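(* Let $G$ be a locally compact groupoid with a left Haar system $\lambda=\{\lambda^u\}_{u\in G^0}$. Let $H$ be a clopen subset of $G$ which forms a subgroupoid, and let $\lambda_H$ be the restriction of $\lambda$ to $H$. Then the natural inclusion $C^*_r(H,\lambda_H)\subseteq C^*_r(G,\lambda)$ admits a conditional expectation $e\colon C^*_r(G,\lambda)\to C^*_r(H,\lambda_H)$.
   Context: A locally compact groupoid (in the sense of Paterson) is a topological groupoid $G$ (continuous multiplication on composable pairs and continuous inversion) with unit space $G^0$, range $r$ and domain $d$, such that: $G^0$ is locally compact Hausdorff; there is a countable family of compact Hausdorff subsets of $G$ whose interiors form a basis of the topology; each $G^u=r^{-1}(u)$ is locally compact Hausdorff; and $G$ is equipped with a left Haar system $\{\lambda^u\}$: positive regular Borel measures $\lambda^u$ on $G^u$ with full support such that $u\mapsto\int_{G^u}g\,d\lambda^u$ lies in $C_c(G^0)$ for all $g\in C_c(G)$, and $\int f(xz)\,d\lambda^{d(x)}(z)=\int f(y)\,d\lambda^{r(x)}(y)$. Here $C_c(G)$ is the linear span of functions which vanish outside some Hausdorff open set $U$ and are continuous and compactly supported on $U$. $C_c(G)$ is a $*$-algebra with $f*g(x)=\int_{G^{r(x)}}f(y)g(y^{-1}x)\,d\lambda^{r(x)}(y)$ and $f^*(x)=\overline{f(x^{-1})}$. With $\lambda_v(E)=\lambda^v(E^{-1})$ on $G_v=d^{-1}(v)$, the regular representation $\mathrm{Ind}\,v$ on $L^2(G_v,\lambda_v)$ is $(\mathrm{Ind}\,v(f)\xi)(x)=\int_{G_v}f(xt^{-1})\xi(t)\,d\lambda_v(t)$,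 and $C^*_r(G,\lambda)$ is the completion of $C_c(G)$ in $\|f\|=\sup_v\|\mathrm{Ind}\,v(f)\|$. A subgroupoid $H$ satisfies $H^0=H\cap G^0$ and inherits $d,r$ and multiplication; if $H$ is open, $\lambda_H$ is given by restricting $\lambda^u$ to $H^u$ for $u\in H^0$, and extension by zero $C_c(H)\subseteq C_c(G)$ induces an inclusion $C^*_r(H,\lambda_H)\subseteq C^*_r(G,\lambda)$. A conditional expectation onto a $C^*$-subalgebra $B\subseteq A$ is a contractive completely positive map $e\colon A\to B$ with $e(b)=b$ and $e(abc)=a\,e(b)\,c$ for $b\in A$, $a,c\in B$. *)

theory Defs
  imports "HOL-Analysis.Analysis"
begin

definition borel_top :: "'a topology \<Rightarrow> 'a measure" where
  "borel_top X = sigma (topspace X) {U. openin X U}"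

definition regular_borel_on :: "'a topology \<Rightarrow> 'a measure \<Rightarrow> bool" where
  "regular_borel_on X \<mu> \<longleftrightarrow>
     space \<mu> = topspace X \<and> sets \<mu> = sets (borel_top X) \<and>
     (\<forall>K. compactin X K \<longrightarrow> emeasure \<mu> K < \<infinity>) \<and>
     (\<forall>E \<in> sets \<mu>. emeasure \<mu> E = (INF U \<in> {U. openin X U \<and> E \<subseteq> U}. emeasure \<mu> U)) \<and>
     (\<forall>U. openin X U \<longrightarrow> emeasure \<mu> U = (SUP K \<in> {K. compactin X K \<and> K \<subseteq> U}. emeasure \<mu> K))"

definition full_support_on :: "'a topology \<Rightarrow> 'a measure \<Rightarrow> bool" where
  "full_support_on X \<mu> \<longleftrightarrow> (\<forall>U. openin X U \<and> U \<noteq> {} \<longrightarrow> emeasure \<mu> U > 0)"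

text \<open>G: arrows, G0: units, r: range, d: domain (source), m: partial multiplication
  (m x y defined when d x = r y), i: inversion.\<close>
definition groupoid ::
  "'g set \<Rightarrow> 'g set \<Rightarrow> ('g \<Rightarrow> 'g) \<Rightarrow> ('g \<Rightarrow> 'g) \<Rightarrow> ('g \<Rightarrow> 'g \<Rightarrow> 'g) \<Rightarrow> ('g \<Rightarrow> 'g) \<Rightarrow> bool" where
  "groupoid G G0 r d m i \<longleftrightarrow>
     G0 \<subseteq> G \<and>
     (\<forall>x\<in>G. r x \<in> G0 \<and> d x \<in> G0) \<and>
     (\<forall>u\<in>G0. r u = u \<and> d u = u) \<and>
     (\<forall>x\<in>G. \<forall>y\<in>G. d x = r y \<longrightarrow> m x y \<in> G \<and> r (m x y) = r x \<and> d (m x y) = d y) \<and>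
     (\<forall>x\<in>G. \<forall>y\<in>G. \<forall>z\<in>G. d x = r y \<and> d y = r z \<longrightarrow> m (m x y) z = m x (m y z)) \<and>
     (\<forall>x\<in>G. m (r x) x = x \<and> m x (d x) = x) \<and>
     (\<forall>x\<in>G. i x \<in> G \<and> r (i x) = d x \<and> d (i x) = r x \<and> m x (i x) = r x \<and> m (i x) x = d x)"

definition composable :: "'g set \<Rightarrow> ('g \<Rightarrow> 'g) \<Rightarrow> ('g \<Rightarrow> 'g) \<Rightarrow> ('g \<times> 'g) set" where
  "composable G r d = {(x, y). x \<in> G \<and> y \<in> G \<and> d x = r y}"

definition topological_groupoid ::
  "'g topology \<Rightarrow> 'g set \<Rightarrow> ('g \<Rightarrow> 'g) \<Rightarrow> ('g \<Rightarrow> 'g) \<Rightarrow> ('g \<Rightarrow> 'g \<Rightarrow> 'g) \<Rightarrow> ('g \<Rightarrow> 'g) \<Rightarrow> bool" where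
  "topological_groupoid T G0 r d m i \<longleftrightarrow>
     groupoid (topspace T) G0 r d m i \<and>
     continuous_map (subtopology (prod_topology T T) (composable (topspace T) r d)) T
        (\<lambda>(x, y). m x y) \<and>
     continuous_map T T i"

definition rfib :: "'g topology \<Rightarrow> ('g \<Rightarrow> 'g) \<Rightarrow> 'g \<Rightarrow> 'g set" where
  "rfib T r u = {x \<in> topspace T. r x = u}"

definition dfib :: "'g topology \<Rightarrow> ('g \<Rightarrow> 'g) \<Rightarrow> 'g \<Rightarrow> 'g set" where
  "dfib T d v = {x \<in> topspace T. d x = v}"

section \<open>The function space C_c(G) (non-Hausdorff version)\<close>

definition cc_basic :: "'g topology \<Rightarrow> ('g \<Rightarrow> complex) \<Rightarrow> bool" where
  "cc_basic X f \<longleftrightarrow>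
     (\<exists>U K. openin X U \<and> Hausdorff_space (subtopology X U) \<and>
        (\<forall>x. x \<notin> U \<longrightarrow> f x = 0) \<and>
        continuous_map (subtopology X U) euclidean f \<and>
        compactin (subtopology X U) K \<and> (\<forall>x\<in>U - K. f x = 0))"

text \<open>C_c: the linear span of the basic functions (they are closed under scalars,
  so finite sums suffice).\<close>
definition Cc :: "'g topology \<Rightarrow> ('g \<Rightarrow> complex) set" where
  "Cc X = {f. \<exists>fs. list_all (cc_basic X) fs \<and> f = (\<lambda>x. \<Sum>g\<leftarrow>fs. g x)}"

definition haar_system ::
  "'g topology \<Rightarrow> 'g set \<Rightarrow> ('g \<Rightarrow> 'g) \<Rightarrow> ('g \<Rightarrow> 'g) \<Rightarrow> ('g \<Rightarrow> 'g \<Rightarrow> 'g) \<Rightarrow> ('g \<Rightarrow> 'g)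
   \<Rightarrow> ('g \<Rightarrow> 'g measure) \<Rightarrow> bool" where
  "haar_system T G0 r d m i lam \<longleftrightarrow>
     (\<forall>u\<in>G0. regular_borel_on (subtopology T (rfib T r u)) (lam u) \<and>
              full_support_on (subtopology T (rfib T r u)) (lam u)) \<and>
     (\<forall>g \<in> Cc T.
        (\<forall>u\<in>G0. integrable (lam u) g) \<and>
        continuous_map (subtopology T G0) euclidean (\<lambda>u. \<integral>y. g y \<partial>lam u) \<and>
        (\<exists>K. compactin (subtopology T G0) K \<and> (\<forall>u\<in>G0 - K. (\<integral>y. g y \<partial>lam u) = 0))) \<and>
     (\<forall>f \<in> Cc T. \<forall>x \<in> topspace T.
        (\<integral>z. f (m x z) \<partial>lam (d x)) = (\<integral>y. f y \<partial>lam (r x)))"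

definition lc_groupoid ::
  "'g topology \<Rightarrow> 'g set \<Rightarrow> ('g \<Rightarrow> 'g) \<Rightarrow> ('g \<Rightarrow> 'g) \<Rightarrow> ('g \<Rightarrow> 'g \<Rightarrow> 'g) \<Rightarrow> ('g \<Rightarrow> 'g)
   \<Rightarrow> ('g \<Rightarrow> 'g measure) \<Rightarrow> bool" where
  "lc_groupoid T G0 r d m i lam \<longleftrightarrow>
     topological_groupoid T G0 r d m i \<and>
     Hausdorff_space (subtopology T G0) \<and> locally_compact_space (subtopology T G0) \<and>
     (\<exists>\<K>. countable \<K> \<and>
        (\<forall>K\<in>\<K>. K \<subseteq> topspace T \<and> compactin T K \<and> Hausdorff_space (subtopology T K)) \<and>
        (\<forall>U. openin T U \<longrightarrow> (\<forall>x\<in>U. \<exists>K\<in>\<K>. x \<in> T interior_of K \<and> T interior_of K \<subseteq> U))) \<and>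
     (\<forall>u\<in>G0. Hausdorff_space (subtopology T (rfib T r u)) \<and>
              locally_compact_space (subtopology T (rfib T r u))) \<and>
     haar_system T G0 r d m i lam"

definition subgroupoid ::
  "'g set \<Rightarrow> ('g \<Rightarrow> 'g) \<Rightarrow> ('g \<Rightarrow> 'g) \<Rightarrow> ('g \<Rightarrow> 'g \<Rightarrow> 'g) \<Rightarrow> ('g \<Rightarrow> 'g) \<Rightarrow> 'g set \<Rightarrow> bool" where
  "subgroupoid G r d m i H \<longleftrightarrow>
     H \<subseteq> G \<and> (\<forall>x\<in>H. r x \<in> H \<and> d x \<in> H \<and> i x \<in> H) \<and>
     (\<forall>x\<in>H. \<forall>y\<in>H. d x = r y \<longrightarrow> m x y \<in> H)"

definition restr_haar :: "('g \<Rightarrow> 'g measure) \<Rightarrow> 'g set \<Rightarrow> 'g \<Rightarrow> 'g measure" where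
  "restr_haar lam H u = restrict_space (lam u) H"

definition conv ::
  "'g topology \<Rightarrow> ('g \<Rightarrow> 'g) \<Rightarrow> ('g \<Rightarrow> 'g \<Rightarrow> 'g) \<Rightarrow> ('g \<Rightarrow> 'g) \<Rightarrow> ('g \<Rightarrow> 'g measure)
   \<Rightarrow> ('g \<Rightarrow> complex) \<Rightarrow> ('g \<Rightarrow> complex) \<Rightarrow> 'g \<Rightarrow> complex" where
  "conv T r m i lam f g = (\<lambda>x. if x \<in> topspace T then (\<integral>y. f y * g (m (i y) x) \<partial>lam (r x)) else 0)"

definition invol :: "'g topology \<Rightarrow> ('g \<Rightarrow> 'g) \<Rightarrow> ('g \<Rightarrow> complex) \<Rightarrow> 'g \<Rightarrow> complex" where
  "invol T i f = (\<lambda>x. if x \<in> topspace T then cnj (f (i x)) else 0)"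

definition lam_d ::
  "'g topology \<Rightarrow> ('g \<Rightarrow> 'g) \<Rightarrow> ('g \<Rightarrow> 'g) \<Rightarrow> ('g \<Rightarrow> 'g measure) \<Rightarrow> 'g \<Rightarrow> 'g measure" where
  "lam_d T d i lam v = distr (lam v) (borel_top (subtopology T (dfib T d v))) i"

definition ind ::
  "'g topology \<Rightarrow> ('g \<Rightarrow> 'g) \<Rightarrow> ('g \<Rightarrow> 'g \<Rightarrow> 'g) \<Rightarrow> ('g \<Rightarrow> 'g) \<Rightarrow> ('g \<Rightarrow> 'g measure) \<Rightarrow> 'g
   \<Rightarrow> ('g \<Rightarrow> complex) \<Rightarrow> ('g \<Rightarrow> complex) \<Rightarrow> 'g \<Rightarrow> complex" where
  "ind T d m i lam v f \<xi> = (\<lambda>x. \<integral>t. f (m x (i t)) * \<xi> t \<partial>lam_d T d i lam v)"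

definition l2sq :: "'g measure \<Rightarrow> ('g \<Rightarrow> complex) \<Rightarrow> ennreal" where
  "l2sq \<mu> \<xi> = (\<integral>\<^sup>+ x. ennreal ((cmod (\<xi> x))\<^sup>2) \<partial>\<mu>)"

definition ind_opnorm_sq ::
  "'g topology \<Rightarrow> ('g \<Rightarrow> 'g) \<Rightarrow> ('g \<Rightarrow> 'g \<Rightarrow> 'g) \<Rightarrow> ('g \<Rightarrow> 'g) \<Rightarrow> ('g \<Rightarrow> 'g measure) \<Rightarrow> 'g
   \<Rightarrow> ('g \<Rightarrow> complex) \<Rightarrow> ennreal" where
  "ind_opnorm_sq T d m i lam v f =
     (SUP \<xi> \<in> {\<xi>. \<xi> \<in> borel_measurable (lam_d T d i lam v) \<and> l2sq (lam_d T d i lam v) \<xi> \<le> 1}.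
        l2sq (lam_d T d i lam v) (ind T d m i lam v f \<xi>))"

definition rnorm ::
  "'g topology \<Rightarrow> 'g set \<Rightarrow> ('g \<Rightarrow> 'g) \<Rightarrow> ('g \<Rightarrow> 'g \<Rightarrow> 'g) \<Rightarrow> ('g \<Rightarrow> 'g) \<Rightarrow> ('g \<Rightarrow> 'g measure)
   \<Rightarrow> ('g \<Rightarrow> complex) \<Rightarrow> real" where
  "rnorm T G0 d m i lam f = sqrt (enn2real (SUP v \<in> G0. ind_opnorm_sq T d m i lam v f))"

section \<open>The reduced C*-algebra as a completion (Cauchy sequences modulo null sequences)\<close>

definition cauchy_in :: "(('g \<Rightarrow> complex) \<Rightarrow> real) \<Rightarrow> ('g \<Rightarrow> complex) set \<Rightarrow> (nat \<Rightarrow> 'g \<Rightarrow> complex) \<Rightarrow> bool" where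
  "cauchy_in N S s \<longleftrightarrow> (\<forall>n. s n \<in> S) \<and>
     (\<forall>\<epsilon>>0. \<exists>K. \<forall>p\<ge>K. \<forall>q\<ge>K. N (\<lambda>x. s p x - s q x) < \<epsilon>)"

definition CrG ::
  "'g topology \<Rightarrow> 'g set \<Rightarrow> ('g \<Rightarrow> 'g) \<Rightarrow> ('g \<Rightarrow> 'g \<Rightarrow> 'g) \<Rightarrow> ('g \<Rightarrow> 'g) \<Rightarrow> ('g \<Rightarrow> 'g measure)
   \<Rightarrow> (nat \<Rightarrow> 'g \<Rightarrow> complex) set" where
  "CrG T G0 d m i lam = {s. cauchy_in (rnorm T G0 d m i lam) (Cc T) s}"

definition cr_eq ::
  "'g topology \<Rightarrow> 'g set \<Rightarrow> ('g \<Rightarrow> 'g) \<Rightarrow> ('g \<Rightarrow> 'g \<Rightarrow> 'g) \<Rightarrow> ('g \<Rightarrow> 'g) \<Rightarrow> ('g \<Rightarrow> 'g measure)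
   \<Rightarrow> (nat \<Rightarrow> 'g \<Rightarrow> complex) \<Rightarrow> (nat \<Rightarrow> 'g \<Rightarrow> complex) \<Rightarrow> bool" where
  "cr_eq T G0 d m i lam a b \<longleftrightarrow>
     (\<lambda>n. rnorm T G0 d m i lam (\<lambda>x. a n x - b n x)) \<longlonglongrightarrow> 0"

definition cr_norm ::
  "'g topology \<Rightarrow> 'g set \<Rightarrow> ('g \<Rightarrow> 'g) \<Rightarrow> ('g \<Rightarrow> 'g \<Rightarrow> 'g) \<Rightarrow> ('g \<Rightarrow> 'g) \<Rightarrow> ('g \<Rightarrow> 'g measure)
   \<Rightarrow> (nat \<Rightarrow> 'g \<Rightarrow> complex) \<Rightarrow> real" where
  "cr_norm T G0 d m i lam a = lim (\<lambda>n. rnorm T G0 d m i lam (a n))"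

definition cr_add :: "(nat \<Rightarrow> 'g \<Rightarrow> complex) \<Rightarrow> (nat \<Rightarrow> 'g \<Rightarrow> complex) \<Rightarrow> nat \<Rightarrow> 'g \<Rightarrow> complex" where
  "cr_add a b = (\<lambda>n x. a n x + b n x)"

definition cr_scale :: "complex \<Rightarrow> (nat \<Rightarrow> 'g \<Rightarrow> complex) \<Rightarrow> nat \<Rightarrow> 'g \<Rightarrow> complex" where
  "cr_scale c a = (\<lambda>n x. c * a n x)"

definition cr_sum :: "nat set \<Rightarrow> (nat \<Rightarrow> nat \<Rightarrow> 'g \<Rightarrow> complex) \<Rightarrow> nat \<Rightarrow> 'g \<Rightarrow> complex" where
  "cr_sum I F = (\<lambda>n x. \<Sum>k\<in>I. F k n x)"

definition cr_mult ::
  "'g topology \<Rightarrow> ('g \<Rightarrow> 'g) \<Rightarrow> ('g \<Rightarrow> 'g \<Rightarrow> 'g) \<Rightarrow> ('g \<Rightarrow> 'g) \<Rightarrow> ('g \<Rightarrow> 'g measure)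
   \<Rightarrow> (nat \<Rightarrow> 'g \<Rightarrow> complex) \<Rightarrow> (nat \<Rightarrow> 'g \<Rightarrow> complex) \<Rightarrow> nat \<Rightarrow> 'g \<Rightarrow> complex" where
  "cr_mult T r m i lam a b = (\<lambda>n. conv T r m i lam (a n) (b n))"

definition cr_star :: "'g topology \<Rightarrow> ('g \<Rightarrow> 'g) \<Rightarrow> (nat \<Rightarrow> 'g \<Rightarrow> complex) \<Rightarrow> nat \<Rightarrow> 'g \<Rightarrow> complex" where
  "cr_star T i a = (\<lambda>n. invol T i (a n))"

text \<open>Image of C*_r(H,lambda_H) in C*_r(G,lambda) under the natural inclusion:
  classes of sequences in C_c(H) (extended by zero) that are Cauchy for the reduced
  norm of (H,lambda_H).\<close>
definition CrH_in_G ::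
  "'g topology \<Rightarrow> 'g set \<Rightarrow> ('g \<Rightarrow> 'g) \<Rightarrow> ('g \<Rightarrow> 'g \<Rightarrow> 'g) \<Rightarrow> ('g \<Rightarrow> 'g) \<Rightarrow> ('g \<Rightarrow> 'g measure)
   \<Rightarrow> 'g set \<Rightarrow> (nat \<Rightarrow> 'g \<Rightarrow> complex) set" where
  "CrH_in_G T G0 d m i lam H =
     {a \<in> CrG T G0 d m i lam. \<exists>s.
        cauchy_in (rnorm (subtopology T H) (H \<inter> G0) d m i (restr_haar lam H)) (Cc (subtopology T H)) s \<and>
        s \<in> CrG T G0 d m i lam \<and> cr_eq T G0 d m i lam a s}"

definition cr_matrix_pos ::
  "'g topology \<Rightarrow> 'g set \<Rightarrow> ('g \<Rightarrow> 'g) \<Rightarrow> ('g \<Rightarrow> 'g) \<Rightarrow> ('g \<Rightarrow> 'g \<Rightarrow> 'g) \<Rightarrow> ('g \<Rightarrow> 'g)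
   \<Rightarrow> ('g \<Rightarrow> 'g measure) \<Rightarrow> nat \<Rightarrow> (nat \<Rightarrow> nat \<Rightarrow> nat \<Rightarrow> 'g \<Rightarrow> complex) \<Rightarrow> bool" where
  "cr_matrix_pos T G0 r d m i lam n X \<longleftrightarrow>
     (\<forall>p<n. \<forall>q<n. X p q \<in> CrG T G0 d m i lam) \<and>
     (\<exists>Y. (\<forall>p<n. \<forall>q<n. Y p q \<in> CrG T G0 d m i lam) \<and>
          (\<forall>p<n. \<forall>q<n. cr_eq T G0 d m i lam (X p q)
             (cr_sum {..<n} (\<lambda>k. cr_mult T r m i lam (cr_star T i (Y k p)) (Y k q)))))"

text \<open>e is a conditional expectation from C*_r(G,lambda) onto the subalgebra B
  (a map on representatives respecting equality in the completion).\<close>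
definition is_cond_exp ::
  "'g topology \<Rightarrow> 'g set \<Rightarrow> ('g \<Rightarrow> 'g) \<Rightarrow> ('g \<Rightarrow> 'g) \<Rightarrow> ('g \<Rightarrow> 'g \<Rightarrow> 'g) \<Rightarrow> ('g \<Rightarrow> 'g)
   \<Rightarrow> ('g \<Rightarrow> 'g measure) \<Rightarrow> (nat \<Rightarrow> 'g \<Rightarrow> complex) set
   \<Rightarrow> ((nat \<Rightarrow> 'g \<Rightarrow> complex) \<Rightarrow> (nat \<Rightarrow> 'g \<Rightarrow> complex)) \<Rightarrow> bool" where
  "is_cond_exp T G0 r d m i lam B e \<longleftrightarrow>
     (let A = CrG T G0 d m i lam; eq = cr_eq T G0 d m i lam; mul = cr_mult T r m i lam in
       (\<forall>a\<in>A. e a \<in> B) \<and>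
       (\<forall>a\<in>A. \<forall>b\<in>A. eq a b \<longrightarrow> eq (e a) (e b)) \<and>
       (\<forall>a\<in>A. \<forall>b\<in>A. eq (e (cr_add a b)) (cr_add (e a) (e b))) \<and>
       (\<forall>c. \<forall>a\<in>A. eq (e (cr_scale c a)) (cr_scale c (e a))) \<and>
       (\<forall>a\<in>A. cr_norm T G0 d m i lam (e a) \<le> cr_norm T G0 d m i lam a) \<and>
       (\<forall>n X. cr_matrix_pos T G0 r d m i lam n X \<longrightarrow>
              cr_matrix_pos T G0 r d m i lam n (\<lambda>p q. e (X p q))) \<and>
       (\<forall>b\<in>B. eq (e b) b) \<and>
       (\<forall>a\<in>B. \<forall>b\<in>A. \<forall>c\<in>B. eq (e (mul (mul a b) c)) (mul (mul a (e b)) c)))"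

end

theory Submission
  imports Defs
begin

text \<open>
  The conditional expectation is restriction of functions to \<open>H\<close>. In the regular representation on
  \<open>L\<^sup>2(G\<^sub>v)\<close> a function \<open>f\<close> acts by the integral kernel \<open>f(x t\<^sup>-\<^sup>1)\<close>, and \<open>G\<^sub>v\<close> is a countable union of
  open classes of the relation \<open>x t\<^sup>-\<^sup>1 \<in> H\<close> and a remainder; restricting \<open>f\<close> to \<open>H\<close> keeps exactly the
  diagonal blocks of its kernel. Hence it is contractive, and it preserves the inequality
  \<open>\<parallel>Z\<xi>\<parallel>\<^sup>2 \<le> K Re \<langle>Z\<xi>, \<xi>\<rangle>\<close>, which every \<open>Z = Y\<^sup>*Y\<close> over the convolution algebra satisfies. To write the
  restricted matrix again as \<open>Y'\<^sup>*Y'\<close>, its square root is approximated by polynomials without constant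
  term (the classical iteration for \<open>1 - sqrt (1 - B)\<close>), so that the approximants stay in \<open>Cc\<close>.
  This needs that \<open>Cc\<close> is closed under convolution also when \<open>G\<close> is not Hausdorff; there, a function
  is cut by a partition of unity into pieces on which the convolution is almost a linear combination of
  functions \<open>u \<mapsto> \<integral>g d\<lambda>\<^sup>u\<close>.
\<close>

section \<open>The square root iteration\<close>

text \<open>Positivity of a matrix means here that it equals Y*Y for a matrix Y over the completion,
  and elements of the completion are Cauchy sequences in \<open>Cc\<close>. Knowing that the
  restricted operators are positive on every L2 space is therefore not enough: a root has to be
  written down as a sequence of functions. This is why an inequality with a constant K is carried
  along instead of plain positivity. Both of its sides are integrals over G_v, so it can be checked
  block by block; and it says that 1 - Z/K is a contraction, which is the input that the iteration
  asks for. K bounds the squared norm of the adjoint of Y and has to be uniform along the Cauchy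
  sequence, so that the rescaled matrices still converge. The second obstacle is that the root is
  not Lipschitz near 0, so closeness of two approximants does not bound the distance of their roots
  by a multiple. A fixed number of steps is Lipschitz, however, and the remaining steps are
  controlled by a scalar sequence that does not depend on the operator. These two facts together
  make the roots a Cauchy sequence.\<close>

text \<open>The value at \<open>B = 1\<close> of the iteration \<open>C \<mapsto> (B + C\<^sup>2) / 2\<close>; its increments bound those of the
  operator iteration \<open>sqC\<close> for every contraction \<open>B\<close>.\<close>
fun sqx :: "nat \<Rightarrow> real" where
  "sqx 0 = 0"
| "sqx (Suc n) = (1 + (sqx n)\<^sup>2) / 2"

lemma sqx_range: "0 \<le> sqx n \<and> sqx n \<le> 1"
proof (induction n)
  case (Suc n)
  then have "(sqx n)\<^sup>2 \<le> 1\<^sup>2" by (intro power_mono) auto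
  then show ?case by simp
qed simp

lemma sqx_Suc_ge: "sqx n \<le> sqx (Suc n)"
proof -
  have "0 \<le> (1 - sqx n)\<^sup>2" by simp
  then show ?thesis by (simp add: power2_diff)
qed

declare sqx.simps(2) [simp del]

text \<open>A limit is a fixed point of x |-> (1 + x^2) / 2, and the fixed point equation is (x -
  1)^2 = 0. The double root makes the convergence slow, but no rate is used below.\<close>

lemma sqx_tendsto: "sqx \<longlonglongrightarrow> 1"
proof -
  have "incseq sqx" using sqx_Suc_ge by (rule incseq_SucI)
  moreover have "bdd_above (range sqx)" using sqx_range by (auto intro!: bdd_aboveI[of _ 1])
  ultimately obtain l where l: "sqx \<longlonglongrightarrow> l"
    using LIMSEQ_incseq_SUP by blast
  then have "(\<lambda>n. sqx (Suc n)) \<longlonglongrightarrow> (1 + l\<^sup>2) / 2"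
    unfolding sqx.simps by (intro tendsto_intros) auto
  moreover have "(\<lambda>n. sqx (Suc n)) \<longlonglongrightarrow> l" using l by (rule LIMSEQ_Suc)
  ultimately have "(1 + l\<^sup>2) / 2 = l" using LIMSEQ_unique by blast
  then have "(l - 1)\<^sup>2 = 0" by (simp add: power2_diff)
  then show ?thesis using l by simp
qed

text \<open>Vectors are functions rather than classes modulo null functions, so \<open>q\<close> is
  only a seminorm. Equations between operators are kept pointwise, since the iteration substitutes
  operators into each other. The locale will be used for tuples of square integrable functions on a
  fibre.\<close>

locale seminormed_functions =
  fixes L :: "('a \<Rightarrow> complex) set" and q :: "('a \<Rightarrow> complex) \<Rightarrow> real"
  assumes L_add: "\<And>a b. a \<in> L \<Longrightarrow> b \<in> L \<Longrightarrow> (\<lambda>z. a z + b z) \<in> L"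
    and L_scale: "\<And>c a. a \<in> L \<Longrightarrow> (\<lambda>z. c * a z) \<in> L"
    and q_add: "\<And>a b. a \<in> L \<Longrightarrow> b \<in> L \<Longrightarrow> q (\<lambda>z. a z + b z) \<le> q a + q b"
    and q_scale: "\<And>c a. a \<in> L \<Longrightarrow> q (\<lambda>z. c * a z) = cmod c * q a"
    and q_nonneg: "\<And>a. a \<in> L \<Longrightarrow> 0 \<le> q a"
    and L_zero: "(\<lambda>z. 0) \<in> L"
begin

lemma q_zero: "q (\<lambda>z. 0) = 0"
  using q_scale[OF L_zero, of 0] by simp

lemma L_diff: "a \<in> L \<Longrightarrow> b \<in> L \<Longrightarrow> (\<lambda>z. a z - b z) \<in> L"
  using L_add[of a "\<lambda>z. (-1) * b z"] L_scale[of b "-1"] by simp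

lemma q_diff: "a \<in> L \<Longrightarrow> b \<in> L \<Longrightarrow> q (\<lambda>z. a z - b z) \<le> q a + q b"
  using q_add[of a "\<lambda>z. (-1) * b z"] L_scale[of b "-1"] q_scale[of b "-1"] by simp

definition linop :: "(('a \<Rightarrow> complex) \<Rightarrow> 'a \<Rightarrow> complex) \<Rightarrow> bool" where
  "linop P \<longleftrightarrow> (\<forall>a\<in>L. P a \<in> L) \<and>
     (\<forall>a\<in>L. \<forall>b\<in>L. P (\<lambda>z. a z + b z) = (\<lambda>z. P a z + P b z)) \<and>
     (\<forall>c. \<forall>a\<in>L. P (\<lambda>z. c * a z) = (\<lambda>z. c * P a z))"

lemma linopD:
  assumes "linop P"
  shows "a \<in> L \<Longrightarrow> P a \<in> L"
    and "a \<in> L \<Longrightarrow> b \<in> L \<Longrightarrow> P (\<lambda>z. a z + b z) = (\<lambda>z. P a z + P b z)"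
    and "a \<in> L \<Longrightarrow> P (\<lambda>z. c * a z) = (\<lambda>z. c * P a z)"
  using assms by (auto simp: linop_def)

lemma linop_diff:
  assumes "linop P" "a \<in> L" "b \<in> L"
  shows "P (\<lambda>z. a z - b z) = (\<lambda>z. P a z - P b z)"
  using linopD(2)[OF assms(1,2) L_scale[OF assms(3), of "-1"]] linopD(3)[OF assms(1,3), of "-1"]
  by simp

lemma linop_sum:
  assumes P: "linop P" and Q: "linop Q"
  shows "linop (\<lambda>a z. P a z + Q a z)"
  unfolding linop_def
proof (intro conjI ballI allI)
  fix a b c assume a: "a \<in> L"
  show "(\<lambda>z. P a z + Q a z) \<in> L" by (intro L_add linopD(1)[OF P a] linopD(1)[OF Q a])
  show "(\<lambda>z. P (\<lambda>z. c * a z) z + Q (\<lambda>z. c * a z) z) = (\<lambda>z. c * (P a z + Q a z))"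
    by (simp only: linopD(3)[OF P a] linopD(3)[OF Q a] distrib_left)
  assume b: "b \<in> L"
  show "(\<lambda>z. P (\<lambda>z. a z + b z) z + Q (\<lambda>z. a z + b z) z)
      = (\<lambda>z. (P a z + Q a z) + (P b z + Q b z))"
    by (simp only: linopD(2)[OF P a b] linopD(2)[OF Q a b] add_ac)
qed

lemma linop_scale:
  assumes P: "linop P"
  shows "linop (\<lambda>a z. k * P a z)"
  unfolding linop_def
proof (intro conjI ballI allI)
  fix a b c assume a: "a \<in> L"
  show "(\<lambda>z. k * P a z) \<in> L" by (intro L_scale linopD(1)[OF P a])
  show "(\<lambda>z. k * P (\<lambda>z. c * a z) z) = (\<lambda>z. c * (k * P a z))"
    by (simp only: linopD(3)[OF P a] mult.left_commute)
  assume b: "b \<in> L"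
  show "(\<lambda>z. k * P (\<lambda>z. a z + b z) z) = (\<lambda>z. k * P a z + k * P b z)"
    by (simp only: linopD(2)[OF P a b] distrib_left)
qed

lemma linop_comp: "linop P \<Longrightarrow> linop Q \<Longrightarrow> linop (\<lambda>a. P (Q a))"
  by (simp add: linop_def)

lemma linop_id: "linop (\<lambda>a. a)"
  by (simp add: linop_def)

text \<open>\<open>sqx n - C\<^sub>n\<close>, where \<open>C\<^sub>n\<close> is the iterate for \<open>B = 1 - A\<close>, rewritten so that no unit occurs: the
  convolution algebra has none.\<close>
fun sqD :: "(('a \<Rightarrow> complex) \<Rightarrow> 'a \<Rightarrow> complex) \<Rightarrow> nat \<Rightarrow> ('a \<Rightarrow> complex) \<Rightarrow> 'a \<Rightarrow> complex" where
  "sqD A 0 \<xi> = (\<lambda>z. 0)"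
| "sqD A (Suc n) \<xi> = (\<lambda>z. A \<xi> z / 2 + sqx n * sqD A n \<xi> z - sqD A n (sqD A n \<xi>) z / 2)"

declare sqD.simps(2) [simp del]

lemma linop_sqD:
  assumes A: "linop A" shows "linop (sqD A n)"
proof (induction n)
  case 0
  then show ?case by (auto simp: linop_def L_zero)
next
  case (Suc n)
  have eq: "sqD A (Suc n) = (\<lambda>(\<xi> :: 'a \<Rightarrow> complex) z. ((1/2) * A \<xi> z + sqx n * sqD A n \<xi> z) + (-1/2) * sqD A n (sqD A n \<xi>) z)"
    by (simp add: fun_eq_iff sqD.simps(2))
  show ?case
    unfolding eq by (intro linop_sum linop_scale linop_comp[OF Suc Suc] A Suc)
qed

text \<open>The iterate itself. It contains a multiple of the identity and thus acts on vectors
  only; the estimates are proved for it and then transferred to \<open>sqD\<close>, which also makes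
  sense inside the algebra.\<close>

definition sqC :: "(('a \<Rightarrow> complex) \<Rightarrow> 'a \<Rightarrow> complex) \<Rightarrow> nat \<Rightarrow> ('a \<Rightarrow> complex) \<Rightarrow> 'a \<Rightarrow> complex" where
  "sqC A n \<xi> = (\<lambda>z. complex_of_real (sqx n) * \<xi> z - sqD A n \<xi> z)"

lemma linop_sqC:
  assumes A: "linop A" shows "linop (sqC A n)"
proof -
  have eq: "sqC A n = (\<lambda>(\<xi> :: 'a \<Rightarrow> complex) z. sqx n * \<xi> z + (-1) * sqD A n \<xi> z)"
    by (simp add: fun_eq_iff sqC_def)
  show ?thesis
    unfolding eq by (intro linop_sum linop_scale linop_id linop_sqD A)
qed

text \<open>With \<open>B = 1 - A\<close> this is the iteration \<open>C \<mapsto> (B + C\<^sup>2) / 2\<close>, whose limit is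
  \<open>1 - sqrt (1 - B)\<close>.\<close>
lemma sqC_Suc:
  assumes A: "linop A" and x: "\<xi> \<in> L"
  shows "sqC A (Suc n) \<xi> = (\<lambda>z. ((\<xi> z - A \<xi> z) + sqC A n (sqC A n \<xi>) z) / 2)"
proof -
  have "sqD A n (sqC A n \<xi>) = (\<lambda>z. sqx n * sqD A n \<xi> z - sqD A n (sqD A n \<xi>) z)"
    unfolding sqC_def
    using linop_diff[OF linop_sqD[OF A], of _ _ n, OF L_scale[OF x] linopD(1)[OF linop_sqD[OF A] x]]
      linopD(3)[OF linop_sqD[OF A] x] by simp
  then have *: "sqC A n (sqC A n \<xi>) z = sqx n * (sqx n * \<xi> z - sqD A n \<xi> z)
      - (sqx n * sqD A n \<xi> z - sqD A n (sqD A n \<xi>) z)" for z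
    by (subst sqC_def) (simp add: sqC_def)
  show ?thesis
    unfolding * by (simp add: sqC_def sqD.simps(2) sqx.simps(2) fun_eq_iff field_simps power2_eq_square)
qed

text \<open>The iterate is a polynomial in 1 - A with nonnegative coefficients, and
  \<open>sqx n\<close> is its value at 1. Since 1 - A is a contraction, that value bounds the
  polynomial.\<close>

lemma sqC_bound:
  assumes A: "linop A" and c: "\<And>\<xi>. \<xi> \<in> L \<Longrightarrow> q (\<lambda>z. \<xi> z - A \<xi> z) \<le> q \<xi>" and "\<xi> \<in> L"
  shows "q (sqC A n \<xi>) \<le> sqx n * q \<xi>"
  using \<open>\<xi> \<in> L\<close>
proof (induction n arbitrary: \<xi>)
  case 0
  then show ?case by (simp add: sqC_def q_zero)
next
  case (Suc n)
  note C = linopD(1)[OF linop_sqC[OF A], of _ n]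
  have m: "(\<lambda>z. \<xi> z - A \<xi> z) \<in> L" using Suc.prems linopD(1)[OF A] L_diff by blast
  have cc: "sqC A n (sqC A n \<xi>) \<in> L" using C Suc.prems by blast
  have "q (sqC A (Suc n) \<xi>) = q (\<lambda>z. (1/2) * ((\<xi> z - A \<xi> z) + sqC A n (sqC A n \<xi>) z))"
    by (simp add: sqC_Suc[OF A Suc.prems])
  also have "\<dots> = (1/2) * q (\<lambda>z. (\<xi> z - A \<xi> z) + sqC A n (sqC A n \<xi>) z)"
    using q_scale[OF L_add[OF m cc], of "1/2"] by simp
  also have "\<dots> \<le> (1/2) * (q (\<lambda>z. \<xi> z - A \<xi> z) + q (sqC A n (sqC A n \<xi>)))"
    using q_add[OF m cc] by simp
  also have "\<dots> \<le> (1/2) * (q \<xi> + sqx n * (sqx n * q \<xi>))"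
  proof -
    have "q (sqC A n (sqC A n \<xi>)) \<le> sqx n * q (sqC A n \<xi>)"
      using Suc.IH C Suc.prems by blast
    also have "\<dots> \<le> sqx n * (sqx n * q \<xi>)"
      using Suc.IH[OF Suc.prems] sqx_range by (simp add: mult_left_mono)
    finally show ?thesis using c[OF Suc.prems] by simp
  qed
  finally show ?case by (simp add: sqx.simps(2) power2_eq_square field_simps)
qed

text \<open>The increments are polynomials in 1 - A with nonnegative coefficients too, so the same
  comparison with the value at 1 works. In the induction the difference of squares is written as (C'
  - C) C' + C (C' - C), where \<open>u\<close> is the first term and C applied to
  \<open>\<delta>\<close> is the second.\<close>

lemma sqC_step:
  assumes A: "linop A" and c: "\<And>\<xi>. \<xi> \<in> L \<Longrightarrow> q (\<lambda>z. \<xi> z - A \<xi> z) \<le> q \<xi>" and "\<xi> \<in> L"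
  shows "q (\<lambda>z. sqC A (Suc n) \<xi> z - sqC A n \<xi> z) \<le> (sqx (Suc n) - sqx n) * q \<xi>"
  using \<open>\<xi> \<in> L\<close>
proof (induction n arbitrary: \<xi>)
  case 0
  have "sqC A 0 \<xi> = (\<lambda>z. 0)" by (simp add: sqC_def)
  moreover have "sqC A (Suc 0) \<xi> \<in> L" using linopD(1)[OF linop_sqC[OF A]] 0 by blast
  ultimately show ?case using sqC_bound[OF A c 0, of "Suc 0"] by simp
next
  case (Suc n)
  let ?C = "sqC A n" and ?C' = "sqC A (Suc n)"
  note C = linopD(1)[OF linop_sqC[OF A]]
  note x = Suc.prems
  define \<delta> where "\<delta> = (\<lambda>z. ?C' \<xi> z - ?C \<xi> z)"
  have \<delta>: "\<delta> \<in> L" unfolding \<delta>_def using C x L_diff by blast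
  define u where "u = (\<lambda>z. ?C' (?C' \<xi>) z - ?C (?C' \<xi>) z)"
  have u: "u \<in> L" unfolding u_def using C x L_diff by blast
  have "?C \<delta> = (\<lambda>z. ?C (?C' \<xi>) z - ?C (?C \<xi>) z)"
    unfolding \<delta>_def using linop_diff[OF linop_sqC[OF A]] C x by blast
  then have "?C \<delta> z = ?C (?C' \<xi>) z - ?C (?C \<xi>) z" for z by simp
  moreover have "?C' \<xi> z = (\<xi> z - A \<xi> z + ?C (?C \<xi>) z) / 2" for z
    using fun_cong[OF sqC_Suc[OF A x]] .
  moreover have "sqC A (Suc (Suc n)) \<xi> z = (\<xi> z - A \<xi> z + ?C' (?C' \<xi>) z) / 2" for z
    using fun_cong[OF sqC_Suc[OF A x]] .
  ultimately have "sqC A (Suc (Suc n)) \<xi> z - ?C' \<xi> z = (1/2) * (u z + ?C \<delta> z)" for z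
    unfolding u_def by (simp only: ) (simp add: field_simps)
  then have "(\<lambda>z. sqC A (Suc (Suc n)) \<xi> z - ?C' \<xi> z) = (\<lambda>z. (1/2) * (u z + ?C \<delta> z))"
    by blast
  then have "q (\<lambda>z. sqC A (Suc (Suc n)) \<xi> z - ?C' \<xi> z) = (1/2) * q (\<lambda>z. u z + ?C \<delta> z)"
    using q_scale[OF L_add[OF u C[OF \<delta>, of n]], of "1/2"] by simp
  also have "\<dots> \<le> (1/2) * (q u + q (?C \<delta>))"
    using q_add[OF u C[OF \<delta>, of n]] by simp
  also have "\<dots> \<le> (1/2) * ((sqx (Suc n) - sqx n) * (sqx (Suc n) * q \<xi>)
      + sqx n * ((sqx (Suc n) - sqx n) * q \<xi>))"
  proof -
    have "q u \<le> (sqx (Suc n) - sqx n) * q (?C' \<xi>)"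
      unfolding u_def using Suc.IH[OF C[OF x]] .
    also have "\<dots> \<le> (sqx (Suc n) - sqx n) * (sqx (Suc n) * q \<xi>)"
      using sqC_bound[OF A c x, of "Suc n"] sqx_Suc_ge[of n] by (intro mult_left_mono) auto
    finally have 1: "q u \<le> \<dots>" .
    have "q (?C \<delta>) \<le> sqx n * q \<delta>" using sqC_bound[OF A c \<delta>] .
    also have "\<dots> \<le> sqx n * ((sqx (Suc n) - sqx n) * q \<xi>)"
      unfolding \<delta>_def using Suc.IH[OF x] sqx_range by (intro mult_left_mono) auto
    finally show ?thesis using 1 by simp
  qed
  also have "\<dots> = ((sqx (Suc n))\<^sup>2 - (sqx n)\<^sup>2) / 2 * q \<xi>"
    by (simp add: power2_eq_square field_simps)
  also have "((sqx (Suc n))\<^sup>2 - (sqx n)\<^sup>2) / 2 = sqx (Suc (Suc n)) - sqx (Suc n)"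
    by (simp add: sqx.simps(2) field_simps)
  finally show ?case .
qed

lemma sqC_diff:
  assumes A: "linop A" and c: "\<And>\<xi>. \<xi> \<in> L \<Longrightarrow> q (\<lambda>z. \<xi> z - A \<xi> z) \<le> q \<xi>" and x: "\<xi> \<in> L"
    and "k \<le> n"
  shows "q (\<lambda>z. sqC A n \<xi> z - sqC A k \<xi> z) \<le> (sqx n - sqx k) * q \<xi>"
  using \<open>k \<le> n\<close>
proof (induction n rule: dec_induct)
  case base
  then show ?case by (simp add: q_zero)
next
  case (step n)
  note C = linopD(1)[OF linop_sqC[OF A] x]
  have "q (\<lambda>z. (sqC A (Suc n) \<xi> z - sqC A n \<xi> z) + (sqC A n \<xi> z - sqC A k \<xi> z))
      \<le> (sqx (Suc n) - sqx n) * q \<xi> + (sqx n - sqx k) * q \<xi>"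
    using q_add[OF L_diff[OF C[of "Suc n"] C[of n]] L_diff[OF C[of n] C[of k]]]
      sqC_step[OF A c x, of n] step.IH by linarith
  then show ?case by (simp add: algebra_simps)
qed

lemma sqD_bound:
  assumes A: "linop A" and c: "\<And>\<xi>. \<xi> \<in> L \<Longrightarrow> q (\<lambda>z. \<xi> z - A \<xi> z) \<le> q \<xi>" and x: "\<xi> \<in> L"
  shows "q (sqD A n \<xi>) \<le> 2 * q \<xi>"
proof -
  note C = linopD(1)[OF linop_sqC[OF A] x]
  have "q (sqD A n \<xi>) = q (\<lambda>z. sqx n * \<xi> z - sqC A n \<xi> z)"
    by (rule arg_cong[where f=q]) (simp add: sqC_def)
  also have "\<dots> \<le> q (\<lambda>z. sqx n * \<xi> z) + q (sqC A n \<xi>)"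
    by (rule q_diff[OF L_scale[OF x] C])
  also have "\<dots> \<le> sqx n * q \<xi> + sqx n * q \<xi>"
    using q_scale[OF x, of "sqx n"] sqC_bound[OF A c x, of n] sqx_range[of n] by simp
  also have "\<dots> \<le> 2 * q \<xi>"
    using mult_right_mono[of "sqx n" 1 "q \<xi>"] sqx_range[of n] q_nonneg[OF x] by simp
  finally show ?thesis .
qed

text \<open>The factor 2 counts the change of the scalar part \<open>sqx\<close> and the change of
  \<open>sqC\<close>, both bounded by the same increment.\<close>

lemma sqD_diff:
  assumes A: "linop A" and c: "\<And>\<xi>. \<xi> \<in> L \<Longrightarrow> q (\<lambda>z. \<xi> z - A \<xi> z) \<le> q \<xi>" and x: "\<xi> \<in> L"
    and k: "k \<le> n"
  shows "q (\<lambda>z. sqD A n \<xi> z - sqD A k \<xi> z) \<le> 2 * (sqx n - sqx k) * q \<xi>"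
proof -
  note C = linopD(1)[OF linop_sqC[OF A] x]
  have mono: "sqx k \<le> sqx n" using k incseq_SucI[of sqx] sqx_Suc_ge by (auto simp: incseq_def)
  have "q (\<lambda>z. sqD A n \<xi> z - sqD A k \<xi> z)
      = q (\<lambda>z. complex_of_real (sqx n - sqx k) * \<xi> z - (sqC A n \<xi> z - sqC A k \<xi> z))"
    by (rule arg_cong[where f=q]) (simp add: sqC_def algebra_simps)
  also have "\<dots> \<le> q (\<lambda>z. complex_of_real (sqx n - sqx k) * \<xi> z) + q (\<lambda>z. sqC A n \<xi> z - sqC A k \<xi> z)"
    by (rule q_diff[OF L_scale[OF x] L_diff[OF C C]])
  also have "\<dots> \<le> (sqx n - sqx k) * q \<xi> + (sqx n - sqx k) * q \<xi>"
    unfolding q_scale[OF x] norm_of_real using sqC_diff[OF A c x k] mono by (intro add_mono) auto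
  finally show ?thesis by (simp add: algebra_simps)
qed

text \<open>Solving the recursion for the square gives D_n^2 - A = -2 (D_{n+1} - D_n) - 2 (1 - sqx
  n) D_n. So the defect of D_n as a root of A is governed by one step of the iteration and by 1 -
  sqx n. The constant 8 is 4 + 4 from these two terms.\<close>

lemma sqD_square:
  assumes A: "linop A" and c: "\<And>\<xi>. \<xi> \<in> L \<Longrightarrow> q (\<lambda>z. \<xi> z - A \<xi> z) \<le> q \<xi>" and x: "\<xi> \<in> L"
  shows "q (\<lambda>z. sqD A n (sqD A n \<xi>) z - A \<xi> z) \<le> 8 * (1 - sqx n) * q \<xi>"
proof -
  note D = linopD(1)[OF linop_sqD[OF A] x]
  have "q (\<lambda>z. sqD A n (sqD A n \<xi>) z - A \<xi> z)
    = q (\<lambda>z. (-2) * (sqD A (Suc n) \<xi> z - sqD A n \<xi> z) - complex_of_real (2 * (1 - sqx n)) * sqD A n \<xi> z)"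
    by (rule arg_cong[where f=q]) (simp add: fun_eq_iff sqD.simps(2) algebra_simps)
  also have "\<dots> \<le> q (\<lambda>z. (-2) * (sqD A (Suc n) \<xi> z - sqD A n \<xi> z))
      + q (\<lambda>z. complex_of_real (2 * (1 - sqx n)) * sqD A n \<xi> z)"
    by (intro q_diff L_scale L_diff D)
  also have "q (\<lambda>z. (-2) * (sqD A (Suc n) \<xi> z - sqD A n \<xi> z))
      \<le> 4 * (sqx (Suc n) - sqx n) * q \<xi>"
    using sqD_diff[OF A c x, of n "Suc n"] q_scale[OF L_diff[OF D[of "Suc n"] D[of n]], of "-2"]
    by (simp add: algebra_simps)
  also have "4 * (sqx (Suc n) - sqx n) * q \<xi> \<le> 4 * (1 - sqx n) * q \<xi>"
    using sqx_range[of "Suc n"] q_nonneg[OF x] by (intro mult_right_mono) auto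
  also have "q (\<lambda>z. complex_of_real (2 * (1 - sqx n)) * sqD A n \<xi> z) \<le> 2 * (1 - sqx n) * (2 * q \<xi>)"
    unfolding q_scale[OF D] norm_of_real
    using sqD_bound[OF A c x, of n] sqx_range[of n] by (intro mult_mono) (auto simp: q_nonneg D)
  finally show ?thesis by (simp add: algebra_simps)
qed

text \<open>If two contractions are at distance e, their squares are at distance at most 2 e, which
  the factor 1/2 of the recursion brings back to e; the change from A to A' contributes half of
  \<open>\<delta>\<close> in every step. The bound thus grows only linearly with n.\<close>

lemma sqC_perturb:
  assumes A: "linop A" and c: "\<And>\<xi>. \<xi> \<in> L \<Longrightarrow> q (\<lambda>z. \<xi> z - A \<xi> z) \<le> q \<xi>"
    and A': "linop A'" and c': "\<And>\<xi>. \<xi> \<in> L \<Longrightarrow> q (\<lambda>z. \<xi> z - A' \<xi> z) \<le> q \<xi>"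
    and d: "\<And>\<xi>. \<xi> \<in> L \<Longrightarrow> q (\<lambda>z. A \<xi> z - A' \<xi> z) \<le> \<delta> * q \<xi>" and d0: "0 \<le> \<delta>"
    and "\<xi> \<in> L"
  shows "q (\<lambda>z. sqC A n \<xi> z - sqC A' n \<xi> z) \<le> real n * \<delta> * q \<xi>"
  using \<open>\<xi> \<in> L\<close>
proof (induction n arbitrary: \<xi>)
  case 0
  then show ?case by (simp add: sqC_def q_zero)
next
  case (Suc n)
  let ?C = "sqC A n" and ?C' = "sqC A' n"
  note C = linopD(1)[OF linop_sqC[OF A], of _ n] and C' = linopD(1)[OF linop_sqC[OF A'], of _ n]
  note x = Suc.prems
  define w where "w = (\<lambda>z. ?C \<xi> z - ?C' \<xi> z)"
  have w: "w \<in> L" unfolding w_def by (rule L_diff[OF C[OF x] C'[OF x]])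
  define u where "u = (\<lambda>z. ?C (?C' \<xi>) z - ?C' (?C' \<xi>) z)"
  have u: "u \<in> L" unfolding u_def by (rule L_diff[OF C[OF C'[OF x]] C'[OF C'[OF x]]])
  define a where "a = (\<lambda>z. A \<xi> z - A' \<xi> z)"
  have a: "a \<in> L" unfolding a_def by (rule L_diff[OF linopD(1)[OF A x] linopD(1)[OF A' x]])
  have "?C w = (\<lambda>z. ?C (?C \<xi>) z - ?C (?C' \<xi>) z)"
    unfolding w_def by (rule linop_diff[OF linop_sqC[OF A] C[OF x] C'[OF x]])
  then have "?C w z = ?C (?C \<xi>) z - ?C (?C' \<xi>) z" for z by simp
  moreover note fun_cong[OF sqC_Suc[OF A x, of n]] fun_cong[OF sqC_Suc[OF A' x, of n]]
  ultimately have "sqC A (Suc n) \<xi> z - sqC A' (Suc n) \<xi> z = (1/2) * ((u z + ?C w z) - a z)" for z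
    unfolding u_def a_def by (simp only: ) (simp add: field_simps)
  then have "(\<lambda>z. sqC A (Suc n) \<xi> z - sqC A' (Suc n) \<xi> z) = (\<lambda>z. (1/2) * ((u z + ?C w z) - a z))"
    by blast
  then have "q (\<lambda>z. sqC A (Suc n) \<xi> z - sqC A' (Suc n) \<xi> z) = (1/2) * q (\<lambda>z. (u z + ?C w z) - a z)"
    using q_scale[OF L_diff[OF L_add[OF u C[OF w]] a], of "1/2"] by simp
  also have "\<dots> \<le> (1/2) * (q u + q (?C w) + q a)"
    using q_diff[OF L_add[OF u C[OF w]] a] q_add[OF u C[OF w]] by simp
  also have "\<dots> \<le> (1/2) * (real n * \<delta> * q \<xi> + real n * \<delta> * q \<xi> + \<delta> * q \<xi>)"
  proof -
    have le1: "sqx n * q \<eta> \<le> q \<eta>" if "\<eta> \<in> L" for \<eta>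
      using mult_right_mono[of "sqx n" 1 "q \<eta>"] sqx_range[of n] q_nonneg[OF that] by simp
    have "q u \<le> real n * \<delta> * q (?C' \<xi>)"
      unfolding u_def using Suc.IH C' x by blast
    also have "\<dots> \<le> real n * \<delta> * q \<xi>"
      using sqC_bound[OF A' c' x, of n] le1[OF x] d0 by (intro mult_left_mono) auto
    finally have 1: "q u \<le> \<dots>" .
    have "q (?C w) \<le> q w" using sqC_bound[OF A c w, of n] le1[OF w] by linarith
    also have "\<dots> \<le> real n * \<delta> * q \<xi>" unfolding w_def using Suc.IH[OF x] .
    finally show ?thesis using 1 d[OF x] unfolding a_def by (intro mult_left_mono add_mono) auto
  qed
  also have "\<dots> \<le> real (Suc n) * \<delta> * q \<xi>"
    using d0 q_nonneg[OF x] by (simp add: algebra_simps)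
  finally show ?case .
qed

lemma sqD_perturb:
  assumes A: "linop A" and c: "\<And>\<xi>. \<xi> \<in> L \<Longrightarrow> q (\<lambda>z. \<xi> z - A \<xi> z) \<le> q \<xi>"
    and A': "linop A'" and c': "\<And>\<xi>. \<xi> \<in> L \<Longrightarrow> q (\<lambda>z. \<xi> z - A' \<xi> z) \<le> q \<xi>"
    and d: "\<And>\<xi>. \<xi> \<in> L \<Longrightarrow> q (\<lambda>z. A \<xi> z - A' \<xi> z) \<le> \<delta> * q \<xi>" and d0: "0 \<le> \<delta>"
    and x: "\<xi> \<in> L"
  shows "q (\<lambda>z. sqD A n \<xi> z - sqD A' n \<xi> z) \<le> real n * \<delta> * q \<xi>"
proof -
  have m: "(\<lambda>z. sqC A n \<xi> z - sqC A' n \<xi> z) \<in> L"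
    using linopD(1)[OF linop_sqC x] A A' L_diff by blast
  have "q (\<lambda>z. sqD A n \<xi> z - sqD A' n \<xi> z) = q (\<lambda>z. (-1) * (sqC A n \<xi> z - sqC A' n \<xi> z))"
    by (rule arg_cong[where f=q]) (simp add: sqC_def)
  also have "\<dots> = q (\<lambda>z. sqC A n \<xi> z - sqC A' n \<xi> z)"
    using q_scale[OF m, of "-1"] by simp
  finally show ?thesis using sqC_perturb[OF A c A' c' d d0 x, of n] by simp
qed

text \<open>The iterates of nearby operators form a Cauchy family: \<open>k\<close> is chosen first to make
  \<open>1 - sqx k\<close> small, then the operators are required to be close.\<close>
lemma sqD_cauchy:
  assumes A: "linop A" and c: "\<And>\<xi>. \<xi> \<in> L \<Longrightarrow> q (\<lambda>z. \<xi> z - A \<xi> z) \<le> q \<xi>"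
    and A': "linop A'" and c': "\<And>\<xi>. \<xi> \<in> L \<Longrightarrow> q (\<lambda>z. \<xi> z - A' \<xi> z) \<le> q \<xi>"
    and d: "\<And>\<xi>. \<xi> \<in> L \<Longrightarrow> q (\<lambda>z. A \<xi> z - A' \<xi> z) \<le> \<delta> * q \<xi>" and d0: "0 \<le> \<delta>"
    and x: "\<xi> \<in> L" and k: "k \<le> n" "k \<le> n'"
  shows "q (\<lambda>z. sqD A n \<xi> z - sqD A' n' \<xi> z) \<le> (4 * (1 - sqx k) + real k * \<delta>) * q \<xi>"
proof -
  note D = linopD(1)[OF linop_sqD[OF A] x] and D' = linopD(1)[OF linop_sqD[OF A'] x]
  have 1: "q (\<lambda>z. sqD A n \<xi> z - sqD A k \<xi> z) \<le> 2 * (1 - sqx k) * q \<xi>"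
    using sqD_diff[OF A c x k(1)] mult_right_mono[of "2 * (sqx n - sqx k)" "2 * (1 - sqx k)" "q \<xi>"]
      sqx_range[of n] q_nonneg[OF x] by simp
  have 2: "q (\<lambda>z. sqD A' n' \<xi> z - sqD A' k \<xi> z) \<le> 2 * (1 - sqx k) * q \<xi>"
    using sqD_diff[OF A' c' x k(2)] mult_right_mono[of "2 * (sqx n' - sqx k)" "2 * (1 - sqx k)" "q \<xi>"]
      sqx_range[of n'] q_nonneg[OF x] by simp
  have "q (\<lambda>z. sqD A n \<xi> z - sqD A' n' \<xi> z)
     = q (\<lambda>z. ((sqD A n \<xi> z - sqD A k \<xi> z) + (sqD A k \<xi> z - sqD A' k \<xi> z))
           - (sqD A' n' \<xi> z - sqD A' k \<xi> z))"
    by (rule arg_cong[where f=q]) simp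
  also have "\<dots> \<le> q (\<lambda>z. (sqD A n \<xi> z - sqD A k \<xi> z) + (sqD A k \<xi> z - sqD A' k \<xi> z))
      + q (\<lambda>z. sqD A' n' \<xi> z - sqD A' k \<xi> z)"
    by (intro q_diff L_add L_diff D D')
  also have "q (\<lambda>z. (sqD A n \<xi> z - sqD A k \<xi> z) + (sqD A k \<xi> z - sqD A' k \<xi> z))
      \<le> q (\<lambda>z. sqD A n \<xi> z - sqD A k \<xi> z) + q (\<lambda>z. sqD A k \<xi> z - sqD A' k \<xi> z)"
    by (intro q_add L_diff D D')
  finally have "q (\<lambda>z. sqD A n \<xi> z - sqD A' n' \<xi> z)
      \<le> 2 * (1 - sqx k) * q \<xi> + real k * \<delta> * q \<xi> + 2 * (1 - sqx k) * q \<xi>"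
    using 1 2 sqD_perturb[OF A c A' c' d d0 x, of k] by linarith
  then show ?thesis by (simp add: algebra_simps)
qed

end

section \<open>Square integrable functions and Schur kernels\<close>

text \<open>Functions instead of classes modulo null functions, because the operators below are
  given by integrals at every point and satisfy their identities at every point.\<close>

definition L2 :: "'a measure \<Rightarrow> ('a \<Rightarrow> complex) set" where
  "L2 M = {\<xi> \<in> borel_measurable M. integrable M (\<lambda>x. (cmod (\<xi> x))\<^sup>2)}"

definition n2 :: "'a measure \<Rightarrow> ('a \<Rightarrow> complex) \<Rightarrow> real" where
  "n2 M \<xi> = sqrt (\<integral>x. (cmod (\<xi> x))\<^sup>2 \<partial>M)"

definition ip2 :: "'a measure \<Rightarrow> ('a \<Rightarrow> complex) \<Rightarrow> ('a \<Rightarrow> complex) \<Rightarrow> complex" where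
  "ip2 M \<xi> \<eta> = (\<integral>x. cnj (\<xi> x) * \<eta> x \<partial>M)"

lemma borel_measurable_cnj:
  "f \<in> borel_measurable M \<Longrightarrow> (\<lambda>x. cnj (f x)) \<in> borel_measurable M"
  by (rule measurable_compose[OF _ borel_measurable_continuous_onI]) (auto intro!: continuous_intros)

lemma L2_measurable [measurable_dest]: "\<xi> \<in> L2 M \<Longrightarrow> \<xi> \<in> borel_measurable M"
  by (simp add: L2_def)

lemma L2_integrable: "\<xi> \<in> L2 M \<Longrightarrow> integrable M (\<lambda>x. (cmod (\<xi> x))\<^sup>2)"
  by (simp add: L2_def)

lemma L2_iff_l2sq: "\<xi> \<in> L2 M \<longleftrightarrow> \<xi> \<in> borel_measurable M \<and> l2sq M \<xi> < \<infinity>"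
  unfolding L2_def l2sq_def by (auto simp: integrable_iff_bounded)

lemma n2_nonneg: "0 \<le> n2 M \<xi>"
  by (simp add: n2_def)

lemma n2_square: "(n2 M \<xi>)\<^sup>2 = (\<integral>x. (cmod (\<xi> x))\<^sup>2 \<partial>M)"
  by (simp add: n2_def)

text \<open>Without integrability the integral in \<open>n2\<close> is 0 by convention. The passage
  between \<open>n2\<close> and the extended valued \<open>l2sq\<close> of the definitions therefore
  always goes through membership in \<open>L2\<close>.\<close>

lemma l2sq_n2: "\<xi> \<in> L2 M \<Longrightarrow> l2sq M \<xi> = ennreal ((n2 M \<xi>)\<^sup>2)"
  unfolding n2_square l2sq_def by (rule nn_integral_eq_integral) (auto simp: L2_integrable)

lemma L2_mult_integrable:
  assumes "\<xi> \<in> L2 M" "\<eta> \<in> L2 M"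
  shows "integrable M (\<lambda>x. \<xi> x * \<eta> x)"
proof (rule Bochner_Integration.integrable_bound)
  show "integrable M (\<lambda>x. (cmod (\<xi> x))\<^sup>2 + (cmod (\<eta> x))\<^sup>2)"
    using assms by (intro Bochner_Integration.integrable_add L2_integrable)
  show "(\<lambda>x. \<xi> x * \<eta> x) \<in> borel_measurable M"
    using assms by measurable
  have "a * b \<le> a\<^sup>2 + b\<^sup>2" if "0 \<le> a" "0 \<le> b" for a b :: real
  proof -
    have "2 * (a * b) \<le> a\<^sup>2 + b\<^sup>2" using sum_squares_bound[of a b] by simp
    moreover have "0 \<le> a * b" using that by simp
    ultimately show ?thesis by linarith
  qed
  then show "AE x in M. cmod (\<xi> x * \<eta> x) \<le> norm ((cmod (\<xi> x))\<^sup>2 + (cmod (\<eta> x))\<^sup>2)"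
    by (auto simp: norm_mult)
qed

lemma L2_scale: "\<xi> \<in> L2 M \<Longrightarrow> (\<lambda>x. c * \<xi> x) \<in> L2 M"
  by (auto simp: L2_def norm_mult power_mult_distrib)

lemma L2_add:
  assumes "\<xi> \<in> L2 M" "\<eta> \<in> L2 M" shows "(\<lambda>x. \<xi> x + \<eta> x) \<in> L2 M"
proof -
  have "integrable M (\<lambda>x. (cmod (\<xi> x + \<eta> x))\<^sup>2)"
  proof (rule Bochner_Integration.integrable_bound)
    show "integrable M (\<lambda>x. 2 * (cmod (\<xi> x))\<^sup>2 + 2 * (cmod (\<eta> x))\<^sup>2)"
      using assms by (auto intro!: Bochner_Integration.integrable_add L2_integrable)
    show "(\<lambda>x. (cmod (\<xi> x + \<eta> x))\<^sup>2) \<in> borel_measurable M"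
      using assms by measurable
    have "(cmod (a + b))\<^sup>2 \<le> 2 * (cmod a)\<^sup>2 + 2 * (cmod b)\<^sup>2" for a b
    proof -
      have "(cmod (a + b))\<^sup>2 \<le> (cmod a + cmod b)\<^sup>2" by (intro power_mono norm_triangle_ineq) simp
      also have "\<dots> \<le> 2 * (cmod a)\<^sup>2 + 2 * (cmod b)\<^sup>2"
        using sum_squares_bound[of "cmod a" "cmod b"] by (simp add: power2_sum)
      finally show ?thesis .
    qed
    then show "AE x in M. norm ((cmod (\<xi> x + \<eta> x))\<^sup>2) \<le> norm (2 * (cmod (\<xi> x))\<^sup>2 + 2 * (cmod (\<eta> x))\<^sup>2)"
      by auto
  qed
  moreover have "(\<lambda>x. \<xi> x + \<eta> x) \<in> borel_measurable M"
    using assms by measurable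
  ultimately show ?thesis by (simp add: L2_def)
qed

lemma L2_zero: "(\<lambda>x. 0) \<in> L2 M"
  by (simp add: L2_def)

lemma L2_sum: "(\<And>k. k \<in> I \<Longrightarrow> f k \<in> L2 M) \<Longrightarrow> (\<lambda>x. \<Sum>k\<in>I. f k x) \<in> L2 M"
  by (induction I rule: infinite_finite_induct) (auto simp: L2_add L2_zero)

lemma L2_cmod: "\<xi> \<in> L2 M \<Longrightarrow> (\<lambda>x. complex_of_real (cmod (\<xi> x))) \<in> L2 M"
  by (auto simp: L2_def)

lemma L2_cnj: "\<xi> \<in> L2 M \<Longrightarrow> (\<lambda>x. cnj (\<xi> x)) \<in> L2 M"
  by (auto simp: L2_def intro: borel_measurable_cnj)

lemma ip2_integrable: "\<xi> \<in> L2 M \<Longrightarrow> \<eta> \<in> L2 M \<Longrightarrow> integrable M (\<lambda>x. cnj (\<xi> x) * \<eta> x)"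
  by (intro L2_mult_integrable L2_cnj)

lemma L2_indicator:
  assumes "\<xi> \<in> L2 M" "E \<in> sets M" shows "(\<lambda>x. if x \<in> E then \<xi> x else 0) \<in> L2 M"
proof -
  have "integrable M (\<lambda>x. indicator E x *\<^sub>R (cmod (\<xi> x))\<^sup>2)"
    using assms by (intro integrable_mult_indicator L2_integrable)
  moreover have "(\<lambda>x. indicator E x *\<^sub>R (cmod (\<xi> x))\<^sup>2) = (\<lambda>x. (cmod (if x \<in> E then \<xi> x else 0))\<^sup>2)"
    by (auto simp: fun_eq_iff)
  moreover have "(\<lambda>x. if x \<in> E then \<xi> x else 0) \<in> borel_measurable M"
    using assms by measurable
  ultimately show ?thesis by (simp add: L2_def)
qed

lemma ip2_self: "\<xi> \<in> L2 M \<Longrightarrow> ip2 M \<xi> \<xi> = complex_of_real ((n2 M \<xi>)\<^sup>2)"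
  unfolding n2_square ip2_def
  by (simp only: mult.commute[of "cnj _"] complex_norm_square[symmetric] integral_complex_of_real)

lemma cauchy_schwarz_L2:
  assumes "\<xi> \<in> L2 M" "\<eta> \<in> L2 M"
  shows "(\<integral>x. cmod (\<xi> x) * cmod (\<eta> x) \<partial>M) \<le> n2 M \<xi> * n2 M \<eta>"
proof -
  have i: "integrable M (\<lambda>x. cmod (\<xi> x) * cmod (\<eta> x))"
    using integrable_norm[OF L2_mult_integrable[OF assms]] by (simp add: norm_mult)
  have [measurable]: "\<xi> \<in> borel_measurable M" "\<eta> \<in> borel_measurable M" using assms by auto
  let ?I = "\<integral>x. cmod (\<xi> x) * cmod (\<eta> x) \<partial>M"
  have I0: "0 \<le> ?I" by simp
  have "ennreal (?I\<^sup>2) = (ennreal ?I)\<^sup>2" using I0 by (simp add: ennreal_power)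
  also have "ennreal ?I = (\<integral>\<^sup>+x. ennreal (cmod (\<xi> x)) * ennreal (cmod (\<eta> x)) \<partial>M)"
    using i by (subst nn_integral_eq_integral[symmetric]) (auto simp: ennreal_mult)
  also have "\<dots>\<^sup>2 \<le> (\<integral>\<^sup>+x. (ennreal (cmod (\<xi> x)))\<^sup>2 \<partial>M) * (\<integral>\<^sup>+x. (ennreal (cmod (\<eta> x)))\<^sup>2 \<partial>M)"
    by (rule Cauchy_Schwarz_nn_integral) auto
  also have "\<dots> = l2sq M \<xi> * l2sq M \<eta>"
    by (simp add: l2sq_def ennreal_power)
  also have "\<dots> = ennreal ((n2 M \<xi> * n2 M \<eta>)\<^sup>2)"
    using assms by (simp add: l2sq_n2 ennreal_mult power_mult_distrib)
  finally have "?I\<^sup>2 \<le> (n2 M \<xi> * n2 M \<eta>)\<^sup>2" by (simp add: ennreal_le_iff)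
  then show ?thesis by (rule power2_le_imp_le) (simp add: n2_nonneg)
qed

lemma ip2_le:
  assumes "\<xi> \<in> L2 M" "\<eta> \<in> L2 M"
  shows "cmod (ip2 M \<xi> \<eta>) \<le> n2 M \<xi> * n2 M \<eta>"
proof -
  have "cmod (ip2 M \<xi> \<eta>) \<le> (\<integral>x. cmod (cnj (\<xi> x) * \<eta> x) \<partial>M)"
    unfolding ip2_def by (rule integral_norm_bound)
  also have "\<dots> \<le> n2 M \<xi> * n2 M \<eta>"
    using cauchy_schwarz_L2[OF assms] by (simp add: norm_mult)
  finally show ?thesis .
qed

lemma n2_add:
  assumes "\<xi> \<in> L2 M" "\<eta> \<in> L2 M"
  shows "n2 M (\<lambda>x. \<xi> x + \<eta> x) \<le> n2 M \<xi> + n2 M \<eta>"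
proof -
  have i: "integrable M (\<lambda>x. cmod (\<xi> x) * cmod (\<eta> x))"
    using integrable_norm[OF L2_mult_integrable[OF assms]] by (simp add: norm_mult)
  note ii = i L2_integrable[OF assms(1)] L2_integrable[OF assms(2)]
  have "(n2 M (\<lambda>x. \<xi> x + \<eta> x))\<^sup>2 = (\<integral>x. (cmod (\<xi> x + \<eta> x))\<^sup>2 \<partial>M)" by (rule n2_square)
  also have "\<dots> \<le> (\<integral>x. (cmod (\<xi> x))\<^sup>2 + (cmod (\<eta> x))\<^sup>2 + 2 * (cmod (\<xi> x) * cmod (\<eta> x)) \<partial>M)"
  proof (rule integral_mono)
    show "integrable M (\<lambda>x. (cmod (\<xi> x + \<eta> x))\<^sup>2)" using L2_add[OF assms] by (rule L2_integrable)
    show "integrable M (\<lambda>x. (cmod (\<xi> x))\<^sup>2 + (cmod (\<eta> x))\<^sup>2 + 2 * (cmod (\<xi> x) * cmod (\<eta> x)))"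
      using ii by auto
    fix x
    have "(cmod (\<xi> x + \<eta> x))\<^sup>2 \<le> (cmod (\<xi> x) + cmod (\<eta> x))\<^sup>2"
      by (intro power_mono norm_triangle_ineq) simp
    then show "(cmod (\<xi> x + \<eta> x))\<^sup>2 \<le> (cmod (\<xi> x))\<^sup>2 + (cmod (\<eta> x))\<^sup>2 + 2 * (cmod (\<xi> x) * cmod (\<eta> x))"
      by (simp add: power2_sum)
  qed
  also have "\<dots> = (n2 M \<xi>)\<^sup>2 + (n2 M \<eta>)\<^sup>2 + 2 * (\<integral>x. cmod (\<xi> x) * cmod (\<eta> x) \<partial>M)"
    using ii by (simp add: n2_square)
  also have "\<dots> \<le> (n2 M \<xi> + n2 M \<eta>)\<^sup>2"
    using cauchy_schwarz_L2[OF assms] by (simp add: power2_sum)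
  finally show ?thesis by (rule power2_le_imp_le) (simp add: n2_nonneg)
qed

lemma n2_scale: "n2 M (\<lambda>x. c * \<xi> x) = cmod c * n2 M \<xi>"
  by (simp add: n2_def norm_mult power_mult_distrib real_sqrt_mult)

section \<open>Integral operators and Schur's test\<close>

definition schur_kernel :: "'a measure \<Rightarrow> real \<Rightarrow> ('a \<Rightarrow> 'a \<Rightarrow> complex) \<Rightarrow> bool" where
  "schur_kernel M C K \<longleftrightarrow> 0 \<le> C \<and> (\<lambda>(x, t). K x t) \<in> borel_measurable (M \<Otimes>\<^sub>M M) \<and>
     (\<forall>x\<in>space M. \<forall>t\<in>space M. cmod (K x t) \<le> C) \<and>
     (\<forall>x\<in>space M. (\<integral>\<^sup>+t. ennreal (cmod (K x t)) \<partial>M) \<le> ennreal C) \<and>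
     (\<forall>t\<in>space M. (\<integral>\<^sup>+x. ennreal (cmod (K x t)) \<partial>M) \<le> ennreal C)"

text \<open>The value 0 outside the space allows identities between operators to be stated as
  equations of functions.\<close>

definition kop :: "'a measure \<Rightarrow> ('a \<Rightarrow> 'a \<Rightarrow> complex) \<Rightarrow> ('a \<Rightarrow> complex) \<Rightarrow> 'a \<Rightarrow> complex" where
  "kop M K \<xi> = (\<lambda>x. if x \<in> space M then (\<integral>t. K x t * \<xi> t \<partial>M) else 0)"

context sigma_finite_measure
begin

lemma schur_measurable: "schur_kernel M C K \<Longrightarrow> (\<lambda>(x, t). K x t) \<in> borel_measurable (M \<Otimes>\<^sub>M M)"
  by (simp add: schur_kernel_def)

lemma schur_section_measurable:
  assumes "schur_kernel M C K"
  shows "x \<in> space M \<Longrightarrow> K x \<in> borel_measurable M"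
    and "t \<in> space M \<Longrightarrow> (\<lambda>x. K x t) \<in> borel_measurable M"
  using measurable_compose[OF measurable_Pair1' schur_measurable[OF assms], of x]
    measurable_compose[OF measurable_Pair2' schur_measurable[OF assms], of t] by auto

text \<open>The pointwise bound on the kernel enters here, through |K|^2 <= C |K|. Rows being square
  integrable, the integral that defines \<open>kop\<close> converges at every point and not only
  almost everywhere.\<close>

lemma schur_section_L2:
  assumes K: "schur_kernel M C K" and x: "x \<in> space M"
  shows "K x \<in> L2 M"
proof -
  note [measurable] = schur_section_measurable(1)[OF K x]
  have "l2sq M (K x) \<le> (\<integral>\<^sup>+t. ennreal C * ennreal (cmod (K x t)) \<partial>M)"
    unfolding l2sq_def
  proof (rule nn_integral_mono)
    fix t assume "t \<in> space M"
    then have "(cmod (K x t))\<^sup>2 \<le> C * cmod (K x t)"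
      using K x by (auto simp: schur_kernel_def power2_eq_square intro!: mult_right_mono)
    then show "ennreal ((cmod (K x t))\<^sup>2) \<le> ennreal C * ennreal (cmod (K x t))"
      using K by (simp add: schur_kernel_def ennreal_leI flip: ennreal_mult)
  qed
  also have "\<dots> = ennreal C * (\<integral>\<^sup>+t. ennreal (cmod (K x t)) \<partial>M)"
    by (rule nn_integral_cmult) simp
  also have "\<dots> \<le> ennreal C * ennreal C"
    using K x by (auto simp: schur_kernel_def intro!: mult_left_mono)
  also have "\<dots> < \<infinity>" by (simp add: ennreal_mult_less_top)
  finally show ?thesis by (simp add: L2_iff_l2sq)
qed

lemma kop_integrable:
  "schur_kernel M C K \<Longrightarrow> \<xi> \<in> L2 M \<Longrightarrow> x \<in> space M \<Longrightarrow> integrable M (\<lambda>t. K x t * \<xi> t)"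
  by (rule L2_mult_integrable[OF schur_section_L2])

lemma kop_add:
  assumes "schur_kernel M C K" "\<xi> \<in> L2 M" "\<eta> \<in> L2 M"
  shows "kop M K (\<lambda>x. \<xi> x + \<eta> x) = (\<lambda>x. kop M K \<xi> x + kop M K \<eta> x)"
  using kop_integrable[OF assms(1,2)] kop_integrable[OF assms(1,3)]
  by (auto simp: kop_def fun_eq_iff distrib_left)

lemma kop_scale: "kop M K (\<lambda>x. c * \<xi> x) = (\<lambda>x. c * kop M K \<xi> x)"
  by (auto simp: kop_def fun_eq_iff mult.left_commute)

lemma kop_kernel_add:
  assumes "schur_kernel M C K" "schur_kernel M C' K'" "\<xi> \<in> L2 M"
  shows "kop M (\<lambda>x t. K x t + K' x t) \<xi> = (\<lambda>x. kop M K \<xi> x + kop M K' \<xi> x)"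
  using kop_integrable[OF assms(1,3)] kop_integrable[OF assms(2,3)]
  by (auto simp: kop_def fun_eq_iff distrib_right)

lemma kop_kernel_scale: "kop M (\<lambda>x t. c * K x t) \<xi> = (\<lambda>x. c * kop M K \<xi> x)"
  by (auto simp: kop_def fun_eq_iff mult.assoc)

lemma kop_measurable:
  assumes K: "schur_kernel M C K" and \<xi>: "\<xi> \<in> L2 M"
  shows "kop M K \<xi> \<in> borel_measurable M"
proof -
  note [measurable] = schur_measurable[OF K] L2_measurable[OF \<xi>]
  have "(\<lambda>x. \<integral>t. K x t * \<xi> t \<partial>M) \<in> borel_measurable M"
    by measurable
  then show ?thesis
    by (subst measurable_cong[where g = "\<lambda>x. \<integral>t. K x t * \<xi> t \<partial>M"]) (auto simp: kop_def)
qed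

text \<open>Schur's test: Cauchy-Schwarz for the measure with density \<open>cmod (K x t)\<close>, then Tonelli.\<close>
lemma kop_l2sq:
  assumes K: "schur_kernel M C K" and \<xi>: "\<xi> \<in> L2 M"
  shows "l2sq M (kop M K \<xi>) \<le> ennreal (C\<^sup>2) * l2sq M \<xi>"
proof -
  note [measurable] = schur_measurable[OF K] L2_measurable[OF \<xi>]
  have C0: "0 \<le> C" using K by (simp add: schur_kernel_def)
  have "ennreal ((cmod (kop M K \<xi> x))\<^sup>2)
      \<le> ennreal C * (\<integral>\<^sup>+t. ennreal (cmod (K x t)) * ennreal ((cmod (\<xi> t))\<^sup>2) \<partial>M)"
    if x: "x \<in> space M" for x
  proof -
    note [measurable] = schur_section_measurable(1)[OF K x]
    let ?s = "\<lambda>t. ennreal (sqrt (cmod (K x t)))"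
    have "ennreal (cmod (kop M K \<xi> x)) \<le> (\<integral>\<^sup>+t. ennreal (cmod (K x t * \<xi> t)) \<partial>M)"
      using x integral_norm_bound_ennreal[OF kop_integrable[OF K \<xi> x]] by (simp add: kop_def)
    also have "\<dots> = (\<integral>\<^sup>+t. ?s t * (?s t * ennreal (cmod (\<xi> t))) \<partial>M)"
      by (intro nn_integral_cong)
        (simp add: norm_mult flip: ennreal_mult mult.assoc)
    finally have "(ennreal (cmod (kop M K \<xi> x)))\<^sup>2 \<le> (\<integral>\<^sup>+t. ?s t * (?s t * ennreal (cmod (\<xi> t))) \<partial>M)\<^sup>2"
      by (rule power_mono) simp
    also have "\<dots> \<le> (\<integral>\<^sup>+t. (?s t)\<^sup>2 \<partial>M) * (\<integral>\<^sup>+t. (?s t * ennreal (cmod (\<xi> t)))\<^sup>2 \<partial>M)"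
      by (rule Cauchy_Schwarz_nn_integral) auto
    also have "\<dots> = (\<integral>\<^sup>+t. ennreal (cmod (K x t)) \<partial>M)
        * (\<integral>\<^sup>+t. ennreal (cmod (K x t)) * ennreal ((cmod (\<xi> t))\<^sup>2) \<partial>M)"
      by (simp add: power_mult_distrib ennreal_power)
    also have "\<dots> \<le> ennreal C * (\<integral>\<^sup>+t. ennreal (cmod (K x t)) * ennreal ((cmod (\<xi> t))\<^sup>2) \<partial>M)"
      using K x by (intro mult_right_mono) (auto simp: schur_kernel_def)
    finally show ?thesis by (simp add: ennreal_power)
  qed
  then have "l2sq M (kop M K \<xi>)
      \<le> (\<integral>\<^sup>+x. ennreal C * (\<integral>\<^sup>+t. ennreal (cmod (K x t)) * ennreal ((cmod (\<xi> t))\<^sup>2) \<partial>M) \<partial>M)"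
    unfolding l2sq_def by (rule nn_integral_mono)
  also have "\<dots> = ennreal C * (\<integral>\<^sup>+x. (\<integral>\<^sup>+t. ennreal (cmod (K x t)) * ennreal ((cmod (\<xi> t))\<^sup>2) \<partial>M) \<partial>M)"
    by (rule nn_integral_cmult) measurable
  also have "(\<integral>\<^sup>+x. (\<integral>\<^sup>+t. ennreal (cmod (K x t)) * ennreal ((cmod (\<xi> t))\<^sup>2) \<partial>M) \<partial>M)
      = (\<integral>\<^sup>+t. (\<integral>\<^sup>+x. ennreal (cmod (K x t)) * ennreal ((cmod (\<xi> t))\<^sup>2) \<partial>M) \<partial>M)"
  proof -
    interpret pair_sigma_finite M M by standard
    have "(\<lambda>(x, t). ennreal (cmod (K x t)) * ennreal ((cmod (\<xi> t))\<^sup>2)) \<in> borel_measurable (M \<Otimes>\<^sub>M M)"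
      by measurable
    from Fubini'[OF this] show ?thesis by simp
  qed
  also have "\<dots> = (\<integral>\<^sup>+t. (\<integral>\<^sup>+x. ennreal (cmod (K x t)) \<partial>M) * ennreal ((cmod (\<xi> t))\<^sup>2) \<partial>M)"
    using schur_section_measurable(2)[OF K]
    by (intro nn_integral_cong nn_integral_multc) auto
  also have "\<dots> \<le> (\<integral>\<^sup>+t. ennreal C * ennreal ((cmod (\<xi> t))\<^sup>2) \<partial>M)"
    using K by (intro nn_integral_mono mult_right_mono) (auto simp: schur_kernel_def)
  also have "\<dots> = ennreal C * l2sq M \<xi>"
    unfolding l2sq_def by (rule nn_integral_cmult) measurable
  finally show ?thesis
    using C0 by (simp add: power2_eq_square ennreal_mult mult.assoc mult_left_mono)
qed

lemma kop_L2:
  assumes K: "schur_kernel M C K" and \<xi>: "\<xi> \<in> L2 M"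
  shows "kop M K \<xi> \<in> L2 M"
proof -
  have "l2sq M (kop M K \<xi>) < \<infinity>"
    using kop_l2sq[OF K \<xi>] \<xi> by (simp add: l2sq_n2 le_less_trans flip: ennreal_mult)
  then show ?thesis by (simp add: L2_iff_l2sq kop_measurable[OF K \<xi>])
qed

lemma schur_cmod: "schur_kernel M C K \<Longrightarrow> schur_kernel M C (\<lambda>x t. complex_of_real (cmod (K x t)))"
  by (auto simp: schur_kernel_def split_beta')

lemma nn_integral_kernel_abs:
  assumes K: "schur_kernel M C K" and \<xi>: "\<xi> \<in> L2 M" and x: "x \<in> space M"
  shows "(\<integral>\<^sup>+t. ennreal (cmod (K x t * \<xi> t)) \<partial>M)
    = ennreal (cmod (kop M (\<lambda>x t. complex_of_real (cmod (K x t))) (\<lambda>t. complex_of_real (cmod (\<xi> t))) x))"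
proof -
  have "integrable M (\<lambda>t. cmod (K x t * \<xi> t))"
    using kop_integrable[OF K \<xi> x] by (rule integrable_norm)
  then have "(\<integral>\<^sup>+t. ennreal (cmod (K x t * \<xi> t)) \<partial>M) = ennreal (\<integral>t. cmod (K x t * \<xi> t) \<partial>M)"
    by (intro nn_integral_eq_integral) auto
  moreover have "(\<integral>t. complex_of_real (cmod (K x t)) * complex_of_real (cmod (\<xi> t)) \<partial>M)
      = complex_of_real (\<integral>t. cmod (K x t * \<xi> t) \<partial>M)"
    by (simp add: norm_mult flip: integral_complex_of_real)
  ultimately show ?thesis using x by (simp add: kop_def)
qed

text \<open>The absolute value of the integrand is the product of |eta| and the operator with kernel
  |K| applied to |xi|. Schur's test for |K| makes the latter square integrable, so the product is
  integrable and Fubini's theorem applies.\<close>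

lemma kernel_fubini:
  assumes K: "schur_kernel M C K" and \<xi>: "\<xi> \<in> L2 M" and \<eta>: "\<eta> \<in> L2 M"
  shows "(\<integral>x. (\<integral>t. \<eta> x * (K x t * \<xi> t) \<partial>M) \<partial>M) = (\<integral>t. (\<integral>x. \<eta> x * (K x t * \<xi> t) \<partial>M) \<partial>M)"
proof -
  note [measurable] = schur_measurable[OF K] L2_measurable[OF \<xi>] L2_measurable[OF \<eta>]
  note sec = schur_section_measurable(1)[OF K]
  let ?K = "\<lambda>x t. complex_of_real (cmod (K x t))" and ?\<xi> = "\<lambda>t. complex_of_real (cmod (\<xi> t))"
  have "integrable (M \<Otimes>\<^sub>M M) (\<lambda>(x, t). \<eta> x * (K x t * \<xi> t))"
  proof (rule integrableI_bounded)
    show "(\<lambda>(x, t). \<eta> x * (K x t * \<xi> t)) \<in> borel_measurable (M \<Otimes>\<^sub>M M)" by measurable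
    have [measurable]: "(\<lambda>p. \<eta> (fst p) * (K (fst p) (snd p) * \<xi> (snd p))) \<in> borel_measurable (M \<Otimes>\<^sub>M M)"
      using \<open>(\<lambda>(x, t). \<eta> x * (K x t * \<xi> t)) \<in> _\<close> by (simp add: split_beta')
    have "(\<integral>\<^sup>+p. ennreal (cmod (case p of (x, t) \<Rightarrow> \<eta> x * (K x t * \<xi> t))) \<partial>(M \<Otimes>\<^sub>M M))
        = (\<integral>\<^sup>+x. (\<integral>\<^sup>+t. ennreal (cmod (\<eta> x * (K x t * \<xi> t))) \<partial>M) \<partial>M)"
      by (subst nn_integral_fst[symmetric]) (simp_all add: split_beta')
    also have "\<dots> = (\<integral>\<^sup>+x. ennreal (cmod (\<eta> x * kop M ?K ?\<xi> x)) \<partial>M)"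
    proof (rule nn_integral_cong)
      fix x assume x: "x \<in> space M"
      note [measurable] = sec[OF x]
      have "(\<integral>\<^sup>+t. ennreal (cmod (\<eta> x * (K x t * \<xi> t))) \<partial>M)
          = ennreal (cmod (\<eta> x)) * (\<integral>\<^sup>+t. ennreal (cmod (K x t * \<xi> t)) \<partial>M)"
        by (subst norm_mult, subst ennreal_mult, simp, simp, rule nn_integral_cmult) measurable
      then show "(\<integral>\<^sup>+t. ennreal (cmod (\<eta> x * (K x t * \<xi> t))) \<partial>M) = ennreal (cmod (\<eta> x * kop M ?K ?\<xi> x))"
        by (simp add: nn_integral_kernel_abs[OF K \<xi> x] norm_mult[of "\<eta> x" "kop M ?K ?\<xi> x"] ennreal_mult)
    qed
    also have "\<dots> < \<infinity>"
      using L2_mult_integrable[OF \<eta> kop_L2[OF schur_cmod[OF K] L2_cmod[OF \<xi>]]]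
      by (simp add: integrable_iff_bounded)
    finally show "(\<integral>\<^sup>+p. ennreal (cmod (case p of (x, t) \<Rightarrow> \<eta> x * (K x t * \<xi> t))) \<partial>(M \<Otimes>\<^sub>M M)) < \<infinity>" .
  qed
  from pair_sigma_finite.Fubini_integral[OF pair_sigma_finite.intro this]
  show ?thesis using sigma_finite_measure_axioms by simp
qed

text \<open>Fubini's theorem for K', with the row \<open>K x\<close> as the outer square integrable
  function.\<close>

lemma kop_comp:
  assumes K: "schur_kernel M C K" and K': "schur_kernel M C' K'" and \<xi>: "\<xi> \<in> L2 M"
    and eq: "\<And>x t. x \<in> space M \<Longrightarrow> t \<in> space M \<Longrightarrow> K'' x t = (\<integral>s. K x s * K' s t \<partial>M)"
  shows "kop M K'' \<xi> = kop M K (kop M K' \<xi>)"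
proof
  fix x
  show "kop M K'' \<xi> x = kop M K (kop M K' \<xi>) x"
  proof (cases "x \<in> space M")
    case x: True
    have "kop M K'' \<xi> x = (\<integral>t. (\<integral>s. K x s * K' s t \<partial>M) * \<xi> t \<partial>M)"
      using x by (auto simp: kop_def eq intro!: Bochner_Integration.integral_cong)
    also have "\<dots> = (\<integral>t. (\<integral>s. K x s * (K' s t * \<xi> t) \<partial>M) \<partial>M)"
      by (simp add: mult.assoc flip: integral_mult_left_zero)
    also have "\<dots> = (\<integral>s. (\<integral>t. K x s * (K' s t * \<xi> t) \<partial>M) \<partial>M)"
      by (rule kernel_fubini[OF K' \<xi> schur_section_L2[OF K x], symmetric])
    also have "\<dots> = (\<integral>s. K x s * kop M K' \<xi> s \<partial>M)"
      by (auto simp: kop_def intro!: Bochner_Integration.integral_cong)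
    finally show ?thesis using x by (simp add: kop_def)
  qed (simp add: kop_def)
qed

lemma kop_adjoint:
  assumes K: "schur_kernel M C K" and \<xi>: "\<xi> \<in> L2 M" and \<eta>: "\<eta> \<in> L2 M"
  shows "ip2 M \<eta> (kop M K \<xi>) = ip2 M (kop M (\<lambda>x t. cnj (K t x)) \<eta>) \<xi>"
proof -
  have "ip2 M \<eta> (kop M K \<xi>) = (\<integral>x. (\<integral>t. cnj (\<eta> x) * (K x t * \<xi> t) \<partial>M) \<partial>M)"
    by (auto simp: kop_def ip2_def intro!: Bochner_Integration.integral_cong)
  also have "\<dots> = (\<integral>t. (\<integral>x. cnj (\<eta> x) * (K x t * \<xi> t) \<partial>M) \<partial>M)"
    by (rule kernel_fubini[OF K \<xi> L2_cnj[OF \<eta>]])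
  also have "\<dots> = (\<integral>t. (\<integral>x. cnj (cnj (K x t) * \<eta> x) \<partial>M) * \<xi> t \<partial>M)"
    by (simp add: mult_ac flip: integral_mult_left_zero)
  also have "\<dots> = ip2 M (kop M (\<lambda>x t. cnj (K t x)) \<eta>) \<xi>"
    unfolding ip2_def by (auto simp: kop_def simp del: complex_cnj_mult intro!: Bochner_Integration.integral_cong)
  finally show ?thesis .
qed

end

section \<open>The function space \<open>Cc\<close>\<close>

lemma continuous_map_comp_continuous:
  assumes "continuous_map X euclidean f" "continuous_on UNIV h"
  shows "continuous_map X euclidean (\<lambda>x. h (f x))"
  using continuous_map_compose[OF assms(1), of euclidean h] assms(2) by (simp add: o_def)

lemma continuous_map_comp2_continuous:
  fixes f :: "'a \<Rightarrow> 'b::topological_space" and g :: "'a \<Rightarrow> 'c::topological_space"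
  assumes "continuous_map X euclidean f" "continuous_map X euclidean g"
    and "continuous_on UNIV (\<lambda>p. h (fst p) (snd p))"
  shows "continuous_map X euclidean (\<lambda>x. h (f x) (g x))"
proof -
  have "continuous_map X (prod_topology euclidean euclidean) (\<lambda>x. (f x, g x))"
    using assms by (intro continuous_map_pairedI)
  then have "continuous_map X euclidean (\<lambda>x. (f x, g x))"
    by (simp add: prod_topology_euclidean)
  from continuous_map_comp_continuous[OF this assms(3)] show ?thesis by simp
qed

lemma continuous_map_mult_field:
  fixes f g :: "'a \<Rightarrow> complex"
  assumes "continuous_map X euclidean f" "continuous_map X euclidean g"
  shows "continuous_map X euclidean (\<lambda>x. f x * g x)"
  by (rule continuous_map_comp2_continuous[OF assms]) (auto intro!: continuous_intros)

text \<open>Names the open set and the compact set that \<open>cc_basic\<close> quantifies away. The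
  partition of unity and the convolution have to keep track of both.\<close>

definition cc_on :: "'a topology \<Rightarrow> 'a set \<Rightarrow> 'a set \<Rightarrow> ('a \<Rightarrow> complex) \<Rightarrow> bool" where
  "cc_on X U K f \<longleftrightarrow> openin X U \<and> Hausdorff_space (subtopology X U) \<and>
     (\<forall>x. x \<notin> U \<longrightarrow> f x = 0) \<and> continuous_map (subtopology X U) euclidean f \<and>
     compactin (subtopology X U) K \<and> (\<forall>x\<in>U - K. f x = 0)"

lemma cc_basic_iff: "cc_basic X f \<longleftrightarrow> (\<exists>U K. cc_on X U K f)"
  by (simp add: cc_basic_def cc_on_def)

lemma cc_onD:
  assumes "cc_on X U K f"
  shows "openin X U" "Hausdorff_space (subtopology X U)" "continuous_map (subtopology X U) euclidean f"
    "compactin X K" "K \<subseteq> U" "\<And>x. x \<notin> K \<Longrightarrow> f x = 0"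
  using assms by (auto simp: cc_on_def compactin_subtopology)

lemma openin_cc_preimage:
  assumes "openin X U" "continuous_map (subtopology X U) euclidean f" "open S"
  shows "openin X {x \<in> U. f x \<in> S}"
proof -
  have "topspace (subtopology X U) = U"
    using assms by (simp add: openin_subset Int_absorb1)
  then have "openin (subtopology X U) {x \<in> U. f x \<in> S}"
    using openin_continuous_map_preimage[OF assms(2), of S] assms(3) by auto
  then show ?thesis
    using assms by (simp add: openin_open_subtopology)
qed

lemma cc_on_openin_preimage:
  "cc_on X U K f \<Longrightarrow> open S \<Longrightarrow> openin X {x \<in> U. f x \<in> S}"
  by (rule openin_cc_preimage) (auto dest: cc_onD)

text \<open>Extension by zero can destroy continuity in a space that is not Hausdorff. Here the
  larger set U is still Hausdorff, so the compact set C is closed in U and the function vanishes on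
  the open set U - C.\<close>

lemma cc_on_mono:
  assumes f: "cc_on X W C f" and U: "openin X U" "Hausdorff_space (subtopology X U)" "W \<subseteq> U"
  shows "cc_on X U C f"
proof -
  note D = cc_onD[OF f]
  have tU: "topspace (subtopology X U) = U"
    using U by (simp add: openin_subset Int_absorb1)
  have C: "compactin (subtopology X U) C"
    using D U by (auto simp: compactin_subtopology)
  then have "closedin (subtopology X U) C"
    by (rule compactin_imp_closedin[OF U(2)])
  then have UC: "openin X (U - C)"
    using tU U(1) by (metis openin_closedin_eq openin_diff openin_open_subtopology openin_topspace tU)
  have "continuous_map (subtopology X U) euclidean f"
    unfolding continuous_map_def
  proof (intro conjI allI impI)
    fix S :: "complex set" assume S: "openin euclidean S"
    have "{x \<in> U. f x \<in> S} = {x \<in> W. f x \<in> S} \<union> (if 0 \<in> S then U - C else {})"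
      using D(5) D(6) U(3) f by (auto simp: cc_on_def split: if_splits)
    moreover have "openin X \<dots>"
      using openin_cc_preimage[OF D(1,3), of S] S UC by auto
    ultimately show "openin (subtopology X U) {x \<in> topspace (subtopology X U). f x \<in> S}"
      unfolding tU using U(1) by (auto simp: openin_open_subtopology)
  qed auto
  then show ?thesis using U C D by (auto simp: cc_on_def)
qed

lemma cc_on_mult:
  assumes f: "cc_on X U K f" and h: "continuous_map (subtopology X U) euclidean h"
  shows "cc_on X U K (\<lambda>x. f x * h x)"
  using f continuous_map_mult_field[OF cc_onD(3)[OF f] h] by (auto simp: cc_on_def)

lemma cc_on_comp:
  assumes f: "cc_on X U K f" and h: "continuous_on UNIV h" "h 0 = (0 :: complex)"
  shows "cc_on X U K (\<lambda>x. h (f x))"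
  using f continuous_map_comp_continuous[OF cc_onD(3)[OF f] h(1)] h(2) by (auto simp: cc_on_def)

lemma cc_on_bounded:
  assumes f: "cc_on X U K f" shows "\<exists>B. \<forall>x. cmod (f x) \<le> B"
proof -
  have "compactin euclidean (f ` K)"
    using f by (intro image_compactin[of "subtopology X U"]) (auto simp: cc_on_def)
  then obtain B where "\<forall>z\<in>f ` K. norm z \<le> B"
    using compact_imp_bounded bounded_iff by (metis compactin_euclidean_iff)
  then have "\<forall>x. cmod (f x) \<le> max B 0"
    using cc_onD(6)[OF f] by (metis imageI max.coboundedI1 max.cobounded2 norm_zero)
  then show ?thesis by blast
qed

section \<open>Borel sets of a topology\<close>

lemma space_borel_top [simp]: "space (borel_top X) = topspace X"
  unfolding borel_top_def by (rule space_measure_of) (auto dest: openin_subset)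

lemma sets_borel_top: "sets (borel_top X) = sigma_sets (topspace X) {U. openin X U}"
  unfolding borel_top_def by (rule sets_measure_of) (auto dest: openin_subset)

lemma openin_borel_top: "openin X U \<Longrightarrow> U \<in> sets (borel_top X)"
  unfolding sets_borel_top by (rule sigma_sets.Basic) simp

lemma closedin_borel_top: "closedin X U \<Longrightarrow> U \<in> sets (borel_top X)"
  using openin_borel_top[of X "topspace X - U"] sets.compl_sets[of "topspace X - U" "borel_top X"]
  by (metis closedin_def double_diff order_refl space_borel_top)

lemma continuous_map_borel_top:
  assumes "continuous_map X Y f" shows "f \<in> measurable (borel_top X) (borel_top Y)"
proof (rule measurable_sigma_sets)
  show "sets (borel_top Y) = sigma_sets (topspace Y) {U. openin Y U}" by (rule sets_borel_top)
  show "{U. openin Y U} \<subseteq> Pow (topspace Y)" by (auto dest: openin_subset)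
  show "f \<in> space (borel_top X) \<rightarrow> topspace Y"
    using assms by (auto simp: continuous_map_def)
  fix U assume "U \<in> {U. openin Y U}"
  then have "openin X {x \<in> topspace X. f x \<in> U}"
    using assms by (auto simp: continuous_map_def)
  moreover have "{x \<in> topspace X. f x \<in> U} = f -` U \<inter> space (borel_top X)" by auto
  ultimately show "f -` U \<inter> space (borel_top X) \<in> sets (borel_top X)"
    using openin_borel_top by metis
qed

text \<open>Although f may be discontinuous on X, the preimage of an open set is an open subset of
  U, joined with the closed complement of U if it contains 0.\<close>

lemma cc_on_measurable:
  assumes f: "cc_on X U K f" shows "f \<in> borel_measurable (borel_top X)"
proof (rule borel_measurableI)
  fix S :: "complex set" assume S: "open S"
  have "f -` S \<inter> space (borel_top X) = {x \<in> U. f x \<in> S} \<union> (if 0 \<in> S then topspace X - U else {})"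
    using f cc_onD(1)[OF f] by (auto simp: cc_on_def dest: openin_subset split: if_splits)
  also have "\<dots> \<in> sets (borel_top X)"
    using openin_borel_top[OF cc_on_openin_preimage[OF f S]] openin_borel_top[OF cc_onD(1)[OF f]]
      sets.compl_sets[of U "borel_top X"] by auto
  finally show "f -` S \<inter> space (borel_top X) \<in> sets (borel_top X)" .
qed

section \<open>Linear structure of \<open>Cc\<close>, restriction and inversion\<close>

lemma cc_basic_Cc: "cc_basic X f \<Longrightarrow> f \<in> Cc X"
  unfolding Cc_def by (auto intro!: exI[of _ "[f]"])

lemma cc_on_Cc: "cc_on X U K f \<Longrightarrow> f \<in> Cc X"
  using cc_basic_Cc cc_basic_iff by blast

lemma Cc_zero: "(\<lambda>x. 0) \<in> Cc X"
  unfolding Cc_def by (auto intro!: exI[of _ "[]"])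

lemma Cc_add: "f \<in> Cc X \<Longrightarrow> g \<in> Cc X \<Longrightarrow> (\<lambda>x. f x + g x) \<in> Cc X"
  unfolding Cc_def
proof safe
  fix fs gs assume "list_all (cc_basic X) fs" "list_all (cc_basic X) gs"
  then show "\<exists>hs. list_all (cc_basic X) hs \<and>
      (\<lambda>x. (\<Sum>g\<leftarrow>fs. g x) + (\<Sum>g\<leftarrow>gs. g x)) = (\<lambda>x. \<Sum>g\<leftarrow>hs. g x)"
    by (intro exI[of _ "fs @ gs"]) auto
qed

lemma Cc_induct [consumes 1, case_names basic zero add]:
  assumes "f \<in> Cc X"
    and basic: "\<And>U K f. cc_on X U K f \<Longrightarrow> P f"
    and zero: "P (\<lambda>x. 0)"
    and add: "\<And>f g. f \<in> Cc X \<Longrightarrow> g \<in> Cc X \<Longrightarrow> P f \<Longrightarrow> P g \<Longrightarrow> P (\<lambda>x. f x + g x)"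
  shows "P f"
proof -
  obtain fs where fs: "list_all (cc_basic X) fs" and f: "f = (\<lambda>x. \<Sum>g\<leftarrow>fs. g x)"
    using assms(1) by (auto simp: Cc_def)
  have "P (\<lambda>x. \<Sum>g\<leftarrow>fs. g x) \<and> (\<lambda>x. \<Sum>g\<leftarrow>fs. g x) \<in> Cc X"
    using fs
  proof (induction fs)
    case (Cons g gs)
    then obtain U K where "cc_on X U K g" by (auto simp: cc_basic_iff)
    then have "P g" "g \<in> Cc X" using basic cc_on_Cc by auto
    then show ?case using Cons add Cc_add by auto
  qed (auto simp: zero Cc_zero)
  then show ?thesis using f by simp
qed

lemma Cc_sum: "(\<And>k. k \<in> I \<Longrightarrow> f k \<in> Cc X) \<Longrightarrow> (\<lambda>x. \<Sum>k\<in>I. f k x) \<in> Cc X"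
  by (induction I rule: infinite_finite_induct) (auto simp: Cc_zero intro: Cc_add)

text \<open>Only an additive h passes through the decomposition into Hausdorff pieces; scalar
  multiples and conjugation are the instances. The modulus is not one: on the line with two origins,
  the modulus of the difference of two bumps that differ only at the origins does not lie in
  \<open>Cc\<close>.\<close>

lemma Cc_comp_additive:
  assumes "f \<in> Cc X" and h: "continuous_on UNIV h" and add: "\<And>a b. h (a + b) = h a + h (b :: complex)"
  shows "(\<lambda>x. h (f x)) \<in> Cc X"
  using assms(1)
proof (induction rule: Cc_induct)
  have h0: "h 0 = 0" using add[of 0 0] by simp
  case (basic U K f)
  show ?case using cc_on_comp[OF basic h h0] by (rule cc_on_Cc)
next
  case zero
  have h0: "h 0 = 0" using add[of 0 0] by simp
  show ?case by (simp add: h0 Cc_zero)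
next
  case (add f g)
  then show ?case by (simp add: assms(3) Cc_add)
qed

lemma Cc_scale: "f \<in> Cc X \<Longrightarrow> (\<lambda>x. c * f x) \<in> Cc X"
  by (rule Cc_comp_additive) (auto intro!: continuous_intros simp: distrib_left)

lemma Cc_cnj: "f \<in> Cc X \<Longrightarrow> (\<lambda>x. cnj (f x)) \<in> Cc X"
  by (rule Cc_comp_additive) (auto intro!: continuous_intros)

lemma Cc_diff: "f \<in> Cc X \<Longrightarrow> g \<in> Cc X \<Longrightarrow> (\<lambda>x. f x - g x) \<in> Cc X"
  using Cc_add[of f X "\<lambda>x. (-1) * g x"] Cc_scale[of g X "-1"] by simp

lemma Cc_measurable: "f \<in> Cc X \<Longrightarrow> f \<in> borel_measurable (borel_top X)"
  by (induction rule: Cc_induct) (auto intro: cc_on_measurable)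

lemma Cc_bounded: "f \<in> Cc X \<Longrightarrow> \<exists>B. \<forall>x. cmod (f x) \<le> B"
proof (induction rule: Cc_induct)
  case (add f g)
  then obtain B B' where "\<forall>x. cmod (f x) \<le> B" "\<forall>x. cmod (g x) \<le> B'" by auto
  then have "\<forall>x. cmod (f x + g x) \<le> B + B'"
    by (meson add_mono norm_triangle_ineq order_trans)
  then show ?case by blast
qed (auto intro: cc_on_bounded)

lemma Cc_outside: "f \<in> Cc X \<Longrightarrow> x \<notin> topspace X \<Longrightarrow> f x = 0"
  by (induction rule: Cc_induct) (auto simp: cc_on_def dest: openin_subset)

lemma Hausdorff_subtopology_mono:
  "Hausdorff_space (subtopology X U) \<Longrightarrow> W \<subseteq> U \<Longrightarrow> Hausdorff_space (subtopology X W)"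
  using Hausdorff_space_subtopology[of "subtopology X U" W]
  by (simp add: subtopology_subtopology Int_absorb1)

text \<open>Openness of H keeps the domain of continuity open, closedness keeps the support compact.
  This is the point where H has to be clopen for the expectation to map \<open>Cc\<close> to
  itself.\<close>

lemma Cc_restrict_subspace:
  assumes f: "f \<in> Cc X" and H: "openin X H" "closedin X H"
  shows "(\<lambda>x. if x \<in> H then f x else 0) \<in> Cc (subtopology X H)"
  using f
proof (induction rule: Cc_induct)
  case (basic U K f)
  note D = cc_onD[OF basic]
  have eq: "subtopology (subtopology X H) (U \<inter> H) = subtopology X (U \<inter> H)"
    by (simp add: subtopology_subtopology Int_commute Int_left_commute)
  have "cc_on (subtopology X H) (U \<inter> H) (K \<inter> H) (\<lambda>x. if x \<in> H then f x else 0)"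
    unfolding cc_on_def eq
  proof (intro conjI)
    show "openin (subtopology X H) (U \<inter> H)"
      using D(1) H(1) by (simp add: openin_open_subtopology openin_Int)
    show "Hausdorff_space (subtopology X (U \<inter> H))"
      using Hausdorff_subtopology_mono[OF D(2)] by simp
    have "continuous_map (subtopology X (U \<inter> H)) euclidean f"
      using continuous_map_from_subtopology_mono[OF D(3)] by simp
    then show "continuous_map (subtopology X (U \<inter> H)) euclidean (\<lambda>x. if x \<in> H then f x else 0)"
      by (rule continuous_map_eq) simp
    show "compactin (subtopology X (U \<inter> H)) (K \<inter> H)"
      using closed_Int_compactin[OF H(2) D(4)] D(5) by (auto simp: compactin_subtopology Int_commute)
    show "\<forall>x\<in>U \<inter> H - K \<inter> H. (if x \<in> H then f x else 0) = 0"
      using D(6) by auto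
    show "\<forall>x. x \<notin> U \<inter> H \<longrightarrow> (if x \<in> H then f x else 0) = 0"
      using D(5,6) by auto
  qed
  then show ?case by (rule cc_on_Cc)
next
  case zero
  then show ?case by (simp add: Cc_zero)
next
  case (add f g)
  then show ?case
    using Cc_add[OF add(3,4)] by (simp add: if_distrib if_distribR cong: if_cong)
qed

lemma Cc_open_subspace:
  assumes f: "f \<in> Cc (subtopology X H)" and H: "openin X H"
  shows "f \<in> Cc X"
  using f
proof (induction rule: Cc_induct)
  case (basic U K f)
  note D = cc_onD[OF basic]
  have U: "openin X U" "U \<subseteq> H"
    using D(1) H by (auto simp: openin_open_subtopology)
  then have "subtopology (subtopology X H) U = subtopology X U"
    by (simp add: subtopology_subtopology Int_absorb1)
  then have "cc_on X U K f"
    using basic U(1) by (simp add: cc_on_def)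
  then show ?case by (rule cc_on_Cc)
qed (auto simp: Cc_zero Cc_add)

lemma Cc_homeo:
  assumes f: "f \<in> Cc X" and i: "continuous_map X X i" "\<And>x. x \<in> topspace X \<Longrightarrow> i (i x) = x"
  shows "(\<lambda>x. if x \<in> topspace X then f (i x) else 0) \<in> Cc X"
  using f
proof (induction rule: Cc_induct)
  case (basic U K f)
  note D = cc_onD[OF basic]
  note sub = compactin_subset_topspace[OF D(4)] openin_subset[OF D(1)]
  have iX: "i x \<in> topspace X" if "x \<in> topspace X" for x
    using i(1) that by (auto simp: continuous_map_def)
  have KX: "K \<subseteq> topspace X" and UX: "U \<subseteq> topspace X"
    using sub by auto
  define V where "V = {x \<in> topspace X. i x \<in> U}"
  have V: "openin X V" unfolding V_def using i(1) D(1) by (auto simp: continuous_map_def)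
  have iV: "continuous_map (subtopology X V) (subtopology X U) i"
    using i(1) by (auto simp: continuous_map_in_subtopology continuous_map_from_subtopology V_def)
  have "cc_on X V (i ` K) (\<lambda>x. if x \<in> topspace X then f (i x) else 0)"
    unfolding cc_on_def
  proof (intro conjI)
    show "openin X V" by (rule V)
    have tV: "topspace (subtopology X V) = V" using V_def by auto
    show "Hausdorff_space (subtopology X V)"
    proof (rule Hausdorff_space_injective_preimage[OF D(2) iV])
      show "inj_on i (topspace (subtopology X V))"
        unfolding tV by (rule inj_on_inverseI[of _ i]) (auto simp: V_def i(2))
    qed
    have "continuous_map (subtopology X V) euclidean (f \<circ> i)"
      by (rule continuous_map_compose[OF iV D(3)])
    then show "continuous_map (subtopology X V) euclidean (\<lambda>x. if x \<in> topspace X then f (i x) else 0)"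
      by (rule continuous_map_eq) (auto simp: V_def)
    show "compactin (subtopology X V) (i ` K)"
      using image_compactin[OF D(4) i(1)] D(5) iX KX i(2) by (auto simp: compactin_subtopology V_def subset_iff)
    have "f (i x) = 0" if "x \<in> topspace X" "x \<notin> i ` K" for x
      using D(6)[of "i x"] that i(2) by (metis imageI)
    then show "\<forall>x\<in>V - i ` K. (if x \<in> topspace X then f (i x) else 0) = 0"
      by auto
    show "\<forall>x. x \<notin> V \<longrightarrow> (if x \<in> topspace X then f (i x) else 0) = 0"
      using basic by (auto simp: cc_on_def V_def)
  qed
  then show ?case by (rule cc_on_Cc)
next
  case zero
  then show ?case by (simp add: Cc_zero)
next
  case (add f g)
  then show ?case
    using Cc_add[OF add(3,4)] by (simp add: if_distrib if_distribR cong: if_cong)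
qed

section \<open>Bump functions and partitions of unity\<close>

definition lch_base :: "'a topology \<Rightarrow> bool" where
  "lch_base X \<longleftrightarrow> (\<forall>U x. openin X U \<longrightarrow> x \<in> U \<longrightarrow>
     (\<exists>K. compactin X K \<and> Hausdorff_space (subtopology X K) \<and> x \<in> X interior_of K \<and> X interior_of K \<subseteq> U))"

text \<open>Urysohn's lemma is applied inside K, which is compact Hausdorff and hence normal. The
  function obtained vanishes on K - W but may be positive arbitrarily near the boundary of W;
  replacing f by max 0 (2 f - 1) shrinks its support into the compact set where f >= 1/2.\<close>

lemma bump_function:
  assumes K: "compactin X K" "Hausdorff_space (subtopology X K)"
    and W: "openin X W" "W \<subseteq> K" and C: "compactin X C" "C \<subseteq> W"
  obtains D h where "cc_on X W D (\<lambda>x. complex_of_real (h x))" "\<And>x. 0 \<le> h x" "\<And>x. h x \<le> (1::real)"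
    "\<And>x. x \<in> C \<Longrightarrow> h x = 1"
proof -
  let ?Y = "subtopology X K"
  have KX: "K \<subseteq> topspace X" using K(1) by (rule compactin_subset_topspace)
  then have tY: "topspace ?Y = K" by auto
  have cY: "compact_space ?Y" using K(1) by (simp add: compact_space_subtopology)
  then have "normal_space ?Y" using K(2) compact_Hausdorff_or_regular_imp_normal_space by blast
  moreover have oW: "openin ?Y W"
    using W by (metis openin_subtopology_Int Int_absorb2)
  then have "closedin ?Y (K - W)" by (metis closedin_diff closedin_topspace tY)
  moreover have "closedin ?Y C"
    using C W K by (intro compactin_imp_closedin) (auto simp: compactin_subtopology)
  moreover have "disjnt (K - W) C" using C by (auto simp: disjnt_def)
  ultimately obtain f where f: "continuous_map ?Y (top_of_set {0..1::real}) f"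
    "f ` (K - W) \<subseteq> {0}" "f ` C \<subseteq> {1}"
    using Urysohn_lemma[of ?Y "K - W" C 0 1] by auto
  have fc: "continuous_map ?Y euclidean f" and f01: "\<And>x. x \<in> K \<Longrightarrow> f x \<in> {0..1}"
    using f(1) unfolding continuous_map_in_subtopology tY by auto
  define h where "h x = (if x \<in> W then max 0 (2 * f x - 1) else 0)" for x
  define D where "D = {x \<in> K. f x \<in> {1/2..}}"
  have "closedin ?Y D"
    unfolding D_def using closedin_continuous_map_preimage[OF fc, of "{1/2..}"]
    unfolding tY by simp
  then have "compactin ?Y D" using cY closedin_compact_space by blast
  then have D: "compactin X D" by (simp add: compactin_subtopology)
  have DW: "D \<subseteq> W" using f(2) by (force simp: D_def)
  show thesis
  proof (rule that[of D h])
    have "continuous_map (subtopology X W) euclidean f"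
      using continuous_map_from_subtopology_mono[OF fc W(2)] .
    then have "continuous_map (subtopology X W) euclidean (\<lambda>x. complex_of_real (max 0 (2 * f x - 1)))"
      by (rule continuous_map_comp_continuous) (auto intro!: continuous_intros)
    then have "continuous_map (subtopology X W) euclidean (\<lambda>x. complex_of_real (h x))"
      by (rule continuous_map_eq) (auto simp: h_def)
    moreover have "h x = 0" if "x \<in> W - D" for x
      using that W(2) by (auto simp: h_def D_def)
    ultimately show "cc_on X W D (\<lambda>x. complex_of_real (h x))"
      using W D DW Hausdorff_subtopology_mono[OF K(2) W(2)] by (auto simp: cc_on_def h_def compactin_subtopology)
    show "0 \<le> h x" "h x \<le> 1" for x using f01[of x] W(2) by (auto simp: h_def)
    show "h x = 1" if "x \<in> C" for x using that f(3) C(2) by (auto simp: h_def)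
  qed
qed

text \<open>The last conclusion holds because the pieces are nonnegative multiples of \<open>f\<close>.\<close>
lemma cc_on_localise:
  assumes X: "lch_base X" and f: "cc_on X U K f"
    and P: "\<And>y. y \<in> K \<Longrightarrow> \<exists>W. openin X W \<and> y \<in> W \<and> P y W"
    and her: "\<And>y W W'. P y W \<Longrightarrow> openin X W' \<Longrightarrow> W' \<subseteq> W \<Longrightarrow> P y W'"
  shows "\<exists>F W C \<phi>. finite F \<and> (\<forall>y\<in>F. cc_on X (W y) (C y) (\<phi> y) \<and> P y (W y)) \<and>
    (\<forall>x. f x = (\<Sum>y\<in>F. \<phi> y x)) \<and> (\<forall>x. (\<Sum>y\<in>F. cmod (\<phi> y x)) = cmod (f x))"
proof -
  note D = cc_onD[OF f]
  \<comment> \<open>Bundles all requirements, so that the open set, the compact set and the bump can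
    be chosen one after the other.\<close>
  define R where "R y W E h \<longleftrightarrow> cc_on X W E (\<lambda>x. complex_of_real (h x)) \<and> (\<forall>x. 0 \<le> h x) \<and>
      h y = (1::real) \<and> y \<in> W \<and> W \<subseteq> U \<and> P y W" for y W E h
  have ex: "\<exists>W E h. R y W E h" if y: "y \<in> K" for y
  proof -
    obtain W0 where W0: "openin X W0" "y \<in> W0" "P y W0" using P[OF y] by blast
    then have "openin X (W0 \<inter> U)" "y \<in> W0 \<inter> U" using D y by auto
    then obtain Q where Q: "compactin X Q" "Hausdorff_space (subtopology X Q)"
      "y \<in> X interior_of Q" "X interior_of Q \<subseteq> W0 \<inter> U"
      using X unfolding lch_base_def by blast
    have yX: "compactin X {y}" using y D(4) compactin_subset_topspace by fastforce
    obtain E h where "cc_on X (X interior_of Q) E (\<lambda>x. complex_of_real (h x))"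
      "\<And>x. 0 \<le> h x" "\<And>x. h x \<le> 1" "\<And>x. x \<in> {y} \<Longrightarrow> h x = (1::real)"
      using bump_function[OF Q(1,2) openin_interior_of interior_of_subset yX] Q(3) by blast
    then show ?thesis
      using Q(3,4) her[OF W0(3), of "X interior_of Q"]
      unfolding R_def by (intro exI[of _ "X interior_of Q"] exI[of _ E] exI[of _ h]) auto
  qed
  obtain W where "\<forall>y\<in>K. \<exists>E h. R y (W y) E h"
    using bchoice[of K "\<lambda>y W. \<exists>E h. R y W E h"] ex by blast
  then obtain E where "\<forall>y\<in>K. \<exists>h. R y (W y) (E y) h"
    using bchoice[of K "\<lambda>y E. \<exists>h. R y (W y) E h"] by blast
  then obtain h where R: "\<forall>y\<in>K. R y (W y) (E y) (h y)"
    using bchoice[of K "\<lambda>y h. R y (W y) (E y) h"] by blast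
  then have h: "\<And>y. y \<in> K \<Longrightarrow> cc_on X (W y) (E y) (\<lambda>x. complex_of_real (h y x))"
    "\<And>y x. y \<in> K \<Longrightarrow> 0 \<le> h y x" "\<And>y. y \<in> K \<Longrightarrow> h y y = (1::real)" "\<And>y. y \<in> K \<Longrightarrow> y \<in> W y"
    "\<And>y. y \<in> K \<Longrightarrow> W y \<subseteq> U" "\<And>y. y \<in> K \<Longrightarrow> P y (W y)"
    by (auto simp: R_def)
  define O' where "O' y = {x \<in> W y. complex_of_real (h y x) \<in> {z. Re z > 1/2}}" for y
  have "openin X (O' y)" if "y \<in> K" for y
    unfolding O'_def by (rule cc_on_openin_preimage[OF h(1)[OF that]]) (rule open_halfspace_Re_gt)
  moreover have "y \<in> O' y" if "y \<in> K" for y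
    using h(3,4)[OF that] by (simp add: O'_def)
  ultimately have "\<exists>\<F>. finite \<F> \<and> \<F> \<subseteq> O' ` K \<and> K \<subseteq> \<Union>\<F>"
    using D(4) unfolding compactin_def by (auto dest!: spec[of _ "O' ` K"])
  then obtain F where F: "finite F" "F \<subseteq> K" "K \<subseteq> (\<Union>y\<in>F. O' y)"
    by (metis finite_subset_image)
  define s where "s x = (\<Sum>y\<in>F. h y x)" for x
  have s_cont: "continuous_map (subtopology X U) euclidean (\<lambda>x. complex_of_real (s x))"
  proof -
    have "continuous_map (subtopology X U) euclidean (\<lambda>x. complex_of_real (h y x))" if "y \<in> F" for y
      using cc_onD(3)[OF cc_on_mono[OF h(1) D(1,2)]] h(5) that F(2) by blast
    then show ?thesis unfolding s_def of_real_sum by (intro continuous_map_sum F(1))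
  qed
  have s_K: "s x \<ge> 1/2" if "x \<in> K" for x
  proof -
    obtain y where y: "y \<in> F" "x \<in> O' y" using F(3) \<open>x \<in> K\<close> by blast
    have "h y x \<le> s x" unfolding s_def using y F h(2) by (intro member_le_sum) auto
    then show ?thesis using y by (auto simp: O'_def)
  qed
  \<comment> \<open>On K the sum \<open>s\<close> is at least 1/2, so the maximum equals
    \<open>s\<close> there. Off K the function f vanishes, and the maximum only keeps the
    denominator away from 0, which makes g continuous on all of U.\<close>
  define g where "g x = f x * complex_of_real (1 / max (s x) (1/2))" for x
  have g_cont: "continuous_map (subtopology X U) euclidean g"
  proof -
    have "continuous_map (subtopology X U) euclidean
        (\<lambda>x. complex_of_real (1 / max (Re (complex_of_real (s x))) (1/2)))"
      by (rule continuous_map_comp_continuous[OF s_cont]) (auto intro!: continuous_intros)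
    then show ?thesis
      unfolding g_def Re_complex_of_real by (rule continuous_map_mult_field[OF D(3)])
  qed
  define \<phi> where "\<phi> y x = complex_of_real (h y x) * g x" for y x
  have gs: "f x = g x * complex_of_real (s x)" "cmod (f x) = cmod (g x) * s x" for x
  proof -
    show *: "f x = g x * complex_of_real (s x)"
    proof (cases "x \<in> K")
      case True
      then have "max (s x) (1/2) = s x" "s x \<noteq> 0" using s_K[of x] by (auto simp: max_def)
      then show ?thesis by (simp add: g_def)
    qed (simp add: g_def D(6))
    have "0 \<le> s x" unfolding s_def using h(2) F by (intro sum_nonneg) auto
    then show "cmod (f x) = cmod (g x) * s x" unfolding * by (simp add: norm_mult)
  qed
  show ?thesis
  proof (rule exI[of _ F], rule exI[of _ W], rule exI[of _ E], rule exI[of _ \<phi>],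
      intro conjI ballI allI F(1))
    fix y assume "y \<in> F"
    then have y: "y \<in> K" using F by auto
    show "cc_on X (W y) (E y) (\<phi> y)"
      unfolding \<phi>_def
      by (rule cc_on_mult[OF h(1)[OF y] continuous_map_from_subtopology_mono[OF g_cont h(5)[OF y]]])
    show "P y (W y)" using h y by auto
  next
    show "f x = (\<Sum>y\<in>F. \<phi> y x)" for x
      unfolding gs(1)[of x] by (simp add: \<phi>_def s_def sum_distrib_left mult.commute)
    show "(\<Sum>y\<in>F. cmod (\<phi> y x)) = cmod (f x)" for x
    proof -
      have "(\<Sum>y\<in>F. cmod (\<phi> y x)) = (\<Sum>y\<in>F. cmod (g x) * h y x)"
        using h(2) F(2) by (intro sum.cong) (auto simp: \<phi>_def norm_mult)
      then show ?thesis unfolding gs(2)[of x] by (simp add: s_def sum_distrib_left)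
    qed
  qed
qed

section \<open>Groupoids with a Haar system\<close>

lemma continuous_map_epsilon:
  fixes F :: "'a \<Rightarrow> 'b::metric_space"
  assumes "openin X W"
    and "\<And>x e. x \<in> W \<Longrightarrow> 0 < e \<Longrightarrow> \<exists>N. openin X N \<and> x \<in> N \<and> (\<forall>y\<in>N \<inter> W. dist (F y) (F x) < e)"
  shows "continuous_map (subtopology X W) euclidean F"
  unfolding continuous_map_def
proof (intro conjI allI impI)
  fix S :: "'b set" assume "openin euclidean S"
  then have S: "open S" by simp
  have tW: "topspace (subtopology X W) = W"
    using assms(1) by (simp add: openin_subset Int_absorb1)
  have "openin X {x \<in> W. F x \<in> S}"
  proof (subst openin_subopen, clarify)
    fix x assume x: "x \<in> W" "F x \<in> S"
    then obtain e where e: "0 < e" "ball (F x) e \<subseteq> S" using S openE by blast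
    then obtain N where "openin X N" "x \<in> N" "\<forall>y\<in>N \<inter> W. dist (F y) (F x) < e"
      using assms(2) x by blast
    then show "\<exists>N. openin X N \<and> x \<in> N \<and> N \<subseteq> {x \<in> W. F x \<in> S}"
      using assms(1) x e(2) by (intro exI[of _ "N \<inter> W"]) (auto simp: dist_commute subset_iff)
  qed
  then show "openin (subtopology X W) {x \<in> topspace (subtopology X W). F x \<in> S}"
    unfolding tW using assms(1) by (auto simp: openin_open_subtopology)
qed auto

locale haar_groupoid =
  fixes T :: "'g topology" and G0 :: "'g set" and r d i :: "'g \<Rightarrow> 'g"
    and m :: "'g \<Rightarrow> 'g \<Rightarrow> 'g" and lam :: "'g \<Rightarrow> 'g measure"
  assumes lc: "lc_groupoid T G0 r d m i lam"
begin

abbreviation G :: "'g set" where "G \<equiv> topspace T"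

section \<open>Algebraic identities in the groupoid\<close>

lemma gpd: "groupoid G G0 r d m i"
  using lc by (simp add: lc_groupoid_def topological_groupoid_def)

lemma G0_G: "u \<in> G0 \<Longrightarrow> u \<in> G"
  using gpd by (auto simp: groupoid_def)

lemma r_G0 [simp]: "x \<in> G \<Longrightarrow> r x \<in> G0" and d_G0 [simp]: "x \<in> G \<Longrightarrow> d x \<in> G0"
  using gpd by (auto simp: groupoid_def)

lemma r_unit [simp]: "u \<in> G0 \<Longrightarrow> r u = u" and d_unit [simp]: "u \<in> G0 \<Longrightarrow> d u = u"
  using gpd by (auto simp: groupoid_def)

lemma m_closed: "x \<in> G \<Longrightarrow> y \<in> G \<Longrightarrow> d x = r y \<Longrightarrow> m x y \<in> G"
  and r_m: "x \<in> G \<Longrightarrow> y \<in> G \<Longrightarrow> d x = r y \<Longrightarrow> r (m x y) = r x"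
  and d_m: "x \<in> G \<Longrightarrow> y \<in> G \<Longrightarrow> d x = r y \<Longrightarrow> d (m x y) = d y"
  using gpd by (auto simp: groupoid_def)

lemma m_assoc: "x \<in> G \<Longrightarrow> y \<in> G \<Longrightarrow> z \<in> G \<Longrightarrow> d x = r y \<Longrightarrow> d y = r z \<Longrightarrow> m (m x y) z = m x (m y z)"
  using gpd by (auto simp: groupoid_def)

lemma m_r: "x \<in> G \<Longrightarrow> m (r x) x = x" and m_d: "x \<in> G \<Longrightarrow> m x (d x) = x"
  using gpd by (auto simp: groupoid_def)

lemma i_closed: "x \<in> G \<Longrightarrow> i x \<in> G" and r_i: "x \<in> G \<Longrightarrow> r (i x) = d x"
  and d_i: "x \<in> G \<Longrightarrow> d (i x) = r x" and m_i: "x \<in> G \<Longrightarrow> m x (i x) = r x"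
  and i_m: "x \<in> G \<Longrightarrow> m (i x) x = d x"
  using gpd by (auto simp: groupoid_def)

lemmas gsimps = m_closed r_m d_m i_closed r_i d_i

lemma i_m_cancel: "x \<in> G \<Longrightarrow> z \<in> G \<Longrightarrow> d x = r z \<Longrightarrow> m (i x) (m x z) = z"
  using m_assoc[of "i x" x z] by (simp add: gsimps i_m m_r)

lemma m_i_cancel: "x \<in> G \<Longrightarrow> y \<in> G \<Longrightarrow> r x = r y \<Longrightarrow> m x (m (i x) y) = y"
  using m_assoc[of x "i x" y] by (simp add: gsimps m_i m_r)

lemma i_unique:
  assumes "a \<in> G" "b \<in> G" "d a = r b" "m a b = r a" shows "b = i a"
  using i_m_cancel[OF assms(1-3)] m_d[of "i a"] assms by (simp add: gsimps)

lemma i_i [simp]: "x \<in> G \<Longrightarrow> i (i x) = x"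
  using i_unique[of "i x" x] by (simp add: gsimps i_m)

lemma i_mult:
  assumes "x \<in> G" "y \<in> G" "d x = r y" shows "i (m x y) = m (i y) (i x)"
proof -
  have "m (m x y) (m (i y) (i x)) = m x (m y (m (i y) (i x)))"
    using assms by (simp add: m_assoc gsimps)
  also have "\<dots> = r x" using assms by (simp add: m_i_cancel gsimps m_i)
  finally show ?thesis
    using i_unique[of "m x y" "m (i y) (i x)"] assms by (simp add: gsimps)
qed

section \<open>Continuity of the operations\<close>

lemma m_continuous:
  "continuous_map (subtopology (prod_topology T T) (composable G r d)) T (\<lambda>(x, y). m x y)"
  using lc by (simp add: lc_groupoid_def topological_groupoid_def)

lemma i_continuous: "continuous_map T T i"
  using lc by (simp add: lc_groupoid_def topological_groupoid_def)

lemma continuous_map_m: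
  assumes "continuous_map X T f" "continuous_map X T g"
    and "\<And>x. x \<in> topspace X \<Longrightarrow> d (f x) = r (g x)"
  shows "continuous_map X T (\<lambda>x. m (f x) (g x))"
proof -
  have "continuous_map X (subtopology (prod_topology T T) (composable G r d)) (\<lambda>x. (f x, g x))"
    unfolding continuous_map_in_subtopology continuous_map_paired
    using assms continuous_map_image_subset_topspace[OF assms(1)] continuous_map_image_subset_topspace[OF assms(2)]
    by (auto simp: composable_def)
  from continuous_map_compose[OF this m_continuous] show ?thesis by (simp add: o_def)
qed

lemma continuous_map_i: "continuous_map X T f \<Longrightarrow> continuous_map X T (\<lambda>x. i (f x))"
  using continuous_map_compose[OF _ i_continuous] by (simp add: o_def)

lemma r_continuous: "continuous_map T (subtopology T G0) r"
proof -
  have "continuous_map T T (\<lambda>x. m x (i x))"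
    by (rule continuous_map_m) (auto simp: i_continuous gsimps)
  then have "continuous_map T T r"
    by (rule continuous_map_eq) (simp add: m_i)
  then show ?thesis by (auto simp: continuous_map_in_subtopology)
qed

lemma d_continuous: "continuous_map T (subtopology T G0) d"
proof -
  have "continuous_map T (subtopology T G0) (r \<circ> i)"
    by (rule continuous_map_compose[OF i_continuous r_continuous])
  then show ?thesis by (rule continuous_map_eq) (simp add: r_i)
qed

lemma G0_Hausdorff: "Hausdorff_space (subtopology T G0)"
  using lc by (simp add: lc_groupoid_def)

lemma m_nbhd:
  assumes "x \<in> G" "y \<in> G" "d x = r y" "openin T W" "m x y \<in> W"
  obtains A B where "openin T A" "openin T B" "x \<in> A" "y \<in> B"
    "\<And>a b. a \<in> A \<Longrightarrow> b \<in> B \<Longrightarrow> d a = r b \<Longrightarrow> m a b \<in> W"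
proof -
  let ?S = "subtopology (prod_topology T T) (composable G r d)"
  have "openin ?S {p \<in> topspace ?S. (\<lambda>(x, y). m x y) p \<in> W}"
    using m_continuous assms(4) by (rule openin_continuous_map_preimage)
  then obtain Q where Q: "openin (prod_topology T T) Q"
    "{p \<in> topspace ?S. (\<lambda>(x, y). m x y) p \<in> W} = Q \<inter> composable G r d"
    unfolding openin_subtopology by blast
  have "(x, y) \<in> Q"
    using equalityD1[OF Q(2)] assms by (auto simp: composable_def)
  then have "\<exists>A B. openin T A \<and> openin T B \<and> x \<in> A \<and> y \<in> B \<and> A \<times> B \<subseteq> Q"
    using Q(1) by (simp add: openin_prod_topology_alt)
  then obtain A B where AB: "openin T A" "openin T B" "x \<in> A" "y \<in> B" "A \<times> B \<subseteq> Q"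
    by blast
  have "m a b \<in> W" if "a \<in> A" "b \<in> B" "d a = r b" for a b
  proof -
    have "(a, b) \<in> Q \<inter> composable G r d"
      using that AB openin_subset[OF AB(1)] openin_subset[OF AB(2)] by (auto simp: composable_def)
    then show ?thesis using equalityD2[OF Q(2)] by auto
  qed
  then show thesis using that AB by blast
qed

text \<open>The unit space is Hausdorff even when the groupoid is not. Hence failing to be
  composable is an open condition on pairs of arrows.\<close>

lemma separate_values:
  assumes p: "continuous_map T (subtopology T G0) p" and q: "continuous_map T (subtopology T G0) q"
    and "x \<in> G" "y \<in> G" "p x \<noteq> q y"
  obtains A B where "openin T A" "openin T B" "x \<in> A" "y \<in> B"
    "\<And>a b. a \<in> A \<Longrightarrow> b \<in> B \<Longrightarrow> p a \<noteq> q b"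
proof -
  have "p x \<in> topspace (subtopology T G0)" "q y \<in> topspace (subtopology T G0)"
    using p q assms(3,4) by (auto simp: continuous_map_def)
  then obtain P Q where PQ: "openin (subtopology T G0) P" "openin (subtopology T G0) Q"
    "p x \<in> P" "q y \<in> Q" "disjnt P Q"
    using G0_Hausdorff assms(5) unfolding Hausdorff_space_def by blast
  have "openin T {a \<in> G. p a \<in> P}" "openin T {b \<in> G. q b \<in> Q}"
    using p q PQ openin_continuous_map_preimage by blast+
  then show thesis
    using PQ assms(3,4) by (intro that[of "{a \<in> G. p a \<in> P}" "{b \<in> G. q b \<in> Q}"]) (auto simp: disjnt_def)
qed

lemma div_nbhd:
  assumes "y \<in> G" "x \<in> G" "r y = r x" "openin T W" "m (i y) x \<in> W"
  obtains A B where "openin T A" "openin T B" "y \<in> A" "x \<in> B"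
    "\<And>a b. a \<in> A \<Longrightarrow> b \<in> B \<Longrightarrow> r a = r b \<Longrightarrow> m (i a) b \<in> W"
proof -
  obtain A B where AB: "openin T A" "openin T B" "i y \<in> A" "x \<in> B"
    "\<And>a b. a \<in> A \<Longrightarrow> b \<in> B \<Longrightarrow> d a = r b \<Longrightarrow> m a b \<in> W"
    using m_nbhd[of "i y" x W] assms by (auto simp: gsimps)
  have "openin T {a \<in> G. i a \<in> A}"
    using i_continuous AB(1) by (rule openin_continuous_map_preimage)
  then show thesis
    using AB assms(1) by (intro that[of "{a \<in> G. i a \<in> A}" B]) (auto simp: gsimps)
qed

lemma lch: "lch_base T"
  using lc unfolding lc_groupoid_def lch_base_def by meson

lemma second_countable_T: "second_countable T"
proof -
  obtain \<K> where K: "countable \<K>"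
    "\<And>U x. openin T U \<Longrightarrow> x \<in> U \<Longrightarrow> \<exists>K\<in>\<K>. x \<in> T interior_of K \<and> T interior_of K \<subseteq> U"
    using lc unfolding lc_groupoid_def by meson
  have "\<exists>V\<in>(\<lambda>K. T interior_of K) ` \<K>. x \<in> V \<and> V \<subseteq> U" if "openin T U" "x \<in> U" for U x
    using K(2)[OF that] by auto
  moreover have "\<forall>V\<in>(\<lambda>K. T interior_of K) ` \<K>. openin T V" by auto
  moreover have "countable ((\<lambda>K. T interior_of K) ` \<K>)" using K(1) by simp
  ultimately show ?thesis unfolding second_countable_def by meson
qed

section \<open>Haar measures on the range fibres\<close>

lemma rfib_G: "x \<in> rfib T r u \<longleftrightarrow> x \<in> G \<and> r x = u"
  by (simp add: rfib_def)

lemma dfib_G: "x \<in> dfib T d u \<longleftrightarrow> x \<in> G \<and> d x = u"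
  by (simp add: dfib_def)

lemma lam_regular: "u \<in> G0 \<Longrightarrow> regular_borel_on (subtopology T (rfib T r u)) (lam u)"
  using lc by (simp add: lc_groupoid_def haar_system_def)

lemma topspace_rfib [simp]: "topspace (subtopology T (rfib T r u)) = rfib T r u"
  by (auto simp: rfib_def)

lemma topspace_dfib [simp]: "topspace (subtopology T (dfib T d u)) = dfib T d u"
  by (auto simp: dfib_def)

lemma sets_lam: "u \<in> G0 \<Longrightarrow> sets (lam u) = sets (borel_top (subtopology T (rfib T r u)))"
  and space_lam: "u \<in> G0 \<Longrightarrow> space (lam u) = rfib T r u"
  using lam_regular[of u] unfolding regular_borel_on_def topspace_rfib by auto

lemma lam_integrable: "u \<in> G0 \<Longrightarrow> f \<in> Cc T \<Longrightarrow> integrable (lam u) f"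
  using lc by (simp add: lc_groupoid_def haar_system_def)

lemma lam_continuous: "f \<in> Cc T \<Longrightarrow> continuous_map (subtopology T G0) euclidean (\<lambda>u. \<integral>y. f y \<partial>lam u)"
  using lc by (simp add: lc_groupoid_def haar_system_def)

lemma lam_compact: "f \<in> Cc T \<Longrightarrow>
    \<exists>K. compactin (subtopology T G0) K \<and> (\<forall>u\<in>G0 - K. (\<integral>y. f y \<partial>lam u) = 0)"
  using lc by (simp add: lc_groupoid_def haar_system_def)

lemma lam_invariant: "f \<in> Cc T \<Longrightarrow> x \<in> G \<Longrightarrow> (\<integral>z. f (m x z) \<partial>lam (d x)) = (\<integral>y. f y \<partial>lam (r x))"
  using lc by (simp add: lc_groupoid_def haar_system_def)

lemma measurable_lam:
  assumes "u \<in> G0" "continuous_map (subtopology T (rfib T r u)) T h" "f \<in> borel_measurable (borel_top T)"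
  shows "(\<lambda>y. f (h y)) \<in> borel_measurable (lam u)"
proof -
  have "h \<in> measurable (lam u) (borel_top T)"
    using continuous_map_borel_top[OF assms(2)] measurable_cong_sets[OF sets_lam[OF assms(1)] refl] by blast
  then show ?thesis using assms(3) by (rule measurable_compose)
qed

lemma continuous_map_subtopology_id: "continuous_map (subtopology T S) T (\<lambda>x. x)"
  by (intro continuous_map_from_subtopology) simp

lemma Cc_div_measurable:
  assumes "x \<in> G" "g \<in> Cc T" shows "(\<lambda>y. g (m (i y) x)) \<in> borel_measurable (lam (r x))"
proof (rule measurable_lam)
  show "continuous_map (subtopology T (rfib T r (r x))) T (\<lambda>y. m (i y) x)"
    using assms by (intro continuous_map_m continuous_map_i continuous_map_subtopology_id)
      (auto simp: rfib_G gsimps)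
qed (use assms Cc_measurable in auto)

lemma conv_integrable:
  assumes "f \<in> Cc T" "g \<in> Cc T" "x \<in> G"
  shows "integrable (lam (r x)) (\<lambda>y. f y * g (m (i y) x))"
proof -
  obtain B where B: "\<And>x. cmod (g x) \<le> B" using Cc_bounded[OF assms(2)] by blast
  have f: "integrable (lam (r x)) f" using lam_integrable assms by simp
  show ?thesis
  proof (rule Bochner_Integration.integrable_bound)
    show "integrable (lam (r x)) (\<lambda>y. B * cmod (f y))" using f by simp
    show "(\<lambda>y. f y * g (m (i y) x)) \<in> borel_measurable (lam (r x))"
      using f Cc_div_measurable[OF assms(3,2)] by measurable
    have "cmod (f y * g (m (i y) x)) \<le> norm (B * cmod (f y))" for y
      using mult_left_mono[OF order_trans[OF B[of "m (i y) x"] abs_ge_self], of "cmod (f y)"]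
      by (simp add: norm_mult mult.commute abs_mult)
    then show "AE y in lam (r x). cmod (f y * g (m (i y) x)) \<le> norm (B * cmod (f y))" by simp
  qed
qed

section \<open>Convolution on \<open>Cc\<close>\<close>

abbreviation cv :: "('g \<Rightarrow> complex) \<Rightarrow> ('g \<Rightarrow> complex) \<Rightarrow> 'g \<Rightarrow> complex" (infixl "\<star>" 70) where
  "f \<star> g \<equiv> conv T r m i lam f g"

lemma conv_add_left: "f \<in> Cc T \<Longrightarrow> f' \<in> Cc T \<Longrightarrow> g \<in> Cc T \<Longrightarrow>
    (\<lambda>x. f x + f' x) \<star> g = (\<lambda>x. (f \<star> g) x + (f' \<star> g) x)"
  by (auto simp: conv_def fun_eq_iff distrib_right conv_integrable)

lemma conv_add_right: "f \<in> Cc T \<Longrightarrow> g \<in> Cc T \<Longrightarrow> g' \<in> Cc T \<Longrightarrow>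
    f \<star> (\<lambda>x. g x + g' x) = (\<lambda>x. (f \<star> g) x + (f \<star> g') x)"
  by (auto simp: conv_def fun_eq_iff distrib_left conv_integrable)

lemma conv_zero_left: "(\<lambda>x. 0) \<star> g = (\<lambda>x. 0)" and conv_zero_right: "f \<star> (\<lambda>x. 0) = (\<lambda>x. 0)"
  by (auto simp: conv_def)

lemma conv_sum_left:
  "(\<And>k. k \<in> I \<Longrightarrow> f k \<in> Cc T) \<Longrightarrow> g \<in> Cc T \<Longrightarrow> (\<lambda>x. \<Sum>k\<in>I. f k x) \<star> g = (\<lambda>x. \<Sum>k\<in>I. (f k \<star> g) x)"
proof (induction I rule: infinite_finite_induct)
  case (insert a F)
  then show ?case
    using conv_add_left[of "f a" "\<lambda>x. \<Sum>k\<in>F. f k x" g] Cc_sum[of F f T] by simp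
qed (auto simp: conv_zero_left)

lemma conv_sum_right:
  "(\<And>k. k \<in> I \<Longrightarrow> g k \<in> Cc T) \<Longrightarrow> f \<in> Cc T \<Longrightarrow> f \<star> (\<lambda>x. \<Sum>k\<in>I. g k x) = (\<lambda>x. \<Sum>k\<in>I. (f \<star> g k) x)"
proof (induction I rule: infinite_finite_induct)
  case (insert a F)
  then show ?case
    using conv_add_right[of f "g a" "\<lambda>x. \<Sum>k\<in>F. g k x"] Cc_sum[of F g T] by simp
qed (auto simp: conv_zero_right)

text \<open>For a single Hausdorff piece the modulus is again in \<open>Cc\<close>, so its fibre
  integrals form a continuous function of compact support on the unit space, which is bounded. For a
  sum the modulus may leave \<open>Cc\<close>; there the bounds of the pieces are added.\<close>

lemma Cc_lam_bound:
  assumes "f \<in> Cc T" shows "\<exists>C\<ge>0. \<forall>u\<in>G0. (\<integral>y. cmod (f y) \<partial>lam u) \<le> C"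
  using assms
proof (induction rule: Cc_induct)
  case (basic U K f)
  let ?g = "\<lambda>x. complex_of_real (cmod (f x))"
  have g: "?g \<in> Cc T"
    using cc_on_comp[OF basic, of "\<lambda>z. complex_of_real (cmod z)"]
    by (intro cc_on_Cc) (auto intro!: continuous_intros)
  obtain Q where Q: "compactin (subtopology T G0) Q" "\<And>u. u \<in> G0 - Q \<Longrightarrow> (\<integral>y. ?g y \<partial>lam u) = 0"
    using lam_compact[OF g] by blast
  have "compactin euclidean ((\<lambda>u. \<integral>y. ?g y \<partial>lam u) ` Q)"
    using Q(1) lam_continuous[OF g] by (rule image_compactin)
  then obtain B where B: "\<And>u. u \<in> Q \<Longrightarrow> cmod (\<integral>y. ?g y \<partial>lam u) \<le> B"
    using compact_imp_bounded bounded_iff by (metis compactin_euclidean_iff imageI)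
  have "(\<integral>y. cmod (f y) \<partial>lam u) \<le> max B 0" if u: "u \<in> G0" for u
  proof -
    have *: "cmod (\<integral>y. ?g y \<partial>lam u) = (\<integral>y. cmod (f y) \<partial>lam u)"
      by (simp add: Bochner_Integration.integral_nonneg)
    show ?thesis
    proof (cases "u \<in> Q")
      case True
      then show ?thesis using B[OF True] * by simp
    next
      case False
      then show ?thesis using Q(2)[of u] u * by simp
    qed
  qed
  then show ?case by (intro exI[of _ "max B 0"]) auto
next
  case zero
  then show ?case by (intro exI[of _ 0]) auto
next
  case (add f g)
  then obtain C C' where C: "0 \<le> C" "0 \<le> C'" "\<And>u. u \<in> G0 \<Longrightarrow> (\<integral>y. cmod (f y) \<partial>lam u) \<le> C"
    "\<And>u. u \<in> G0 \<Longrightarrow> (\<integral>y. cmod (g y) \<partial>lam u) \<le> C'" by blast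
  have "(\<integral>y. cmod (f y + g y) \<partial>lam u) \<le> C + C'" if u: "u \<in> G0" for u
  proof -
    have i: "integrable (lam u) (\<lambda>y. cmod (f y))" "integrable (lam u) (\<lambda>y. cmod (g y))"
      "integrable (lam u) (\<lambda>y. cmod (f y + g y))"
      using lam_integrable[OF u] add Cc_add by (auto intro: integrable_norm)
    have "(\<integral>y. cmod (f y + g y) \<partial>lam u) \<le> (\<integral>y. cmod (f y) + cmod (g y) \<partial>lam u)"
      using i by (intro integral_mono) (auto intro: norm_triangle_ineq)
    also have "\<dots> \<le> C + C'" using i C u by (simp add: add_mono)
    finally show ?thesis .
  qed
  then show ?case using C by (intro exI[of _ "C + C'"]) auto
qed

definition smul :: "'g set \<Rightarrow> 'g set \<Rightarrow> 'g set" where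
  "smul A B = {m a b |a b. a \<in> A \<and> b \<in> B \<and> d a = r b}"

lemma smul_mono: "A \<subseteq> A' \<Longrightarrow> B \<subseteq> B' \<Longrightarrow> smul A B \<subseteq> smul A' B'"
  by (auto simp: smul_def)

text \<open>The composable pairs form a closed set because the unit space is Hausdorff. They meet
  the compact product of A and B in a compact set, whose image under multiplication is
  taken.\<close>

lemma compactin_smul:
  assumes "compactin T A" "compactin T B" shows "compactin T (smul A B)"
proof -
  have sub: "A \<subseteq> G" "B \<subseteq> G" using assms compactin_subset_topspace by auto
  have "closedin (prod_topology T T) {p \<in> topspace (prod_topology T T). (d \<circ> fst) p = (r \<circ> snd) p}"
    by (intro closedin_continuous_maps_eq[OF G0_Hausdorff] continuous_map_compose[OF _ d_continuous]
        continuous_map_compose[OF _ r_continuous] continuous_map_fst continuous_map_snd)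
  moreover have "{p \<in> topspace (prod_topology T T). (d \<circ> fst) p = (r \<circ> snd) p} = composable G r d"
    by (auto simp: composable_def)
  moreover have "compactin (prod_topology T T) (A \<times> B)"
    using assms by (simp add: compactin_Times)
  ultimately have "compactin (prod_topology T T) (composable G r d \<inter> (A \<times> B))"
    using closed_Int_compactin by metis
  then have "compactin (subtopology (prod_topology T T) (composable G r d)) (composable G r d \<inter> (A \<times> B))"
    by (simp add: compactin_subtopology)
  from image_compactin[OF this m_continuous]
  have "compactin T ((\<lambda>(x, y). m x y) ` (composable G r d \<inter> (A \<times> B)))" .
  moreover have "(\<lambda>(x, y). m x y) ` (composable G r d \<inter> (A \<times> B)) = smul A B"
    using sub by (auto simp: smul_def composable_def image_iff)
  ultimately show ?thesis by simp
qed

text \<open>In a non-Hausdorff groupoid \<open>K\<close> need not be closed; compactness of \<open>K\<close> together with the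
  Hausdorff set \<open>W\<close> containing the products replaces closedness.\<close>
lemma div_avoids_compact:
  assumes K: "compactin T K" and y: "y \<in> G" and W: "openin T W" "Hausdorff_space (subtopology T W)"
    and yK: "smul {y} K \<subseteq> W" and x: "x \<in> W" "\<not> (r y = r x \<and> m (i y) x \<in> K)"
  obtains A N where "openin T A" "openin T N" "y \<in> A" "x \<in> N"
    "\<And>a b. a \<in> A \<Longrightarrow> b \<in> N \<Longrightarrow> r a = r b \<Longrightarrow> m (i a) b \<notin> K"
proof -
  have xG: "x \<in> G" using W x openin_subset by blast
  \<comment> \<open>For a point z of K: neighbourhoods of y and z all of whose products avoid a
    neighbourhood of x.\<close>
  define R where "R z Z A N \<longleftrightarrow> openin T Z \<and> openin T A \<and> openin T N \<and> z \<in> Z \<and> y \<in> A \<and> x \<in> N \<and>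
    (\<forall>a\<in>A. \<forall>z'\<in>Z. d a = r z' \<longrightarrow> m a z' \<notin> N)" for z Z A N
  have ex: "\<exists>Z A N. R z Z A N" if z: "z \<in> K" for z
  proof -
    have zG: "z \<in> G" using K z compactin_subset_topspace by blast
    show ?thesis
    proof (cases "d y = r z")
      case True
      have yz: "m y z \<in> W" using yK z True by (auto simp: smul_def)
      have "m y z \<noteq> x"
      proof
        assume "m y z = x"
        then have "r y = r x" "m (i y) x = z"
          using True y zG by (auto simp: gsimps i_m_cancel)
        then show False using x z by simp
      qed
      moreover have tW: "topspace (subtopology T W) = W" using W(1) openin_subset by fastforce
      ultimately obtain O1 N where ON: "openin (subtopology T W) O1" "openin (subtopology T W) N"
        "m y z \<in> O1" "x \<in> N" "disjnt O1 N"
        using W(2) yz x(1) unfolding Hausdorff_space_def by metis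
      have O: "openin T O1" "openin T N" using ON W(1) by (auto simp: openin_open_subtopology)
      obtain A Z where "openin T A" "openin T Z" "y \<in> A" "z \<in> Z"
        "\<And>a b. a \<in> A \<Longrightarrow> b \<in> Z \<Longrightarrow> d a = r b \<Longrightarrow> m a b \<in> O1"
        using m_nbhd[OF y zG True O(1) ON(3)] by blast
      then have "R z Z A N" using O(2) ON(4,5) unfolding R_def disjnt_iff by blast
      then show ?thesis by blast
    next
      case False
      obtain A Z where "openin T A" "openin T Z" "y \<in> A" "z \<in> Z"
        "\<And>a b. a \<in> A \<Longrightarrow> b \<in> Z \<Longrightarrow> d a \<noteq> r b"
        using separate_values[OF d_continuous r_continuous y zG False] by blast
      \<comment> \<open>No products exist near (y, z), so the neighbourhood of x can be the whole
        space.\<close>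
      then have "R z Z A G" using xG by (auto simp: R_def)
      then show ?thesis by blast
    qed
  qed
  obtain Z where "\<forall>z\<in>K. \<exists>A N. R z (Z z) A N"
    using bchoice[of K "\<lambda>z Z. \<exists>A N. R z Z A N"] ex by blast
  then obtain A where "\<forall>z\<in>K. \<exists>N. R z (Z z) (A z) N"
    using bchoice[of K "\<lambda>z A. \<exists>N. R z (Z z) A N"] by blast
  then obtain N where R: "\<forall>z\<in>K. R z (Z z) (A z) (N z)"
    using bchoice[of K "\<lambda>z N. R z (Z z) (A z) N"] by blast
  have "(\<forall>Q\<in>Z ` K. openin T Q) \<and> K \<subseteq> \<Union>(Z ` K)" using R unfolding R_def by blast
  then have "\<exists>\<F>. finite \<F> \<and> \<F> \<subseteq> Z ` K \<and> K \<subseteq> \<Union>\<F>"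
    using K unfolding compactin_def by blast
  then obtain F where F: "finite F" "F \<subseteq> K" "K \<subseteq> (\<Union>z\<in>F. Z z)"
    by (metis finite_subset_image)
  \<comment> \<open>The intersection with \<open>G\<close> gives an open set also when the finite
    subcover is empty.\<close>
  define A' where "A' = G \<inter> (\<Inter>z\<in>F. A z)"
  define N' where "N' = G \<inter> (\<Inter>z\<in>F. N z)"
  have fin: "openin T (G \<inter> (\<Inter>z\<in>F. Q z))" if "\<And>z. z \<in> F \<Longrightarrow> openin T (Q z)" for Q
  proof (cases "F = {}")
    case False
    then show ?thesis using F(1) that by (intro openin_Int openin_INT2) auto
  qed simp
  show thesis
  proof (rule that[of A' N'])
    show "openin T A'" unfolding A'_def by (rule fin) (use R F(2) in \<open>auto simp: R_def\<close>)
    show "openin T N'" unfolding N'_def by (rule fin) (use R F(2) in \<open>auto simp: R_def\<close>)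
    show "y \<in> A'" "x \<in> N'" using R F(2) y xG by (auto simp: R_def A'_def N'_def)
    fix a b assume ab: "a \<in> A'" "b \<in> N'" "r a = r b"
    then have G: "a \<in> G" "b \<in> G" by (auto simp: A'_def N'_def)
    show "m (i a) b \<notin> K"
    proof
      assume "m (i a) b \<in> K"
      then obtain z where z: "z \<in> F" "m (i a) b \<in> Z z" using F(3) by blast
      have "m a (m (i a) b) = b" "d a = r (m (i a) b)" using G ab(3) by (auto simp: m_i_cancel gsimps)
      moreover have "R z (Z z) (A z) (N z)" "a \<in> A z" "b \<in> N z"
        using R F(2) z ab by (auto simp: A'_def N'_def)
      ultimately show False using z(2) unfolding R_def by metis
    qed
  qed
qed

text \<open>Continuity is the only difficulty. Near x0, f is cut into pieces such that on each of
  them a |-> g(a^{-1} x) is almost a constant, for all x close to x0. Then the convolution is almost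
  the combination \<open>J\<close> of the fibre integrals of the pieces, and these are continuous by
  the axioms of a Haar system. The Hausdorff set W makes this possible at points where the quotient
  lies outside the support of g: g need not be continuous there, but nearby quotients stay off the
  support.\<close>

lemma conv_cc_on_small:
  assumes f: "cc_on T U Kf f" and g: "cc_on T V Kg g"
    and W: "openin T W" "Hausdorff_space (subtopology T W)" and UV: "smul U V \<subseteq> W"
  shows "cc_on T W (smul Kf Kg) (f \<star> g)"
proof -
  note Df = cc_onD[OF f] and Dg = cc_onD[OF g]
  have fC: "f \<in> Cc T" and gC: "g \<in> Cc T" using f g cc_on_Cc by auto
  have KW: "smul Kf Kg \<subseteq> W" using smul_mono[OF Df(5) Dg(5)] UV by blast
  have KG: "Kf \<subseteq> G" "Kg \<subseteq> G" using Df(4) Dg(4) compactin_subset_topspace by auto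
  have zero: "(f \<star> g) x = 0" if "x \<notin> smul Kf Kg" for x
  proof (cases "x \<in> G")
    case True
    have "f y * g (m (i y) x) = 0" if y: "y \<in> space (lam (r x))" for y
    proof (rule ccontr)
      assume "f y * g (m (i y) x) \<noteq> 0"
      then have "y \<in> Kf" "m (i y) x \<in> Kg" using Df(6) Dg(6) by auto
      moreover have "y \<in> G" "r y = r x" using y True by (auto simp: space_lam rfib_G)
      ultimately have "x \<in> smul Kf Kg"
        unfolding smul_def mem_Collect_eq using True
        by (intro exI[of _ y] exI[of _ "m (i y) x"]) (auto simp: m_i_cancel gsimps)
      then show False using that \<open>x \<notin> smul Kf Kg\<close> by simp
    qed
    then have "(\<integral>y. f y * g (m (i y) x) \<partial>lam (r x)) = 0"
      by (intro integral_eq_zero_AE) auto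
    then show ?thesis by (simp add: conv_def)
  qed (simp add: conv_def)
  obtain C where C: "0 \<le> C" "\<And>u. u \<in> G0 \<Longrightarrow> (\<integral>y. cmod (f y) \<partial>lam u) \<le> C"
    using Cc_lam_bound[OF fC] by blast
  have "continuous_map (subtopology T W) euclidean (f \<star> g)"
  proof (rule continuous_map_epsilon[OF W(1)])
    fix x0 and e :: real assume x0: "x0 \<in> W" and e: "0 < e"
    have x0G: "x0 \<in> G" using x0 W(1) openin_subset by blast
    \<comment> \<open>The integral of |f| over every fibre is at most C, so an error
      \<open>\<epsilon>\<close> in g changes the convolution by at most e / 4; the summand 1 avoids
      division by 0.\<close>
    define \<epsilon> where "\<epsilon> = e / (4 * (C + 1))"
    have \<epsilon>: "0 < \<epsilon>" using e C by (simp add: \<epsilon>_def)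
    define near where "near A c N \<longleftrightarrow> openin T N \<and> x0 \<in> N \<and>
      (\<forall>a\<in>A. \<forall>x\<in>N. r a = r x \<longrightarrow> cmod (g (m (i a) x) - c) \<le> \<epsilon>)" for A c N
    have loc: "\<exists>A. openin T A \<and> y \<in> A \<and> (\<exists>c N. near A c N)" if y: "y \<in> Kf" for y
    proof -
      have yG: "y \<in> G" using y KG by auto
      show ?thesis
      proof (cases "r y = r x0 \<and> m (i y) x0 \<in> Kg")
        case True
        let ?z = "m (i y) x0"
        define Q where "Q = {z \<in> V. g z \<in> ball (g ?z) \<epsilon>}"
        have Q: "openin T Q" unfolding Q_def by (rule cc_on_openin_preimage[OF g]) simp
        have zQ: "?z \<in> Q" using True Dg(5) \<epsilon> by (auto simp: Q_def)
        obtain A N where AN: "openin T A" "openin T N" "y \<in> A" "x0 \<in> N"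
          "\<And>a b. a \<in> A \<Longrightarrow> b \<in> N \<Longrightarrow> r a = r b \<Longrightarrow> m (i a) b \<in> Q"
          using div_nbhd[OF yG x0G _ Q zQ] True by blast
        have "near A (g ?z) N"
          unfolding near_def
        proof (intro conjI ballI impI)
          fix a x assume "a \<in> A" "x \<in> N" "r a = r x"
          then have "m (i a) x \<in> Q" using AN(5) by blast
          then show "cmod (g (m (i a) x) - g ?z) \<le> \<epsilon>"
            by (simp add: Q_def dist_norm norm_minus_commute less_imp_le)
        qed (use AN in auto)
        then show ?thesis using AN by blast
      next
        case False
        \<comment> \<open>Off the support of g the constant is 0, and the quotients near this point
          do not return to \<open>Kg\<close> because the products lie in the Hausdorff set
          W.\<close>
        have "smul {y} Kg \<subseteq> W"
          using smul_mono[of "{y}" U Kg V] y Df(5) Dg(5) UV by blast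
        then obtain A N where AN: "openin T A" "openin T N" "y \<in> A" "x0 \<in> N"
          "\<And>a b. a \<in> A \<Longrightarrow> b \<in> N \<Longrightarrow> r a = r b \<Longrightarrow> m (i a) b \<notin> Kg"
          using div_avoids_compact[OF Dg(4) yG W _ x0 False] by blast
        then have "near A 0 N" using Dg(6) \<epsilon> unfolding near_def by (auto simp: less_imp_le)
        then show ?thesis using AN by blast
      qed
    qed
    have her: "\<exists>c N. near A' c N" if nr: "\<exists>c N. near A c N" and "openin T A'" and sub: "A' \<subseteq> A" for A A'
    proof -
      obtain c N where "near A c N" using nr by blast
      then have "near A' c N" using sub unfolding near_def by blast
      then show ?thesis by blast
    qed
    have "\<exists>(F :: 'g set) A D \<phi>. finite F \<and> (\<forall>y\<in>F. cc_on T (A y) (D y) (\<phi> y) \<and> (\<exists>c N. near (A y) c N)) \<and>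
        (\<forall>x. f x = (\<Sum>y\<in>F. \<phi> y x)) \<and> (\<forall>x. (\<Sum>y\<in>F. cmod (\<phi> y x)) = cmod (f x))"
    proof (rule cc_on_localise[OF lch f, where P = "\<lambda>y A. \<exists>c N. near A c N"])
      show "\<exists>A. openin T A \<and> y \<in> A \<and> (\<exists>c N. near A c N)" if "y \<in> Kf" for y using that by (rule loc)
      show "(\<exists>c N. near A' c N)" if "(\<exists>c N. near A c N)" "openin T A'" "A' \<subseteq> A" for y A A' using that by (rule her)
    qed
    then obtain F :: "'g set" and A D \<phi> where F0: "finite F"
      "\<forall>y\<in>F. cc_on T (A y) (D y) (\<phi> y) \<and> (\<exists>c N. near (A y) c N)"
      "\<forall>x. f x = (\<Sum>y\<in>F. \<phi> y x)"
      "\<forall>x. (\<Sum>y\<in>F. cmod (\<phi> y x)) = cmod (f x)"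
      by (elim exE conjE) (rule that, assumption+)
    then have F: "finite F"
      "\<And>y. y \<in> F \<Longrightarrow> cc_on T (A y) (D y) (\<phi> y)" "\<And>y. y \<in> F \<Longrightarrow> \<exists>c N. near (A y) c N"
      "\<And>x. f x = (\<Sum>y\<in>F. \<phi> y x)" "\<And>x. (\<Sum>y\<in>F. cmod (\<phi> y x)) = cmod (f x)"
      by blast+
    obtain c where "\<forall>y\<in>F. \<exists>N. near (A y) (c y) N"
      using bchoice[of F "\<lambda>y c. \<exists>N. near (A y) c N"] F(3) by blast
    then obtain N where N: "\<forall>y\<in>F. near (A y) (c y) (N y)"
      using bchoice[of F "\<lambda>y N. near (A y) (c y) N"] by blast
    have \<phi>C: "\<phi> y \<in> Cc T" if "y \<in> F" for y using F(2)[OF that] by (rule cc_on_Cc)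
    define J where "J x = (\<Sum>y\<in>F. c y * (\<integral>a. \<phi> y a \<partial>lam (r x)))" for x
    have Jc: "continuous_map T euclidean J"
      unfolding J_def
    proof (intro continuous_map_sum F(1))
      fix y assume "y \<in> F"
      have "continuous_map T euclidean ((\<lambda>u. \<integral>a. \<phi> y a \<partial>lam u) \<circ> r)"
        by (rule continuous_map_compose[OF r_continuous lam_continuous[OF \<phi>C[OF \<open>y \<in> F\<close>]]])
      then show "continuous_map T euclidean (\<lambda>x. c y * (\<integral>a. \<phi> y a \<partial>lam (r x)))"
        using continuous_map_comp_continuous[of T _ "\<lambda>z. c y * z"] by (auto simp: o_def intro!: continuous_intros)
    qed
    define N' where "N' = {x \<in> G. J x \<in> ball (J x0) (e / 4)} \<inter> (\<Inter>y\<in>F. N y)"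
    have "openin T {x \<in> G. J x \<in> ball (J x0) (e / 4)}"
      by (rule openin_continuous_map_preimage[OF Jc]) simp
    then have N'o: "openin T N'"
      unfolding N'_def using F(1) N by (cases "F = {}") (auto simp: near_def intro!: openin_Int openin_INT2)
    have N'x: "x0 \<in> N'" using N x0G e by (auto simp: N'_def near_def)
    have close: "cmod ((f \<star> g) x - J x) \<le> e / 4" if x: "x \<in> N'" for x
    proof -
      have xG: "x \<in> G" using x by (auto simp: N'_def)
      have u: "r x \<in> G0" using xG by simp
      let ?M = "lam (r x)"
      have i\<phi>: "integrable ?M (\<phi> y)" if "y \<in> F" for y using lam_integrable[OF u \<phi>C[OF that]] .
      have ic: "integrable ?M (\<lambda>a. \<phi> y a * g (m (i a) x))" if "y \<in> F" for y
        using conv_integrable[OF \<phi>C[OF that] gC xG] .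
      have "(f \<star> g) x = (\<integral>a. (\<Sum>y\<in>F. \<phi> y a * g (m (i a) x)) \<partial>?M)"
        using xG by (simp add: conv_def F(4) sum_distrib_right)
      also have "\<dots> = (\<Sum>y\<in>F. \<integral>a. \<phi> y a * g (m (i a) x) \<partial>?M)"
        using ic by (intro Bochner_Integration.integral_sum)
      finally have "(f \<star> g) x - J x = (\<Sum>y\<in>F. (\<integral>a. \<phi> y a * g (m (i a) x) \<partial>?M) - c y * (\<integral>a. \<phi> y a \<partial>?M))"
        by (simp add: J_def sum_subtractf)
      also have "\<dots> = (\<Sum>y\<in>F. \<integral>a. \<phi> y a * g (m (i a) x) - c y * \<phi> y a \<partial>?M)"
        using ic i\<phi> by (intro sum.cong) auto
      finally have "cmod ((f \<star> g) x - J x) \<le> (\<Sum>y\<in>F. cmod (\<integral>a. \<phi> y a * g (m (i a) x) - c y * \<phi> y a \<partial>?M))"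
        by (simp add: norm_sum)
      also have "\<dots> \<le> (\<Sum>y\<in>F. \<integral>a. \<epsilon> * cmod (\<phi> y a) \<partial>?M)"
      proof (rule sum_mono)
        fix y assume y: "y \<in> F"
        have "cmod (\<integral>a. \<phi> y a * g (m (i a) x) - c y * \<phi> y a \<partial>?M)
            \<le> (\<integral>a. cmod (\<phi> y a * g (m (i a) x) - c y * \<phi> y a) \<partial>?M)"
          by (rule integral_norm_bound)
        also have "\<dots> \<le> (\<integral>a. \<epsilon> * cmod (\<phi> y a) \<partial>?M)"
        proof (rule integral_mono)
          show "integrable ?M (\<lambda>a. cmod (\<phi> y a * g (m (i a) x) - c y * \<phi> y a))"
            using ic[OF y] i\<phi>[OF y] by (intro integrable_norm Bochner_Integration.integrable_diff) auto
          show "integrable ?M (\<lambda>a. \<epsilon> * cmod (\<phi> y a))" using i\<phi>[OF y] by simp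
          fix a assume a: "a \<in> space ?M"
          then have ra: "r a = r x" using u by (simp add: space_lam rfib_G)
          show "cmod (\<phi> y a * g (m (i a) x) - c y * \<phi> y a) \<le> \<epsilon> * cmod (\<phi> y a)"
          proof (cases "a \<in> A y")
            case True
            have "near (A y) (c y) (N y)" "x \<in> N y" using N y x by (auto simp: N'_def)
            then have "cmod (g (m (i a) x) - c y) \<le> \<epsilon>" using True ra by (auto simp: near_def)
            then have "cmod (\<phi> y a) * cmod (g (m (i a) x) - c y) \<le> cmod (\<phi> y a) * \<epsilon>"
              by (rule mult_left_mono) simp
            then show ?thesis by (simp add: norm_mult[symmetric] algebra_simps)
          next
            case False
            then have "\<phi> y a = 0" using F(2)[OF y] by (simp add: cc_on_def)
            then show ?thesis by simp
          qed
        qed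
        finally show "cmod (\<integral>a. \<phi> y a * g (m (i a) x) - c y * \<phi> y a \<partial>?M) \<le> (\<integral>a. \<epsilon> * cmod (\<phi> y a) \<partial>?M)" .
      qed
      also have "\<dots> = \<epsilon> * (\<integral>a. (\<Sum>y\<in>F. cmod (\<phi> y a)) \<partial>?M)"
        using i\<phi> by (subst Bochner_Integration.integral_sum) (auto simp: sum_distrib_left)
      \<comment> \<open>The moduli of the pieces add up to |f|, so the error does not depend on how
        many pieces were taken.\<close>
      also have "\<dots> = \<epsilon> * (\<integral>a. cmod (f a) \<partial>?M)" by (simp add: F(5))
      also have "\<dots> \<le> \<epsilon> * (C + 1)" using C(2)[OF u] \<epsilon> by (intro mult_left_mono) auto
      also have "\<dots> = e / 4"
      proof -
        have "e / (4 * k) * k = e / 4" if "k \<noteq> 0" for k :: real using that by simp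
        from this[of "C + 1"] show ?thesis unfolding \<epsilon>_def using C(1) by linarith
      qed
      finally show ?thesis .
    qed
    have "dist ((f \<star> g) x) ((f \<star> g) x0) < e" if x: "x \<in> N'" for x
    proof -
      have J: "cmod (J x - J x0) < e / 4" using x by (simp add: N'_def dist_norm norm_minus_commute)
      have "(f \<star> g) x - (f \<star> g) x0 = ((f \<star> g) x - J x) + (J x - J x0) - ((f \<star> g) x0 - J x0)" by simp
      then have "cmod ((f \<star> g) x - (f \<star> g) x0) \<le> cmod ((f \<star> g) x - J x) + cmod (J x - J x0) + cmod ((f \<star> g) x0 - J x0)"
        by (simp only:) (intro order_trans[OF norm_triangle_ineq4] add_right_mono norm_triangle_ineq)
      also have "\<dots> < e" using close[OF x] close[OF N'x] J e by linarith
      finally show ?thesis by (simp add: dist_norm)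
    qed
    then show "\<exists>N. openin T N \<and> x0 \<in> N \<and> (\<forall>y\<in>N \<inter> W. dist ((f \<star> g) y) ((f \<star> g) x0) < e)"
      using N'o N'x by blast
  qed
  then show ?thesis
    using W KW zero compactin_smul[OF Df(4) Dg(4)] by (auto simp: cc_on_def compactin_subtopology)
qed

text \<open>A Hausdorff neighbourhood of the product is pulled back by continuity of the
  multiplication. If y and z are not composable, there are no products nearby and W can be
  empty.\<close>

lemma small_product_nbhd:
  assumes "y \<in> G" "z \<in> G"
  obtains A B W where "openin T A" "openin T B" "y \<in> A" "z \<in> B"
    "openin T W" "Hausdorff_space (subtopology T W)" "smul A B \<subseteq> W"
proof (cases "d y = r z")
  case True
  then have "m y z \<in> G" using assms by (simp add: gsimps)
  then obtain K where K: "Hausdorff_space (subtopology T K)" "m y z \<in> T interior_of K"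
    using lch unfolding lch_base_def by (metis openin_topspace)
  obtain A B where "openin T A" "openin T B" "y \<in> A" "z \<in> B"
    "\<And>a b. a \<in> A \<Longrightarrow> b \<in> B \<Longrightarrow> d a = r b \<Longrightarrow> m a b \<in> T interior_of K"
    using m_nbhd[OF assms True openin_interior_of K(2)] by blast
  then show thesis
    using Hausdorff_subtopology_mono[OF K(1) interior_of_subset]
    by (intro that[of A B "T interior_of K"]) (auto simp: smul_def)
next
  case False
  obtain A B where "openin T A" "openin T B" "y \<in> A" "z \<in> B"
    "\<And>a b. a \<in> A \<Longrightarrow> b \<in> B \<Longrightarrow> d a \<noteq> r b"
    using separate_values[OF d_continuous r_continuous assms False] by blast
  then show thesis
    by (intro that[of A B "{}"]) (auto simp: smul_def Hausdorff_space_def)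
qed

text \<open>The previous case requires all products of the two open sets to lie in one Hausdorff
  set. As in the tube lemma, for each y in the support of f the function g is cut into finitely many
  pieces that work for a whole neighbourhood of y; afterwards f is cut along these
  neighbourhoods.\<close>

lemma conv_Cc_basic:
  assumes f: "cc_on T U Kf f" and g: "cc_on T V Kg g" shows "f \<star> g \<in> Cc T"
proof -
  have KG: "Kf \<subseteq> G" "Kg \<subseteq> G" using cc_onD(4)[OF f] cc_onD(4)[OF g] compactin_subset_topspace by auto
  have fC: "f \<in> Cc T" and gC: "g \<in> Cc T" using f g cc_on_Cc by auto
  define good where "good A B \<longleftrightarrow> (\<exists>W. openin T W \<and> Hausdorff_space (subtopology T W) \<and> smul A B \<subseteq> W)" for A B
  have good_mono: "good A' B'" if "good A B" "A' \<subseteq> A" "B' \<subseteq> B" for A B A' B'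
    using that smul_mono[of A' A B' B] unfolding good_def by blast
  \<comment> \<open>g can be cut into pieces with small products with all of \<open>A\<close>. The
    cut may depend on \<open>A\<close>, since each piece of f is convolved with its own
    decomposition of g.\<close>
  define split where "split A \<longleftrightarrow> (\<exists>(F :: 'g set) B D \<psi>. finite F \<and> (\<forall>z\<in>F. cc_on T (B z) (D z) (\<psi> z) \<and> good A (B z)) \<and>
      (\<forall>x. g x = (\<Sum>z\<in>F. \<psi> z x)))" for A :: "'g set"
  have her: "split A'" if "split A" "openin T A'" "A' \<subseteq> A" for A A'
    using that(1) good_mono[OF _ that(3) order_refl] unfolding split_def by meson
  have loc: "\<exists>A. openin T A \<and> y \<in> A \<and> split A" if y: "y \<in> Kf" for y
  proof -
    have yG: "y \<in> G" using y KG by auto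
    define near where "near B \<longleftrightarrow> (\<exists>A. openin T A \<and> y \<in> A \<and> good A B)" for B
    have "\<exists>B. openin T B \<and> z \<in> B \<and> near B" if "z \<in> Kg" for z
    proof -
      have "z \<in> G" using that KG by auto
      then show ?thesis using small_product_nbhd[OF yG, of z] unfolding near_def good_def by metis
    qed
    note ex = this
    have nmono: "near B'" if "near B" "openin T B'" "B' \<subseteq> B" for B B'
      using that good_mono[OF _ order_refl that(3)] unfolding near_def by blast
    have "\<exists>(F :: 'g set) B D \<psi>. finite F \<and> (\<forall>z\<in>F. cc_on T (B z) (D z) (\<psi> z) \<and> near (B z)) \<and>
        (\<forall>x. g x = (\<Sum>z\<in>F. \<psi> z x)) \<and> (\<forall>x. (\<Sum>z\<in>F. cmod (\<psi> z x)) = cmod (g x))"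
    proof (rule cc_on_localise[OF lch g, where P = "\<lambda>z B. near B"])
      show "\<exists>A. openin T A \<and> y \<in> A \<and> near A" if "y \<in> Kg" for y using that by (rule ex)
      show "near A'" if "near A" "openin T A'" "A' \<subseteq> A" for y A A' using that by (rule nmono)
    qed
    then obtain F :: "'g set" and B D \<psi> where F0: "finite F"
      "\<forall>z\<in>F. cc_on T (B z) (D z) (\<psi> z) \<and> near (B z)"
      "\<forall>x. g x = (\<Sum>z\<in>F. \<psi> z x)"
      "\<forall>x. (\<Sum>z\<in>F. cmod (\<psi> z x)) = cmod (g x)"
      by (elim exE conjE) (rule that, assumption+)
    then have F: "finite F"
      "\<And>z. z \<in> F \<Longrightarrow> cc_on T (B z) (D z) (\<psi> z)" "\<And>z. z \<in> F \<Longrightarrow> near (B z)"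
      "\<And>x. g x = (\<Sum>z\<in>F. \<psi> z x)"
      by blast+
    have "\<forall>z\<in>F. \<exists>A. openin T A \<and> y \<in> A \<and> good A (B z)"
      using F(3) by (simp add: near_def)
    from bchoice[OF this] obtain A where A: "\<forall>z\<in>F. openin T (A z) \<and> y \<in> A z \<and> good (A z) (B z)"
      by (elim exE)
    define A' where "A' = G \<inter> (\<Inter>z\<in>F. A z)"
    have "openin T A'"
      unfolding A'_def using F(1) A by (cases "F = {}") (auto intro!: openin_Int openin_INT2)
    moreover have "y \<in> A'" using A yG by (auto simp: A'_def)
    moreover have "good A' (B z)" if "z \<in> F" for z
      using good_mono[of "A z" "B z" A' "B z"] A that by (auto simp: A'_def)
    then have "split A'"
      unfolding split_def using F
      by (intro exI[of _ F] exI[of _ B] exI[of _ D] exI[of _ \<psi>]) auto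
    ultimately show ?thesis by blast
  qed
  have "\<exists>(F :: 'g set) A D \<phi>. finite F \<and> (\<forall>y\<in>F. cc_on T (A y) (D y) (\<phi> y) \<and> split (A y)) \<and>
      (\<forall>x. f x = (\<Sum>y\<in>F. \<phi> y x)) \<and> (\<forall>x. (\<Sum>y\<in>F. cmod (\<phi> y x)) = cmod (f x))"
  proof (rule cc_on_localise[OF lch f, where P = "\<lambda>y A. split A"])
    show "\<exists>A. openin T A \<and> y \<in> A \<and> split A" if "y \<in> Kf" for y using that by (rule loc)
    show "split A'" if "split A" "openin T A'" "A' \<subseteq> A" for y A A' using that by (rule her)
  qed
  then obtain F :: "'g set" and A D \<phi> where F0: "finite F"
    "\<forall>y\<in>F. cc_on T (A y) (D y) (\<phi> y) \<and> split (A y)"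
    "\<forall>x. f x = (\<Sum>y\<in>F. \<phi> y x)"
    "\<forall>x. (\<Sum>y\<in>F. cmod (\<phi> y x)) = cmod (f x)"
    by (elim exE conjE) (rule that, assumption+)
  then have F: "finite F" "\<And>y. y \<in> F \<Longrightarrow> cc_on T (A y) (D y) (\<phi> y)"
    "\<And>y. y \<in> F \<Longrightarrow> split (A y)" "\<And>x. f x = (\<Sum>y\<in>F. \<phi> y x)"
    by blast+
  have "\<phi> y \<star> g \<in> Cc T" if y: "y \<in> F" for y
  proof -
    obtain F' :: "'g set" and B D' \<psi> where F': "finite F'" "\<forall>z\<in>F'. cc_on T (B z) (D' z) (\<psi> z) \<and> good (A y) (B z)"
      "\<forall>x. g x = (\<Sum>z\<in>F'. \<psi> z x)"
      using F(3)[OF y] unfolding split_def by (elim exE conjE) (rule that, assumption+)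
    have \<phi>C: "\<phi> y \<in> Cc T" using F(2)[OF y] by (rule cc_on_Cc)
    have \<psi>C: "\<psi> z \<in> Cc T" if "z \<in> F'" for z using F'(2) that cc_on_Cc by blast
    have "g = (\<lambda>x. \<Sum>z\<in>F'. \<psi> z x)" using F'(3) by blast
    then have "\<phi> y \<star> g = (\<lambda>x. \<Sum>z\<in>F'. (\<phi> y \<star> \<psi> z) x)"
      using conv_sum_right[OF \<psi>C \<phi>C] by simp
    moreover have "\<phi> y \<star> \<psi> z \<in> Cc T" if z: "z \<in> F'" for z
    proof -
      obtain W where W: "openin T W" "Hausdorff_space (subtopology T W)" "smul (A y) (B z) \<subseteq> W"
        using F'(2) z unfolding good_def by blast
      show ?thesis using conv_cc_on_small[OF F(2)[OF y] _ W] F'(2) z cc_on_Cc by blast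
    qed
    ultimately show ?thesis by (simp add: Cc_sum)
  qed
  moreover have "f = (\<lambda>x. \<Sum>y\<in>F. \<phi> y x)" using F(4) by blast
  then have "f \<star> g = (\<lambda>x. \<Sum>y\<in>F. (\<phi> y \<star> g) x)"
    using conv_sum_left[of F \<phi> g] F(2) cc_on_Cc gC by metis
  ultimately show ?thesis by (simp add: Cc_sum)
qed

lemma conv_Cc:
  assumes "f \<in> Cc T" "g \<in> Cc T" shows "f \<star> g \<in> Cc T"
  using assms(1)
proof (induction rule: Cc_induct)
  case f: (basic U K f)
  show ?case using assms(2)
  proof (induction rule: Cc_induct)
    case (basic U K g)
    then show ?case using conv_Cc_basic[OF f] by blast
  next
    case zero
    then show ?case by (simp add: conv_zero_right Cc_zero)
  next
    case (add g g')
    show ?case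
      unfolding conv_add_right[OF cc_on_Cc[OF f] add(1,2)] by (rule Cc_add[OF add(3,4)])
  qed
next
  case zero
  then show ?case by (simp add: conv_zero_left Cc_zero)
next
  case (add f f')
  show ?case
    unfolding conv_add_left[OF add(1,2) assms(2)] by (rule Cc_add[OF add(3,4)])
qed

lemma invol_Cc: "f \<in> Cc T \<Longrightarrow> invol T i f \<in> Cc T"
proof -
  assume "f \<in> Cc T"
  from Cc_cnj[OF Cc_homeo[OF this i_continuous]]
  have "(\<lambda>x. cnj (if x \<in> G then f (i x) else 0)) \<in> Cc T" by simp
  moreover have "(\<lambda>x. cnj (if x \<in> G then f (i x) else 0)) = invol T i f"
    by (auto simp: invol_def)
  ultimately show ?thesis by simp
qed

end

text \<open>By second countability an open set of the product is a countable union of open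
  rectangles. Joint measurability of the kernels of the regular representation rests on
  this.\<close>

lemma openin_prod_sets:
  assumes X: "second_countable X" and Y: "second_countable Y" and U: "openin (prod_topology X Y) U"
  shows "U \<in> sets (borel_top X \<Otimes>\<^sub>M borel_top Y)"
proof -
  obtain \<A> where A: "countable \<A>" "\<And>V. V \<in> \<A> \<Longrightarrow> openin X V"
    "\<And>V x. openin X V \<Longrightarrow> x \<in> V \<Longrightarrow> \<exists>W\<in>\<A>. x \<in> W \<and> W \<subseteq> V"
    using X unfolding second_countable_def by metis
  obtain \<B> where B: "countable \<B>" "\<And>V. V \<in> \<B> \<Longrightarrow> openin Y V"
    "\<And>V x. openin Y V \<Longrightarrow> x \<in> V \<Longrightarrow> \<exists>W\<in>\<B>. x \<in> W \<and> W \<subseteq> V"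
    using Y unfolding second_countable_def by metis
  define \<C> where "\<C> = {p \<in> \<A> \<times> \<B>. fst p \<times> snd p \<subseteq> U}"
  have "countable \<C>" unfolding \<C>_def
    by (rule countable_subset[of _ "\<A> \<times> \<B>"]) (use A(1) B(1) in auto)
  moreover have "fst p \<times> snd p \<in> sets (borel_top X \<Otimes>\<^sub>M borel_top Y)" if "p \<in> \<C>" for p
    using that A(2) B(2) unfolding \<C>_def by (intro pair_measureI openin_borel_top) auto
  ultimately have "(\<Union>p\<in>\<C>. fst p \<times> snd p) \<in> sets (borel_top X \<Otimes>\<^sub>M borel_top Y)"
    by (intro sets.countable_UN') auto
  moreover have "(\<Union>p\<in>\<C>. fst p \<times> snd p) = U"
  proof
    show "U \<subseteq> (\<Union>p\<in>\<C>. fst p \<times> snd p)"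
    proof clarify
      fix x y assume xy: "(x, y) \<in> U"
      then have "\<exists>V W. openin X V \<and> openin Y W \<and> x \<in> V \<and> y \<in> W \<and> V \<times> W \<subseteq> U"
        using U by (simp add: openin_prod_topology_alt)
      then obtain V W where VW: "openin X V" "openin Y W" "x \<in> V" "y \<in> W" "V \<times> W \<subseteq> U" by blast
      obtain V' where "V' \<in> \<A>" "x \<in> V'" "V' \<subseteq> V" using A(3)[OF VW(1,3)] by blast
      moreover obtain W' where "W' \<in> \<B>" "y \<in> W'" "W' \<subseteq> W" using B(3)[OF VW(2,4)] by blast
      ultimately have "(V', W') \<in> \<C>" "(x, y) \<in> V' \<times> W'" using VW(5) unfolding \<C>_def by auto
      then show "(x, y) \<in> (\<Union>p\<in>\<C>. fst p \<times> snd p)" by force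
    qed
  qed (auto simp: \<C>_def)
  ultimately show ?thesis by simp
qed

lemma continuous_map_prod_borel:
  assumes "second_countable X" "second_countable Y" "continuous_map (prod_topology X Y) Z f"
  shows "f \<in> measurable (borel_top X \<Otimes>\<^sub>M borel_top Y) (borel_top Z)"
proof (rule measurable_sigma_sets)
  show "sets (borel_top Z) = sigma_sets (topspace Z) {U. openin Z U}" by (rule sets_borel_top)
  show "{U. openin Z U} \<subseteq> Pow (topspace Z)" by (auto dest: openin_subset)
  show "f \<in> space (borel_top X \<Otimes>\<^sub>M borel_top Y) \<rightarrow> topspace Z"
    using continuous_map_image_subset_topspace[OF assms(3)] by (auto simp: space_pair_measure)
  fix U assume U: "U \<in> {U. openin Z U}"
  have "openin (prod_topology X Y) {x \<in> topspace (prod_topology X Y). f x \<in> U}"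
    by (rule openin_continuous_map_preimage[OF assms(3)]) (use U in simp)
  moreover have "{x \<in> topspace (prod_topology X Y). f x \<in> U} = f -` U \<inter> space (borel_top X \<Otimes>\<^sub>M borel_top Y)"
    by (auto simp: space_pair_measure)
  ultimately show "f -` U \<inter> space (borel_top X \<Otimes>\<^sub>M borel_top Y) \<in> sets (borel_top X \<Otimes>\<^sub>M borel_top Y)"
    using openin_prod_sets[OF assms(1,2)] by metis
qed

context haar_groupoid
begin

section \<open>Invariance of the Haar system as an identity of measures\<close>

abbreviation R :: "'g \<Rightarrow> 'g topology" where "R u \<equiv> subtopology T (rfib T r u)"
abbreviation D :: "'g \<Rightarrow> 'g topology" where "D v \<equiv> subtopology T (dfib T d v)"
abbreviation Mv :: "'g \<Rightarrow> 'g measure" where "Mv v \<equiv> lam_d T d i lam v"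

lemma R_Hausdorff: "u \<in> G0 \<Longrightarrow> Hausdorff_space (R u)"
  using lc by (simp add: lc_groupoid_def)

lemma rfib_closed: assumes u: "u \<in> G0" shows "closedin T (rfib T r u)"
proof -
  have "continuous_map T (subtopology T G0) (\<lambda>x. u)"
    using u G0_G by (simp add: continuous_map_in_subtopology)
  from closedin_continuous_maps_eq[OF G0_Hausdorff r_continuous this]
  show ?thesis by (simp add: rfib_def)
qed

lemma continuous_map_lmult: "x \<in> G \<Longrightarrow> continuous_map (R (d x)) (R (r x)) (m x)"
  unfolding continuous_map_in_subtopology
  by (auto simp: rfib_G gsimps intro!: continuous_map_m continuous_map_subtopology_id)

lemma continuous_map_inverse_RD: "continuous_map (R v) (D v) i"
  unfolding continuous_map_in_subtopology
  by (auto simp: rfib_G dfib_G gsimps intro!: continuous_map_i continuous_map_subtopology_id)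

lemma continuous_map_inverse_DR: "continuous_map (D v) (R v) i"
  unfolding continuous_map_in_subtopology
  by (auto simp: rfib_G dfib_G gsimps intro!: continuous_map_i continuous_map_subtopology_id)

lemma measurable_lam_iff: "u \<in> G0 \<Longrightarrow> measurable (lam u) N = measurable (borel_top (R u)) N"
  by (rule measurable_cong_sets[OF sets_lam refl])

lemma measurable_lam_cong2: "u \<in> G0 \<Longrightarrow> measurable N (lam u) = measurable N (borel_top (R u))"
  by (rule measurable_cong_sets[OF refl sets_lam])

lemma i_measurable_lam: "v \<in> G0 \<Longrightarrow> i \<in> measurable (lam v) (borel_top (D v))"
  unfolding measurable_lam_iff by (rule continuous_map_borel_top[OF continuous_map_inverse_RD])

lemma sets_Mv [simp]: "sets (Mv v) = sets (borel_top (D v))"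
  by (simp add: lam_d_def)

lemma space_Mv [simp]: "space (Mv v) = dfib T d v"
  using sets_eq_imp_space_eq[OF sets_Mv[of v]] by (simp only: space_borel_top topspace_dfib)

lemma lam_open_inner: "u \<in> G0 \<Longrightarrow> openin (R u) W \<Longrightarrow>
    emeasure (lam u) W = (SUP K \<in> {K. compactin (R u) K \<and> K \<subseteq> W}. emeasure (lam u) K)"
  and lam_compact_finite: "u \<in> G0 \<Longrightarrow> compactin (R u) K \<Longrightarrow> emeasure (lam u) K < \<infinity>"
  using lam_regular[of u] unfolding regular_borel_on_def by auto

lemma compactin_R: assumes "u \<in> G0" "compactin T K" shows "compactin (R u) (rfib T r u \<inter> K)"
  using closed_Int_compactin[OF rfib_closed[OF assms(1)] assms(2)] by (simp add: compactin_subtopology)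

lemma compactin_R_sets: assumes "u \<in> G0" "compactin (R u) K" shows "K \<in> sets (lam u)"
  using compactin_imp_closedin[OF R_Hausdorff[OF assms(1)] assms(2)] sets_lam[OF assms(1)]
  by (simp add: closedin_borel_top)

lemma openin_R_sets: "u \<in> G0 \<Longrightarrow> openin (R u) W \<Longrightarrow> W \<in> sets (lam u)"
  by (simp add: sets_lam openin_borel_top)

text \<open>Invariance is only assumed for functions in \<open>Cc\<close>; inner regularity on open sets and bump
  functions extend it to open sets, and from there to all Borel sets.\<close>
lemma lam_invariant_open:
  assumes x: "x \<in> G" and K: "compactin T K" "Hausdorff_space (subtopology T K)"
    and W: "openin T W" "W \<subseteq> K"
  shows "emeasure (lam (r x)) (rfib T r (r x) \<inter> W) = emeasure (lam (d x)) {z \<in> rfib T r (d x). m x z \<in> W}"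
proof (rule antisym)
  let ?u = "r x" and ?v = "d x"
  have uv: "?u \<in> G0" "?v \<in> G0" using x by auto
  let ?V = "{z \<in> rfib T r ?v. m x z \<in> W}"
  have WR: "openin (R ?u) (rfib T r ?u \<inter> W)"
    using W(1) by (metis openin_subtopology_Int2)
  have V: "openin (R ?v) ?V"
  proof -
    have "openin (R ?v) {z \<in> topspace (R ?v). m x z \<in> rfib T r ?u \<inter> W}"
      by (rule openin_continuous_map_preimage[OF continuous_map_lmult[OF x] WR])
    moreover have "{z \<in> topspace (R ?v). m x z \<in> rfib T r ?u \<inter> W} = ?V"
      unfolding topspace_rfib using x by (auto simp: rfib_G gsimps)
    ultimately show ?thesis by simp
  qed
  note Vs = openin_R_sets[OF uv(2) V] and Ws = openin_R_sets[OF uv(1) WR]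
  show "emeasure (lam ?u) (rfib T r ?u \<inter> W) \<le> emeasure (lam ?v) ?V"
    unfolding lam_open_inner[OF uv(1) WR]
  proof (rule SUP_least)
    fix C assume "C \<in> {K. compactin (R ?u) K \<and> K \<subseteq> rfib T r ?u \<inter> W}"
    then have C: "compactin (R ?u) C" "compactin T C" "C \<subseteq> W" by (auto simp: compactin_subtopology)
    obtain E h where h: "cc_on T W E (\<lambda>x. complex_of_real (h x))" "\<And>x. 0 \<le> h x" "\<And>x. h x \<le> (1::real)"
      "\<And>x. x \<in> C \<Longrightarrow> h x = 1"
      using bump_function[OF K W C(2,3)] by blast
    have hC: "(\<lambda>x. complex_of_real (h x)) \<in> Cc T" using h(1) by (rule cc_on_Cc)
    have h0: "h x = 0" if "x \<notin> W" for x using h(1) that by (auto simp: cc_on_def)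
    have inth: "integrable (lam ?u) h"
      using lam_integrable[OF uv(1) hC] by (simp add: complex_of_real_integrable_eq)
    have "emeasure (lam ?u) C = (\<integral>\<^sup>+y. indicator C y \<partial>lam ?u)"
      using compactin_R_sets[OF uv(1) C(1)] by simp
    also have "\<dots> \<le> (\<integral>\<^sup>+y. ennreal (h y) \<partial>lam ?u)"
      using h by (intro nn_integral_mono) (auto split: split_indicator)
    also have "\<dots> = ennreal (\<integral>y. h y \<partial>lam ?u)"
      using inth h(2) by (intro nn_integral_eq_integral) auto
    also have "(\<integral>y. h y \<partial>lam ?u) = (\<integral>z. h (m x z) \<partial>lam ?v)"
      using lam_invariant[OF hC x] by simp
    \<comment> \<open>If the translated function is not integrable, its integral is 0 by convention,
      so the inequality holds in both cases.\<close>
    also have "ennreal (\<integral>z. h (m x z) \<partial>lam ?v) \<le> (\<integral>\<^sup>+z. ennreal (h (m x z)) \<partial>lam ?v)"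
    proof (cases "integrable (lam ?v) (\<lambda>z. h (m x z))")
      case True
      then show ?thesis using h(2) by (subst nn_integral_eq_integral) auto
    qed (simp add: not_integrable_integral_eq)
    also have "\<dots> \<le> (\<integral>\<^sup>+z. indicator ?V z \<partial>lam ?v)"
      using h h0 uv by (intro nn_integral_mono) (auto simp: space_lam split: split_indicator)
    also have "\<dots> = emeasure (lam ?v) ?V" using Vs by simp
    finally show "emeasure (lam ?u) C \<le> emeasure (lam ?v) ?V" .
  qed
  show "emeasure (lam ?v) ?V \<le> emeasure (lam ?u) (rfib T r ?u \<inter> W)"
    unfolding lam_open_inner[OF uv(2) V]
  proof (rule SUP_least)
    fix C assume "C \<in> {K. compactin (R ?v) K \<and> K \<subseteq> ?V}"
    then have C: "compactin (R ?v) C" "C \<subseteq> ?V" by auto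
    have "compactin (R ?u) (m x ` C)"
      using C(1) continuous_map_lmult[OF x] by (rule image_compactin)
    then have mC: "compactin T (m x ` C)" "m x ` C \<subseteq> W" using C(2) by (auto simp: compactin_subtopology)
    obtain E h where h: "cc_on T W E (\<lambda>x. complex_of_real (h x))" "\<And>x. 0 \<le> h x" "\<And>x. h x \<le> (1::real)"
      "\<And>y. y \<in> m x ` C \<Longrightarrow> h y = 1"
      using bump_function[OF K W mC] by blast
    have hC: "(\<lambda>x. complex_of_real (h x)) \<in> Cc T" using h(1) by (rule cc_on_Cc)
    have h0: "h x = 0" if "x \<notin> W" for x using h(1) that by (auto simp: cc_on_def)
    have hE: "h x = 0" if "x \<notin> E" for x using cc_onD(6)[OF h(1)] that by auto
    have inth: "integrable (lam ?u) h"
      using lam_integrable[OF uv(1) hC] by (simp add: complex_of_real_integrable_eq)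
    \<comment> \<open>In this direction the convention for non-integrable functions would spoil the
      estimate, so integrability has to be proved. The translated bump is bounded by 1 and lives on
      the translate of a compact set, which has finite measure.\<close>
    have intm: "integrable (lam ?v) (\<lambda>z. h (m x z))"
    proof -
      let ?Q = "m (i x) ` (rfib T r ?u \<inter> E)"
      have "continuous_map (R (r x)) (R (d x)) (m (i x))"
        using continuous_map_lmult[of "i x"] x by (simp add: gsimps)
      then have Q: "compactin (R ?v) ?Q"
        using compactin_R[OF uv(1) cc_onD(4)[OF h(1)]] image_compactin by blast
      have i1: "integrable (lam ?v) (indicator ?Q :: 'g \<Rightarrow> real)"
        using compactin_R_sets[OF uv(2) Q] lam_compact_finite[OF uv(2) Q]
        by (intro integrable_real_indicator) auto
      have i2: "(\<lambda>z. h (m x z)) \<in> borel_measurable (lam ?v)"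
      proof -
        have "(\<lambda>z. complex_of_real (h (m x z))) \<in> borel_measurable (lam ?v)"
          using continuous_map_lmult[OF x] Cc_measurable[OF hC]
          by (intro measurable_lam[OF uv(2), of "m x"]) (auto simp: continuous_map_in_subtopology)
        then have "(\<lambda>z. Re (complex_of_real (h (m x z)))) \<in> borel_measurable (lam ?v)"
          by (rule measurable_compose[OF _ borel_measurable_Re])
        then show ?thesis by simp
      qed
      have i3: "norm (h (m x z)) \<le> norm (indicator ?Q z :: real)" if z: "z \<in> space (lam ?v)" for z
      proof (cases "m x z \<in> E")
        case True
        have zG: "z \<in> G" "r z = ?v" using z uv by (auto simp: space_lam rfib_G)
        then have "z = m (i x) (m x z)" using x by (simp add: i_m_cancel)
        moreover have "m x z \<in> rfib T r ?u \<inter> E" using True zG x by (simp add: rfib_G gsimps)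
        ultimately have "z \<in> ?Q" by blast
        then show ?thesis using h(2,3) by simp
      qed (simp add: hE)
      show ?thesis
        by (rule Bochner_Integration.integrable_bound[OF i1 i2]) (rule AE_I2, rule i3)
    qed
    have "emeasure (lam ?v) C = (\<integral>\<^sup>+z. indicator C z \<partial>lam ?v)"
      using compactin_R_sets[OF uv(2) C(1)] by simp
    also have "\<dots> \<le> (\<integral>\<^sup>+z. ennreal (h (m x z)) \<partial>lam ?v)"
      using h by (intro nn_integral_mono) (auto split: split_indicator)
    also have "\<dots> = ennreal (\<integral>z. h (m x z) \<partial>lam ?v)"
      using intm h(2) by (intro nn_integral_eq_integral) auto
    also have "(\<integral>z. h (m x z) \<partial>lam ?v) = (\<integral>y. h y \<partial>lam ?u)"
      using lam_invariant[OF hC x] by simp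
    also have "ennreal (\<integral>y. h y \<partial>lam ?u) = (\<integral>\<^sup>+y. ennreal (h y) \<partial>lam ?u)"
      using inth h(2) by (intro nn_integral_eq_integral[symmetric]) auto
    also have "\<dots> \<le> (\<integral>\<^sup>+y. indicator (rfib T r ?u \<inter> W) y \<partial>lam ?u)"
      using h h0 uv by (intro nn_integral_mono) (auto simp: space_lam split: split_indicator)
    also have "\<dots> = emeasure (lam ?u) (rfib T r ?u \<inter> W)" using Ws by simp
    finally show "emeasure (lam ?v) C \<le> emeasure (lam ?u) (rfib T r ?u \<inter> W)" .
  qed
qed

text \<open>One countable family for several purposes: it shows sigma-finiteness, it generates the
  Borel sets of the fibre by sets for which invariance is already known, and it is the exhaustion by
  sets of finite measure in the uniqueness theorem for measures.\<close>

lemma lam_cover: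
  assumes u: "u \<in> G0"
  shows "\<exists>\<A>. countable \<A> \<and> \<Union>\<A> = rfib T r u \<and>
    (\<forall>A\<in>\<A>. \<exists>K W. compactin T K \<and> Hausdorff_space (subtopology T K) \<and> openin T W \<and> W \<subseteq> K
        \<and> A = rfib T r u \<inter> W) \<and>
    (\<forall>A\<in>\<A>. emeasure (lam u) A \<noteq> \<infinity>) \<and>
    (\<forall>U. openin (R u) U \<longrightarrow> U = \<Union>{A \<in> \<A>. A \<subseteq> U})"
proof -
  obtain \<K> where K: "countable \<K>" "\<And>K. K \<in> \<K> \<Longrightarrow> compactin T K \<and> Hausdorff_space (subtopology T K)"
    "\<And>U x. openin T U \<Longrightarrow> x \<in> U \<Longrightarrow> \<exists>K\<in>\<K>. x \<in> T interior_of K \<and> T interior_of K \<subseteq> U"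
    using lc unfolding lc_groupoid_def by meson
  define \<A> where "\<A> = (\<lambda>K. rfib T r u \<inter> T interior_of K) ` \<K>"
  show ?thesis
  proof (rule exI[of _ \<A>], intro conjI ballI allI impI)
    show "countable \<A>" using K(1) by (simp add: \<A>_def)
    show "\<Union>\<A> = rfib T r u"
    proof
      show "rfib T r u \<subseteq> \<Union>\<A>"
        using K(3)[OF openin_topspace] unfolding \<A>_def by (fastforce simp: rfib_G)
    qed (auto simp: \<A>_def)
    fix A assume "A \<in> \<A>"
    then obtain K where KA: "K \<in> \<K>" "A = rfib T r u \<inter> T interior_of K" by (auto simp: \<A>_def)
    then show "\<exists>K W. compactin T K \<and> Hausdorff_space (subtopology T K) \<and> openin T W \<and> W \<subseteq> K
        \<and> A = rfib T r u \<inter> W"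
      using K(2) interior_of_subset openin_interior_of by metis
    note cK = compactin_R[OF u, of K]
    have "emeasure (lam u) A \<le> emeasure (lam u) (rfib T r u \<inter> K)"
      using K(2)[OF KA(1)] interior_of_subset[of T K] unfolding KA(2)
      by (intro emeasure_mono compactin_R_sets[OF u cK]) auto
    also have "\<dots> < \<infinity>" using K(2)[OF KA(1)] cK lam_compact_finite[OF u] by blast
    finally show "emeasure (lam u) A \<noteq> \<infinity>" by simp
  next
    fix U assume U: "openin (R u) U"
    then obtain W where W: "openin T W" "U = W \<inter> rfib T r u" unfolding openin_subtopology by blast
    show "U = \<Union>{A \<in> \<A>. A \<subseteq> U}"
    proof
      show "U \<subseteq> \<Union>{A \<in> \<A>. A \<subseteq> U}"
      proof
        fix x assume x: "x \<in> U"
        then obtain K where "K \<in> \<K>" "x \<in> T interior_of K" "T interior_of K \<subseteq> W"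
          using K(3)[OF W(1), of x] W(2) by blast
        then have "rfib T r u \<inter> T interior_of K \<in> {A \<in> \<A>. A \<subseteq> U}" "x \<in> rfib T r u \<inter> T interior_of K"
          using W(2) x by (auto simp: \<A>_def)
        then show "x \<in> \<Union>{A \<in> \<A>. A \<subseteq> U}" by blast
      qed
    qed auto
  qed
qed

lemma lam_sigma_finite: assumes u: "u \<in> G0" shows "sigma_finite_measure (lam u)"
proof -
  obtain \<A> where A: "countable \<A>" "\<Union>\<A> = rfib T r u"
    "\<forall>A\<in>\<A>. \<exists>K W. compactin T K \<and> Hausdorff_space (subtopology T K) \<and> openin T W \<and> W \<subseteq> K
        \<and> A = rfib T r u \<inter> W"
    "\<forall>A\<in>\<A>. emeasure (lam u) A \<noteq> \<infinity>"
    "\<forall>U. openin (R u) U \<longrightarrow> U = \<Union>{A \<in> \<A>. A \<subseteq> U}"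
    using lam_cover[OF u] by (elim exE conjE) (rule that, assumption+)
  have "A \<in> sets (lam u)" if "A \<in> \<A>" for A
    using bspec[OF A(3) that] openin_R_sets[OF u openin_subtopology_Int2] by blast
  then show ?thesis
    using A(1,2,4) u by (intro sigma_finite_measure.intro exI[of _ \<A>]) (auto simp: space_lam)
qed

lemma measurable_lmult: "x \<in> G \<Longrightarrow> m x \<in> measurable (lam (d x)) (lam (r x))"
  by (simp add: measurable_lam_iff measurable_lam_cong2 continuous_map_borel_top continuous_map_lmult)

text \<open>Uniqueness of measures on a generator. The generator \<open>E\<close> consists of the
  traces of all open sets that lie in some compact Hausdorff set: unlike the countable family
  \<open>\<A>\<close> it is evidently closed under intersections, and it generates since every open
  set of the fibre is a countable union of members of \<open>\<A>\<close>.\<close>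

lemma lam_invariant_measure:
  assumes x: "x \<in> G" shows "distr (lam (d x)) (lam (r x)) (m x) = lam (r x)"
proof -
  let ?u = "r x" and ?v = "d x"
  have uv: "?u \<in> G0" "?v \<in> G0" using x by auto
  obtain \<A> where A: "countable \<A>" "\<Union>\<A> = rfib T r ?u"
    "\<forall>A\<in>\<A>. \<exists>K W. compactin T K \<and> Hausdorff_space (subtopology T K) \<and> openin T W \<and> W \<subseteq> K
        \<and> A = rfib T r ?u \<inter> W"
    "\<forall>A\<in>\<A>. emeasure (lam ?u) A \<noteq> \<infinity>"
    "\<forall>U. openin (R ?u) U \<longrightarrow> U = \<Union>{A \<in> \<A>. A \<subseteq> U}"
    using lam_cover[OF uv(1)] by (elim exE conjE) (rule that, assumption+)
  define E where "E = {rfib T r ?u \<inter> W |W. openin T W \<and>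
    (\<exists>K. compactin T K \<and> Hausdorff_space (subtopology T K) \<and> W \<subseteq> K)}"
  have EI: "rfib T r ?u \<inter> W \<in> E" if "openin T W" "compactin T K" "Hausdorff_space (subtopology T K)" "W \<subseteq> K"
    for W K
    unfolding E_def mem_Collect_eq using that by (intro exI[of _ W] conjI refl exI[of _ K])
  have AE: "\<A> \<subseteq> E"
  proof
    fix A assume "A \<in> \<A>"
    from bspec[OF A(3) this] show "A \<in> E" by (elim exE conjE) (simp add: EI)
  qed
  have Eopen: "openin (R ?u) X" if "X \<in> E" for X
    using that unfolding E_def mem_Collect_eq by (elim exE conjE) (simp add: openin_subtopology_Int2)
  have eq: "emeasure (distr (lam ?v) (lam ?u) (m x)) X = emeasure (lam ?u) X" if XE: "X \<in> E" for X
  proof -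
    obtain W K where W: "X = rfib T r ?u \<inter> W" "openin T W" "compactin T K"
      "Hausdorff_space (subtopology T K)" "W \<subseteq> K"
      using XE unfolding E_def mem_Collect_eq by (elim exE conjE) (rule that)
    have "emeasure (distr (lam ?v) (lam ?u) (m x)) X = emeasure (lam ?v) (m x -` X \<inter> space (lam ?v))"
      using Eopen[OF XE] uv by (intro emeasure_distr measurable_lmult[OF x] openin_R_sets)
    also have "m x -` X \<inter> space (lam ?v) = {z \<in> rfib T r ?v. m x z \<in> W}"
      using x uv by (auto simp: W(1) space_lam rfib_G gsimps)
    finally show ?thesis
      using lam_invariant_open[OF x W(3,4,2,5)] W(1) by simp
  qed
  have sets: "sets (lam ?u) = sigma_sets (rfib T r ?u) E"
  proof -
    have "sigma_sets (rfib T r ?u) {U. openin (R ?u) U} = sigma_sets (rfib T r ?u) E"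
    proof (rule sigma_sets_eqI)
      fix U assume "U \<in> {U. openin (R ?u) U}"
      then have "U = \<Union>{A \<in> \<A>. A \<subseteq> U}" using A(5) by blast
      moreover have "\<Union>{A \<in> \<A>. A \<subseteq> U} \<in> sigma_sets (rfib T r ?u) E"
        by (rule sigma_sets_UNION) (use A(1) AE in \<open>auto intro: countable_subset[OF _ A(1)] sigma_sets.Basic\<close>)
      ultimately show "U \<in> sigma_sets (rfib T r ?u) E" by simp
    qed (use Eopen in \<open>auto intro: sigma_sets.Basic\<close>)
    then show ?thesis by (simp only: sets_lam[OF uv(1)] sets_borel_top topspace_rfib)
  qed
  show ?thesis
  proof (rule measure_eqI_generator_eq_countable[of E "rfib T r ?u", where A = \<A>])
    show "Int_stable E"
      unfolding Int_stable_def
    proof (intro ballI)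
      fix X X' assume "X \<in> E" "X' \<in> E"
      then obtain W K W' where X: "X = rfib T r ?u \<inter> W" "X' = rfib T r ?u \<inter> W'"
        and *: "openin T W" "compactin T K" "Hausdorff_space (subtopology T K)" "W \<subseteq> K" "openin T W'"
        unfolding E_def mem_Collect_eq by (elim exE conjE) (rule that)
      have "rfib T r ?u \<inter> W \<inter> (rfib T r ?u \<inter> W') = rfib T r ?u \<inter> (W \<inter> W')" by blast
      moreover have "rfib T r ?u \<inter> (W \<inter> W') \<in> E" by (rule EI[OF _ *(2,3)]) (use * in auto)
      ultimately show "X \<inter> X' \<in> E" unfolding X by simp
    qed
    show "E \<subseteq> Pow (rfib T r ?u)" by (auto simp: E_def)
  qed (use eq sets A AE in auto)
qed

lemma nn_integral_lmult:
  assumes x: "x \<in> G" and f: "f \<in> borel_measurable (borel_top T)"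
  shows "(\<integral>\<^sup>+z. f (m x z) \<partial>lam (d x)) = (\<integral>\<^sup>+y. f y \<partial>lam (r x))"
proof -
  have "f \<in> borel_measurable (lam (r x))"
    using measurable_lam[OF _ continuous_map_subtopology_id f] x by simp
  then have "(\<integral>\<^sup>+y. f y \<partial>distr (lam (d x)) (lam (r x)) (m x)) = (\<integral>\<^sup>+z. f (m x z) \<partial>lam (d x))"
    by (intro nn_integral_distr measurable_lmult[OF x]) simp
  then show ?thesis by (simp add: lam_invariant_measure[OF x])
qed

lemma integral_lmult:
  fixes f :: "'g \<Rightarrow> complex"
  assumes x: "x \<in> G" and f: "f \<in> borel_measurable (lam (r x))"
  shows "(\<integral>z. f (m x z) \<partial>lam (d x)) = (\<integral>y. f y \<partial>lam (r x))"
  using integral_distr[OF measurable_lmult[OF x] f] by (simp add: lam_invariant_measure[OF x])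

lemma Mv_eq: "Mv v = distr (lam v) (borel_top (D v)) i"
  by (simp add: lam_d_def)

text \<open>A second inversion carries the measure back to \<open>lam v\<close>, and a measure with
  a sigma-finite image is sigma-finite.\<close>

lemma Mv_sigma_finite: assumes v: "v \<in> G0" shows "sigma_finite_measure (Mv v)"
proof (rule sigma_finite_measure_distr)
  have meas: "i \<in> measurable (borel_top (D v)) (lam v)"
    using continuous_map_borel_top[OF continuous_map_inverse_DR] v by (simp add: measurable_lam_cong2)
  then show im: "i \<in> measurable (Mv v) (lam v)"
    using measurable_cong_sets[OF sets_Mv refl] by blast
  have "distr (Mv v) (lam v) i = distr (lam v) (lam v) (i \<circ> i)"
    unfolding Mv_eq by (rule distr_distr[OF meas i_measurable_lam[OF v]])
  also have "\<dots> = distr (lam v) (lam v) (\<lambda>x. x)"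
    using v by (intro distr_cong) (auto simp: space_lam rfib_G)
  finally show "sigma_finite_measure (distr (Mv v) (lam v) i)"
    using lam_sigma_finite[OF v] by simp
qed

lemma nn_integral_Mv:
  assumes "v \<in> G0" "f \<in> borel_measurable (borel_top (D v))"
  shows "(\<integral>\<^sup>+t. f t \<partial>Mv v) = (\<integral>\<^sup>+z. f (i z) \<partial>lam v)"
  unfolding Mv_eq using assms by (intro nn_integral_distr i_measurable_lam) simp_all

lemma integral_Mv:
  fixes f :: "'g \<Rightarrow> complex"
  assumes "v \<in> G0" "f \<in> borel_measurable (borel_top (D v))"
  shows "(\<integral>t. f t \<partial>Mv v) = (\<integral>z. f (i z) \<partial>lam v)"
  unfolding Mv_eq using assms by (intro integral_distr i_measurable_lam)

section \<open>The regular representation by integral kernels\<close>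

abbreviation ker :: "('g \<Rightarrow> complex) \<Rightarrow> 'g \<Rightarrow> 'g \<Rightarrow> complex" where
  "ker f \<equiv> \<lambda>x t. f (m x (i t))"

lemma second_countable_D: "second_countable (D v)"
  by (rule second_countable_subtopology[OF second_countable_T])

lemma ker_continuous: "continuous_map (prod_topology (D v) (D v)) T (\<lambda>p. m (fst p) (i (snd p)))"
proof (intro continuous_map_m continuous_map_i)
  show "continuous_map (prod_topology (D v) (D v)) T fst" "continuous_map (prod_topology (D v) (D v)) T snd"
    using continuous_map_fst[of "D v" "D v"] continuous_map_snd[of "D v" "D v"]
    by (auto simp: continuous_map_in_subtopology)
qed (auto simp: dfib_G gsimps)

lemma ker_measurable:
  assumes "f \<in> borel_measurable (borel_top T)"
  shows "(\<lambda>(x, t). ker f x t) \<in> borel_measurable (Mv v \<Otimes>\<^sub>M Mv v)"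
proof -
  have "(\<lambda>p. m (fst p) (i (snd p))) \<in> measurable (borel_top (D v) \<Otimes>\<^sub>M borel_top (D v)) (borel_top T)"
    by (rule continuous_map_prod_borel[OF second_countable_D second_countable_D ker_continuous])
  then have "(\<lambda>p. m (fst p) (i (snd p))) \<in> measurable (Mv v \<Otimes>\<^sub>M Mv v) (borel_top T)"
    using measurable_cong_sets[OF sets_pair_measure_cong[OF sets_Mv sets_Mv] refl] by blast
  from measurable_compose[OF this assms] show ?thesis by (simp add: split_beta')
qed

lemma ker_section_measurable:
  assumes "f \<in> borel_measurable (borel_top T)" "x \<in> dfib T d v"
  shows "(\<lambda>t. f (m x (i t))) \<in> borel_measurable (borel_top (D v))"
    and "(\<lambda>t. f (m t (i x))) \<in> borel_measurable (borel_top (D v))"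
proof -
  have "continuous_map (D v) T (\<lambda>t. m x (i t))" "continuous_map (D v) T (\<lambda>t. m t (i x))"
    using assms(2) by (auto simp: dfib_G gsimps intro!: continuous_map_m continuous_map_i continuous_map_subtopology_id)
  then show "(\<lambda>t. f (m x (i t))) \<in> borel_measurable (borel_top (D v))"
    "(\<lambda>t. f (m t (i x))) \<in> borel_measurable (borel_top (D v))"
    using measurable_compose[OF continuous_map_borel_top assms(1)] by blast+
qed

text \<open>The substitution y = x t^{-1} turns a row integral over G_v into a Haar integral over
  G^{r(x)}, by invariance. For a column the variable is the inverse of x t^{-1}, whence the
  inversion in \<open>ker_col\<close>.\<close>

lemma ker_row:
  assumes v: "v \<in> G0" and x: "x \<in> dfib T d v" and f: "f \<in> borel_measurable (borel_top T)"
  shows "(\<integral>\<^sup>+t. f (m x (i t)) \<partial>Mv v) = (\<integral>\<^sup>+y. f y \<partial>lam (r x))"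
proof -
  have xG: "x \<in> G" "d x = v" using x by (auto simp: dfib_G)
  have "(\<integral>\<^sup>+t. f (m x (i t)) \<partial>Mv v) = (\<integral>\<^sup>+z. f (m x (i (i z))) \<partial>lam v)"
    by (rule nn_integral_Mv[OF v ker_section_measurable(1)[OF f x]])
  also have "\<dots> = (\<integral>\<^sup>+z. f (m x z) \<partial>lam v)"
    using v by (intro nn_integral_cong) (auto simp: space_lam rfib_G)
  also have "\<dots> = (\<integral>\<^sup>+y. f y \<partial>lam (r x))" using nn_integral_lmult[OF xG(1) f] xG(2) by simp
  finally show ?thesis .
qed

lemma ker_col:
  assumes v: "v \<in> G0" and t: "t \<in> dfib T d v" and f: "f \<in> borel_measurable (borel_top T)"
  shows "(\<integral>\<^sup>+x. f (m x (i t)) \<partial>Mv v) = (\<integral>\<^sup>+y. f (i y) \<partial>lam (r t))"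
proof -
  have tG: "t \<in> G" "d t = v" using t by (auto simp: dfib_G)
  have fi: "(\<lambda>x. f (i x)) \<in> borel_measurable (borel_top T)"
    using measurable_compose[OF continuous_map_borel_top[OF i_continuous] f] .
  have "(\<integral>\<^sup>+x. f (m x (i t)) \<partial>Mv v) = (\<integral>\<^sup>+z. f (m (i z) (i t)) \<partial>lam v)"
    by (rule nn_integral_Mv[OF v ker_section_measurable(2)[OF f t]])
  also have "\<dots> = (\<integral>\<^sup>+z. f (i (m t z)) \<partial>lam v)"
    using v tG by (intro nn_integral_cong) (auto simp: space_lam rfib_G i_mult)
  also have "\<dots> = (\<integral>\<^sup>+y. f (i y) \<partial>lam (r t))" using nn_integral_lmult[OF tG(1) fi] tG(2) by simp
  finally show ?thesis .
qed

text \<open>Rows are controlled by fibre integrals of |f| and columns by those of f composed with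
  the inversion, which is again in \<open>Cc\<close>. The constant must not depend on v, as the
  reduced norm is a supremum over all units.\<close>

lemma ker_schur:
  assumes f: "f \<in> Cc T" shows "\<exists>C. \<forall>v\<in>G0. schur_kernel (Mv v) C (ker f)"
proof -
  let ?g = "\<lambda>x. if x \<in> G then f (i x) else 0"
  have g: "?g \<in> Cc T" by (rule Cc_homeo[OF f i_continuous]) simp
  obtain B where B: "\<And>x. cmod (f x) \<le> B" using Cc_bounded[OF f] by blast
  have B0: "0 \<le> B" using B[of undefined] norm_ge_zero order_trans by blast
  obtain C where C: "0 \<le> C" "\<And>u. u \<in> G0 \<Longrightarrow> (\<integral>y. cmod (f y) \<partial>lam u) \<le> C"
    using Cc_lam_bound[OF f] by blast
  obtain C' where C': "0 \<le> C'" "\<And>u. u \<in> G0 \<Longrightarrow> (\<integral>y. cmod (?g y) \<partial>lam u) \<le> C'"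
    using Cc_lam_bound[OF g] by blast
  have nn: "(\<integral>\<^sup>+y. ennreal (cmod (h y)) \<partial>lam u) \<le> ennreal K"
    if "h \<in> Cc T" "u \<in> G0" "(\<integral>y. cmod (h y) \<partial>lam u) \<le> K" for h u K
    using that lam_integrable[OF that(2,1)] by (subst nn_integral_eq_integral) (auto intro: ennreal_leI)
  have fm: "f \<in> borel_measurable (borel_top T)" using f by (rule Cc_measurable)
  then have fm': "(\<lambda>x. ennreal (cmod (f x))) \<in> borel_measurable (borel_top T)" by measurable
  define K where "K = B + C + C'"
  have "schur_kernel (Mv v) K (ker f)" if v: "v \<in> G0" for v
    unfolding schur_kernel_def space_Mv
  proof (intro conjI ballI)
    show "0 \<le> K" using B0 C C' by (simp add: K_def)
    show "(\<lambda>(x, t). ker f x t) \<in> borel_measurable (Mv v \<Otimes>\<^sub>M Mv v)" by (rule ker_measurable[OF fm])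
    show "cmod (f (m x (i t))) \<le> K" for x t
      using B[of "m x (i t)"] C C' by (simp add: K_def)
    show "(\<integral>\<^sup>+t. ennreal (cmod (f (m x (i t)))) \<partial>Mv v) \<le> ennreal K" if x: "x \<in> dfib T d v" for x
    proof -
      have "r x \<in> G0" using x by (simp add: dfib_G)
      then show ?thesis
        unfolding ker_row[OF v x fm'] using nn[OF f] C(2)[of "r x"] B0 C'(1) by (simp add: K_def)
    qed
    show "(\<integral>\<^sup>+x. ennreal (cmod (f (m x (i t)))) \<partial>Mv v) \<le> ennreal K" if t: "t \<in> dfib T d v" for t
    proof -
      have u: "r t \<in> G0" using t by (simp add: dfib_G)
      have "(\<integral>\<^sup>+y. ennreal (cmod (f (i y))) \<partial>lam (r t)) = (\<integral>\<^sup>+y. ennreal (cmod (?g y)) \<partial>lam (r t))"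
        using u by (intro nn_integral_cong) (auto simp: space_lam rfib_G)
      also have "\<dots> \<le> ennreal K" using nn[OF g u] C'(2)[OF u] B0 C(1) by (simp add: K_def)
      finally show ?thesis unfolding ker_col[OF v t fm'] .
    qed
  qed
  then show ?thesis by blast
qed

abbreviation opr :: "('g \<Rightarrow> complex) \<Rightarrow> 'g \<Rightarrow> ('g \<Rightarrow> complex) \<Rightarrow> 'g \<Rightarrow> complex" where
  "opr f v \<equiv> kop (Mv v) (ker f)"

lemma ind_eq_opr: "x \<in> dfib T d v \<Longrightarrow> ind T d m i lam v f \<xi> x = opr f v \<xi> x"
  by (simp add: ind_def kop_def)

lemma opr_L2: "f \<in> Cc T \<Longrightarrow> v \<in> G0 \<Longrightarrow> \<xi> \<in> L2 (Mv v) \<Longrightarrow> opr f v \<xi> \<in> L2 (Mv v)"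
  using ker_schur sigma_finite_measure.kop_L2[OF Mv_sigma_finite] by blast

lemma opr_add: "f \<in> Cc T \<Longrightarrow> v \<in> G0 \<Longrightarrow> \<xi> \<in> L2 (Mv v) \<Longrightarrow> \<eta> \<in> L2 (Mv v) \<Longrightarrow>
    opr f v (\<lambda>x. \<xi> x + \<eta> x) = (\<lambda>x. opr f v \<xi> x + opr f v \<eta> x)"
  using ker_schur sigma_finite_measure.kop_add[OF Mv_sigma_finite] by blast

lemma opr_scale: "v \<in> G0 \<Longrightarrow> opr f v (\<lambda>x. c * \<xi> x) = (\<lambda>x. c * opr f v \<xi> x)"
  using sigma_finite_measure.kop_scale[OF Mv_sigma_finite] by blast

lemma opr_fun_add: "f \<in> Cc T \<Longrightarrow> g \<in> Cc T \<Longrightarrow> v \<in> G0 \<Longrightarrow> \<xi> \<in> L2 (Mv v) \<Longrightarrow>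
    opr (\<lambda>x. f x + g x) v \<xi> = (\<lambda>x. opr f v \<xi> x + opr g v \<xi> x)"
  using ker_schur[of f] ker_schur[of g] sigma_finite_measure.kop_kernel_add[OF Mv_sigma_finite] by blast

lemma opr_fun_scale: "v \<in> G0 \<Longrightarrow> opr (\<lambda>x. c * f x) v \<xi> = (\<lambda>x. c * opr f v \<xi> x)"
  using sigma_finite_measure.kop_kernel_scale[OF Mv_sigma_finite, of v c "ker f"] by blast

text \<open>Convolution becomes composition of kernels: substitute y = x z in the Haar integral,
  using invariance, and then s = z^{-1}.\<close>

lemma ker_conv:
  assumes f: "f \<in> Cc T" and g: "g \<in> Cc T" and v: "v \<in> G0"
    and x: "x \<in> dfib T d v" and t: "t \<in> dfib T d v"
  shows "ker (f \<star> g) x t = (\<integral>s. ker f x s * ker g s t \<partial>Mv v)"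
proof -
  have xt: "x \<in> G" "d x = v" "t \<in> G" "d t = v" using x t by (auto simp: dfib_G)
  then have p: "m x (i t) \<in> G" "r (m x (i t)) = r x" by (auto simp: gsimps)
  have "(f \<star> g) (m x (i t)) = (\<integral>y. f y * g (m (i y) (m x (i t))) \<partial>lam (r x))"
    using p by (simp add: conv_def)
  also have "\<dots> = (\<integral>z. f (m x z) * g (m (i (m x z)) (m x (i t))) \<partial>lam (d x))"
    using conv_integrable[OF f g p(1)] p(2) by (intro integral_lmult[symmetric] xt(1)) auto
  also have "\<dots> = (\<integral>z. f (m x (i (i z))) * g (m (i z) (i t)) \<partial>lam v)"
    unfolding xt(2)
  proof (rule Bochner_Integration.integral_cong[OF refl])
    fix z assume "z \<in> space (lam v)"
    then have z: "z \<in> G" "r z = v" using v by (auto simp: space_lam rfib_G)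
    have "m (i (m x z)) (m x (i t)) = m (m (i z) (i x)) (m x (i t))"
      using xt z by (simp add: i_mult)
    also have "\<dots> = m (i z) (i t)"
      using xt z by (simp add: m_assoc gsimps i_m_cancel)
    finally show "f (m x z) * g (m (i (m x z)) (m x (i t))) = f (m x (i (i z))) * g (m (i z) (i t))"
      using z by simp
  qed
  also have "\<dots> = (\<integral>s. f (m x (i s)) * g (m s (i t)) \<partial>Mv v)"
    using ker_section_measurable(1)[OF Cc_measurable[OF f] x] ker_section_measurable(2)[OF Cc_measurable[OF g] t]
    by (intro integral_Mv[symmetric] v borel_measurable_times)
  finally show ?thesis .
qed

lemma opr_conv: "f \<in> Cc T \<Longrightarrow> g \<in> Cc T \<Longrightarrow> v \<in> G0 \<Longrightarrow> \<xi> \<in> L2 (Mv v) \<Longrightarrow>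
    opr (f \<star> g) v \<xi> = opr f v (opr g v \<xi>)"
proof -
  assume a: "f \<in> Cc T" "g \<in> Cc T" "v \<in> G0" "\<xi> \<in> L2 (Mv v)"
  obtain C C' where "schur_kernel (Mv v) C (ker f)" "schur_kernel (Mv v) C' (ker g)"
    using ker_schur[OF a(1)] ker_schur[OF a(2)] a(3) by blast
  from sigma_finite_measure.kop_comp[OF Mv_sigma_finite[OF a(3)] this a(4), of "ker (f \<star> g)"]
  show ?thesis using ker_conv[OF a(1-3)] by simp
qed

lemma opr_adjoint:
  assumes f: "f \<in> Cc T" and v: "v \<in> G0" and \<xi>: "\<xi> \<in> L2 (Mv v)" and \<eta>: "\<eta> \<in> L2 (Mv v)"
  shows "ip2 (Mv v) \<eta> (opr f v \<xi>) = ip2 (Mv v) (opr (invol T i f) v \<eta>) \<xi>"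
proof -
  obtain C where C: "schur_kernel (Mv v) C (ker f)" using ker_schur[OF f] v by blast
  have "ker (invol T i f) x t = cnj (ker f t x)" if "x \<in> dfib T d v" "t \<in> dfib T d v" for x t
    using that by (auto simp: dfib_G invol_def gsimps i_mult)
  then have "kop (Mv v) (\<lambda>x t. cnj (ker f t x)) \<eta> = opr (invol T i f) v \<eta>"
    by (auto simp: kop_def fun_eq_iff intro!: Bochner_Integration.integral_cong)
  then show ?thesis
    using sigma_finite_measure.kop_adjoint[OF Mv_sigma_finite[OF v] C \<xi> \<eta>] by simp
qed

lemma invol_conv:
  assumes f: "f \<in> Cc T" and g: "g \<in> Cc T"
  shows "invol T i (f \<star> g) = invol T i g \<star> invol T i f"
proof
  fix x show "invol T i (f \<star> g) x = (invol T i g \<star> invol T i f) x"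
  proof (cases "x \<in> G")
    case x: True
    have "(invol T i g \<star> invol T i f) x = (\<integral>y. invol T i g y * invol T i f (m (i y) x) \<partial>lam (r x))"
      using x by (simp add: conv_def)
    also have "\<dots> = (\<integral>z. invol T i g (m x z) * invol T i f (m (i (m x z)) x) \<partial>lam (d x))"
      using conv_integrable[OF invol_Cc[OF g] invol_Cc[OF f] x] by (intro integral_lmult[symmetric] x) auto
    also have "\<dots> = (\<integral>z. cnj (f z * g (m (i z) (i x))) \<partial>lam (d x))"
    proof (rule Bochner_Integration.integral_cong[OF refl])
      fix z assume "z \<in> space (lam (d x))"
      then have z: "z \<in> G" "r z = d x" using x by (auto simp: space_lam rfib_G)
      have "m (i (m x z)) x = i z"
        using x z by (simp add: i_mult m_assoc gsimps i_m) (metis d_i i_closed m_d)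
      then show "invol T i g (m x z) * invol T i f (m (i (m x z)) x) = cnj (f z * g (m (i z) (i x)))"
        using x z by (simp add: invol_def gsimps i_mult mult.commute)
    qed
    also have "\<dots> = cnj (\<integral>z. f z * g (m (i z) (i x)) \<partial>lam (d x))" by (rule Bochner_Integration.integral_cnj)
    also have "\<dots> = invol T i (f \<star> g) x" using x by (simp add: invol_def conv_def gsimps)
    finally show ?thesis by simp
  qed (simp add: invol_def conv_def)
qed

end

section \<open>The reduced norm\<close>

text \<open>The measures of the subgroupoid are defined on the Borel sets of its own fibres, whereas
  a restricted measure carries the trace of the larger sigma-algebra. The two have to be identified
  before the measures can be compared.\<close>

lemma sets_borel_top_subtopology:
  assumes "S \<inter> topspace X \<in> sets (borel_top X)"
  shows "sets (borel_top (subtopology X S)) = sets (restrict_space (borel_top X) S)"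
proof -
  let ?S = "S \<inter> topspace X"
  have "sets (restrict_space (borel_top X) S) = (\<inter>) ?S ` sigma_sets (topspace X) {U. openin X U}"
  proof -
    have "S \<inter> A = ?S \<inter> A" if "A \<in> sets (borel_top X)" for A
      using sets.sets_into_space[OF that] by auto
    then show ?thesis
      unfolding sets_restrict_space sets_borel_top[symmetric] by (intro image_cong refl)
  qed
  also have "\<dots> = sigma_sets ?S ((\<inter>) ?S ` {U. openin X U})"
    using assms by (intro sigma_sets_Int) (auto simp: sets_borel_top)
  also have "(\<inter>) ?S ` {U. openin X U} = {U. openin (subtopology X S) U}"
  proof -
    have "?S \<inter> U = U \<inter> S" if "openin X U" for U using openin_subset[OF that] by auto
    then have "(\<inter>) ?S ` {U. openin X U} = (\<lambda>U. U \<inter> S) ` {U. openin X U}"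
      by (intro image_cong refl) simp
    then show ?thesis unfolding openin_subtopology by blast
  qed
  also have "sigma_sets ?S {U. openin (subtopology X S) U} = sets (borel_top (subtopology X S))"
    unfolding sets_borel_top by (simp add: Int_commute)
  finally show ?thesis by simp
qed

text \<open>To be used with h the pointwise difference of the two sides of an inequality between
  integrals, which can then be verified on each block separately. Dominated convergence passes from
  finitely many blocks to all.\<close>

lemma integral_nonneg_blocks:
  fixes h :: "'a \<Rightarrow> real" and E :: "nat \<Rightarrow> 'a set"
  assumes h: "integrable M h" and E: "\<And>n. E n \<in> sets M" "\<And>j k. j \<noteq> k \<Longrightarrow> E j \<inter> E k = {}"
    and nn: "\<And>n. 0 \<le> (\<integral>x. indicator (E n) x * h x \<partial>M)"
    and off: "\<And>x. x \<in> space M \<Longrightarrow> x \<notin> (\<Union>n. E n) \<Longrightarrow> 0 \<le> h x"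
  shows "0 \<le> (\<integral>x. h x \<partial>M)"
proof -
  have U: "(\<Union>n. E n) \<in> sets M" using E(1) by blast
  have iU: "integrable M (\<lambda>x. indicator (\<Union>n. E n) x * h x)"
    using integrable_mult_indicator[OF U h] by simp
  have iC: "integrable M (\<lambda>x. indicator (space M - (\<Union>n. E n)) x * h x)"
    using integrable_mult_indicator[OF sets.compl_sets[OF U] h] by simp
  have "(\<integral>x. h x \<partial>M) = (\<integral>x. indicator (\<Union>n. E n) x * h x + indicator (space M - (\<Union>n. E n)) x * h x \<partial>M)"
    by (intro Bochner_Integration.integral_cong) (auto split: split_indicator)
  also have "\<dots> = (\<integral>x. indicator (\<Union>n. E n) x * h x \<partial>M) + (\<integral>x. indicator (space M - (\<Union>n. E n)) x * h x \<partial>M)"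
    by (rule Bochner_Integration.integral_add[OF iU iC])
  also have "0 \<le> \<dots>"
  proof (rule add_nonneg_nonneg)
    let ?s = "\<lambda>n x. indicator (\<Union>k<n. E k) x * h x"
    have Un: "(\<Union>k<n. E k) \<in> sets M" for n using E(1) by blast
    have "(\<lambda>n. \<integral>x. ?s n x \<partial>M) \<longlonglongrightarrow> (\<integral>x. indicator (\<Union>n. E n) x * h x \<partial>M)"
    proof (rule integral_dominated_convergence[where w = "\<lambda>x. norm (h x)"])
      show "(\<lambda>x. indicator (\<Union>n. E n) x * h x) \<in> borel_measurable M" using iU by simp
      show "(\<lambda>x. ?s n x) \<in> borel_measurable M" for n
        using integrable_mult_indicator[OF Un h] by (simp add: borel_measurable_integrable)
      show "integrable M (\<lambda>x. norm (h x))" using h by (rule integrable_norm)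
      show "AE x in M. norm (?s n x) \<le> norm (h x)" for n by (auto split: split_indicator)
      have "(\<lambda>n. ?s n x) \<longlonglongrightarrow> indicator (\<Union>n. E n) x * h x" for x
      proof (cases "x \<in> (\<Union>n. E n)")
        case True
        then obtain k where k: "x \<in> E k" by blast
        have "?s n x = indicator (\<Union>n. E n) x * h x" if "k < n" for n
          using k that by (auto split: split_indicator)
        then show ?thesis by (intro tendsto_eventually eventually_sequentiallyI[of "Suc k"]) auto
      qed auto
      then show "AE x in M. (\<lambda>n. ?s n x) \<longlonglongrightarrow> indicator (\<Union>n. E n) x * h x" by simp
    qed
    moreover have "0 \<le> (\<integral>x. ?s n x \<partial>M)" for n
    proof -
      have eq: "?s n x = (\<Sum>k<n. indicator (E k) x * h x)" for x
      proof -
        have "disjoint_family_on E {..<n}" using E(2) by (auto simp: disjoint_family_on_def)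
        then have "indicator (\<Union>k<n. E k) x = (\<Sum>k<n. indicator (E k) x :: real)"
          using indicator_UN_disjoint[of "{..<n}" E x] by simp
        then show ?thesis by (simp add: sum_distrib_right)
      qed
      have "(\<integral>x. (\<Sum>k<n. indicator (E k) x * h x) \<partial>M) = (\<Sum>k<n. \<integral>x. indicator (E k) x * h x \<partial>M)"
        using integrable_mult_indicator[OF E(1) h] by (intro Bochner_Integration.integral_sum) simp
      then show ?thesis unfolding eq using nn by (simp add: sum_nonneg)
    qed
    ultimately show "0 \<le> (\<integral>x. indicator (\<Union>n. E n) x * h x \<partial>M)"
      by (intro LIMSEQ_le_const) auto
    show "0 \<le> (\<integral>x. indicator (space M - (\<Union>n. E n)) x * h x \<partial>M)"
      using off by (intro Bochner_Integration.integral_nonneg) (auto split: split_indicator)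
  qed
  finally show ?thesis .
qed

context haar_groupoid
begin

section \<open>Estimates for the reduced norm\<close>

abbreviation rn :: "('g \<Rightarrow> complex) \<Rightarrow> real" where "rn \<equiv> rnorm T G0 d m i lam"

lemma rn_nonneg: "0 \<le> rn f"
  by (simp add: rnorm_def)

lemma opr_bounded:
  assumes f: "f \<in> Cc T"
  shows "\<exists>C\<ge>0. \<forall>v\<in>G0. \<forall>\<xi>\<in>L2 (Mv v). n2 (Mv v) (opr f v \<xi>) \<le> C * n2 (Mv v) \<xi>"
proof -
  obtain C where C: "\<And>v. v \<in> G0 \<Longrightarrow> schur_kernel (Mv v) C (ker f)" using ker_schur[OF f] by blast
  have "n2 (Mv v) (opr f v \<xi>) \<le> \<bar>C\<bar> * n2 (Mv v) \<xi>" if v: "v \<in> G0" and \<xi>: "\<xi> \<in> L2 (Mv v)" for v \<xi>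
  proof -
    have "ennreal ((n2 (Mv v) (opr f v \<xi>))\<^sup>2) \<le> ennreal (C\<^sup>2) * ennreal ((n2 (Mv v) \<xi>)\<^sup>2)"
      using sigma_finite_measure.kop_l2sq[OF Mv_sigma_finite[OF v] C[OF v] \<xi>]
      by (simp add: l2sq_n2 \<xi> opr_L2[OF f v \<xi>])
    then have "(n2 (Mv v) (opr f v \<xi>))\<^sup>2 \<le> (\<bar>C\<bar> * n2 (Mv v) \<xi>)\<^sup>2"
      by (simp add: power_mult_distrib flip: ennreal_mult)
    then show ?thesis by (rule power2_le_imp_le) (simp add: n2_nonneg)
  qed
  then show ?thesis by (intro exI[of _ "\<bar>C\<bar>"]) auto
qed

lemma l2sq_ind: "l2sq (Mv v) (ind T d m i lam v f \<xi>) = l2sq (Mv v) (opr f v \<xi>)"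
  unfolding l2sq_def by (rule nn_integral_cong) (simp add: ind_eq_opr)

lemma unit_ball_L2:
  assumes "\<xi> \<in> borel_measurable (Mv v)" "l2sq (Mv v) \<xi> \<le> 1"
  shows "\<xi> \<in> L2 (Mv v)" "n2 (Mv v) \<xi> \<le> 1"
proof -
  show L: "\<xi> \<in> L2 (Mv v)"
    using assms by (simp add: L2_iff_l2sq) (metis ennreal_one_less_top order_le_less_trans)
  have "(n2 (Mv v) \<xi>)\<^sup>2 \<le> 1" using assms(2) by (simp add: l2sq_n2[OF L])
  then show "n2 (Mv v) \<xi> \<le> 1"
    using power2_le_imp_le[of "n2 (Mv v) \<xi>" 1] by simp
qed

lemma rnorm_sup_le:
  assumes f: "f \<in> Cc T" and c: "0 \<le> c"
    and b: "\<And>v \<xi>. v \<in> G0 \<Longrightarrow> \<xi> \<in> L2 (Mv v) \<Longrightarrow> n2 (Mv v) (opr f v \<xi>) \<le> c * n2 (Mv v) \<xi>"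
  shows "(SUP v \<in> G0. ind_opnorm_sq T d m i lam v f) \<le> ennreal (c\<^sup>2)"
proof (rule SUP_least)
  fix v assume v: "v \<in> G0"
  show "ind_opnorm_sq T d m i lam v f \<le> ennreal (c\<^sup>2)"
    unfolding ind_opnorm_sq_def
  proof (rule SUP_least, clarify)
    fix \<xi> assume "\<xi> \<in> borel_measurable (Mv v)" "l2sq (Mv v) \<xi> \<le> 1"
    from unit_ball_L2[OF this] have \<xi>: "\<xi> \<in> L2 (Mv v)" "n2 (Mv v) \<xi> \<le> 1" .
    have "n2 (Mv v) (opr f v \<xi>) \<le> c"
      using b[OF v \<xi>(1)] mult_left_mono[OF \<xi>(2) c] by simp
    then have "(n2 (Mv v) (opr f v \<xi>))\<^sup>2 \<le> c\<^sup>2" by (intro power_mono n2_nonneg)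
    then show "l2sq (Mv v) (ind T d m i lam v f \<xi>) \<le> ennreal (c\<^sup>2)"
      unfolding l2sq_ind by (simp add: l2sq_n2[OF opr_L2[OF f v \<xi>(1)]])
  qed
qed

lemma rn_le:
  assumes f: "f \<in> Cc T" and c: "0 \<le> c"
    and b: "\<And>v \<xi>. v \<in> G0 \<Longrightarrow> \<xi> \<in> L2 (Mv v) \<Longrightarrow> n2 (Mv v) (opr f v \<xi>) \<le> c * n2 (Mv v) \<xi>"
  shows "rn f \<le> c"
proof -
  have "enn2real (SUP v \<in> G0. ind_opnorm_sq T d m i lam v f) \<le> enn2real (ennreal (c\<^sup>2))"
    by (rule enn2real_mono[OF rnorm_sup_le[OF assms] ennreal_less_top])
  then show ?thesis unfolding rnorm_def using c real_le_lsqrt[of c] by (simp add: real_le_lsqrt)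
qed

text \<open>\<open>enn2real\<close> sends infinity to 0, so \<open>rnorm\<close> is meaningful only
  where the supremum is finite. On \<open>Cc\<close> this is ensured by Schur's test with its
  uniform constant.\<close>

lemma rn_sup: "f \<in> Cc T \<Longrightarrow> (SUP v \<in> G0. ind_opnorm_sq T d m i lam v f) = ennreal ((rn f)\<^sup>2)"
proof -
  assume f: "f \<in> Cc T"
  obtain C where C: "C \<ge> 0"
    "\<And>v \<xi>. v \<in> G0 \<Longrightarrow> \<xi> \<in> L2 (Mv v) \<Longrightarrow> n2 (Mv v) (opr f v \<xi>) \<le> C * n2 (Mv v) \<xi>"
    using opr_bounded[OF f] by blast
  have "(SUP v \<in> G0. ind_opnorm_sq T d m i lam v f) < top"
    by (rule order_le_less_trans[OF rnorm_sup_le[OF f C] ennreal_less_top])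
  then show ?thesis by (simp add: rnorm_def)
qed

lemma rn_bound:
  assumes f: "f \<in> Cc T" and v: "v \<in> G0" and \<xi>: "\<xi> \<in> L2 (Mv v)"
  shows "n2 (Mv v) (opr f v \<xi>) \<le> rn f * n2 (Mv v) \<xi>"
proof (cases "n2 (Mv v) \<xi> = 0")
  \<comment> \<open>A vector of seminorm 0 cannot be normalised. The bound from Schur's test shows
    that its image has seminorm 0 as well.\<close>
  case True
  then show ?thesis using opr_bounded[OF f] v \<xi> by fastforce
next
  case False
  let ?n = "n2 (Mv v) \<xi>" and ?c = "complex_of_real (1 / n2 (Mv v) \<xi>)"
  have pos: "0 < ?n" using False n2_nonneg[of "Mv v" \<xi>] by simp
  let ?\<eta> = "\<lambda>x. ?c * \<xi> x"
  have \<eta>: "?\<eta> \<in> L2 (Mv v)" using \<xi> by (rule L2_scale)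
  have n1: "n2 (Mv v) ?\<eta> = 1" unfolding n2_scale using pos by (simp add: norm_divide)
  have "l2sq (Mv v) ?\<eta> \<le> 1" unfolding l2sq_n2[OF \<eta>] n1 by simp
  then have "l2sq (Mv v) (ind T d m i lam v f ?\<eta>) \<le> ind_opnorm_sq T d m i lam v f"
    unfolding ind_opnorm_sq_def using L2_measurable[OF \<eta>] by (intro SUP_upper) simp
  also have "\<dots> \<le> ennreal ((rn f)\<^sup>2)"
    unfolding rn_sup[OF f, symmetric] by (rule SUP_upper[OF v])
  finally have "(n2 (Mv v) (opr f v ?\<eta>))\<^sup>2 \<le> (rn f)\<^sup>2"
    unfolding l2sq_ind l2sq_n2[OF opr_L2[OF f v \<eta>]] by (simp add: ennreal_le_iff)
  then have "n2 (Mv v) (opr f v ?\<eta>) \<le> rn f" by (rule power2_le_imp_le) (rule rn_nonneg)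
  then show ?thesis unfolding opr_scale[OF v] n2_scale using pos by (simp add: field_simps norm_divide)
qed

lemma rn_add: assumes "f \<in> Cc T" "g \<in> Cc T" shows "rn (\<lambda>x. f x + g x) \<le> rn f + rn g"
proof (rule rn_le)
  fix v \<xi> assume v: "v \<in> G0" and \<xi>: "\<xi> \<in> L2 (Mv v)"
  have "n2 (Mv v) (opr (\<lambda>x. f x + g x) v \<xi>) \<le> n2 (Mv v) (opr f v \<xi>) + n2 (Mv v) (opr g v \<xi>)"
    unfolding opr_fun_add[OF assms v \<xi>] by (intro n2_add opr_L2 assms v \<xi>)
  also have "\<dots> \<le> rn f * n2 (Mv v) \<xi> + rn g * n2 (Mv v) \<xi>"
    by (intro add_mono rn_bound assms v \<xi>)
  finally show "n2 (Mv v) (opr (\<lambda>x. f x + g x) v \<xi>) \<le> (rn f + rn g) * n2 (Mv v) \<xi>"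
    by (simp add: distrib_right)
qed (auto simp: rn_nonneg Cc_add assms)

lemma rn_scale_le: assumes "f \<in> Cc T" shows "rn (\<lambda>x. c * f x) \<le> cmod c * rn f"
proof (rule rn_le)
  fix v \<xi> assume v: "v \<in> G0" and \<xi>: "\<xi> \<in> L2 (Mv v)"
  have "n2 (Mv v) (opr (\<lambda>x. c * f x) v \<xi>) = cmod c * n2 (Mv v) (opr f v \<xi>)"
    unfolding opr_fun_scale[OF v] by (rule n2_scale)
  then show "n2 (Mv v) (opr (\<lambda>x. c * f x) v \<xi>) \<le> cmod c * rn f * n2 (Mv v) \<xi>"
    using mult_left_mono[OF rn_bound[OF assms v \<xi>], of "cmod c"] by (simp add: mult.assoc)
qed (auto simp: rn_nonneg Cc_scale assms)

lemma rn_zero: "rn (\<lambda>x. 0) = 0"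
  using rn_scale_le[OF Cc_zero[of T], of 0] rn_nonneg[of "\<lambda>x. 0"] by simp

lemma rn_diff_sym: assumes "f \<in> Cc T" "g \<in> Cc T" shows "rn (\<lambda>x. f x - g x) = rn (\<lambda>x. g x - f x)"
  using rn_scale_le[OF Cc_diff[OF assms], of "-1"] rn_scale_le[OF Cc_diff[OF assms(2,1)], of "-1"]
  by simp

lemma rn_triangle: assumes "f \<in> Cc T" "g \<in> Cc T" "h \<in> Cc T"
  shows "rn (\<lambda>x. f x - h x) \<le> rn (\<lambda>x. f x - g x) + rn (\<lambda>x. g x - h x)"
  using rn_add[OF Cc_diff[OF assms(1,2)] Cc_diff[OF assms(2,3)]] by simp

lemma rn_le_add_diff: assumes "f \<in> Cc T" "g \<in> Cc T" shows "rn f \<le> rn g + rn (\<lambda>x. f x - g x)"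
  using rn_add[OF assms(2) Cc_diff[OF assms]] by simp

lemma rn_abs_diff: assumes "f \<in> Cc T" "g \<in> Cc T" shows "\<bar>rn f - rn g\<bar> \<le> rn (\<lambda>x. f x - g x)"
  using rn_le_add_diff[OF assms] rn_le_add_diff[OF assms(2,1)] rn_diff_sym[OF assms] by linarith

lemma rn_conv: assumes "f \<in> Cc T" "g \<in> Cc T" shows "rn (f \<star> g) \<le> rn f * rn g"
proof (rule rn_le)
  fix v \<xi> assume v: "v \<in> G0" and \<xi>: "\<xi> \<in> L2 (Mv v)"
  have "n2 (Mv v) (opr (f \<star> g) v \<xi>) \<le> rn f * n2 (Mv v) (opr g v \<xi>)"
    unfolding opr_conv[OF assms v \<xi>] by (intro rn_bound assms v opr_L2 \<xi>)
  also have "\<dots> \<le> rn f * (rn g * n2 (Mv v) \<xi>)"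
    by (intro mult_left_mono rn_bound assms v \<xi> rn_nonneg)
  finally show "n2 (Mv v) (opr (f \<star> g) v \<xi>) \<le> rn f * rn g * n2 (Mv v) \<xi>" by (simp add: mult.assoc)
qed (auto simp: rn_nonneg conv_Cc assms)

text \<open>For s the image of xi under the adjoint, |s|^2 = <xi, f s> <= |xi| |f| |s|; then divide
  by |s|.\<close>

lemma rn_invol: assumes f: "f \<in> Cc T" shows "rn (invol T i f) \<le> rn f"
proof (rule rn_le)
  fix v \<xi> assume v: "v \<in> G0" and \<xi>: "\<xi> \<in> L2 (Mv v)"
  let ?s = "opr (invol T i f) v \<xi>" and ?n = "n2 (Mv v)"
  have s: "?s \<in> L2 (Mv v)" by (rule opr_L2[OF invol_Cc[OF f] v \<xi>])
  have "(?n ?s)\<^sup>2 = cmod (ip2 (Mv v) ?s ?s)"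
    unfolding ip2_self[OF s] by (simp only: norm_of_real abs_power2)
  also have "\<dots> = cmod (ip2 (Mv v) \<xi> (opr f v ?s))"
    by (simp add: opr_adjoint[OF f v s \<xi>])
  also have "\<dots> \<le> ?n \<xi> * ?n (opr f v ?s)" by (rule ip2_le[OF \<xi> opr_L2[OF f v s]])
  also have "\<dots> \<le> ?n \<xi> * (rn f * ?n ?s)" by (intro mult_left_mono rn_bound f v s n2_nonneg)
  finally have *: "?n ?s * ?n ?s \<le> (rn f * ?n \<xi>) * ?n ?s" by (simp add: power2_eq_square mult_ac)
  show "?n ?s \<le> rn f * ?n \<xi>"
  proof (cases "?n ?s = 0")
    case True
    then show ?thesis by (simp add: rn_nonneg n2_nonneg)
  next
    case False
    then show ?thesis using * n2_nonneg[of "Mv v" ?s] mult_right_le_imp_le by fastforce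
  qed
qed (auto simp: rn_nonneg invol_Cc f)

end

section \<open>Restriction to a clopen subgroupoid\<close>

locale clopen_subgroupoid = haar_groupoid T G0 r d i m lam
  for T :: "'g topology" and G0 and r and d and i and m and lam +
  fixes H :: "'g set"
  assumes sub: "subgroupoid (topspace T) r d m i H"
    and H_open: "openin T H" and H_closed: "closedin T H"
begin

lemma H_G: "x \<in> H \<Longrightarrow> x \<in> G" and r_H: "x \<in> H \<Longrightarrow> r x \<in> H" and d_H: "x \<in> H \<Longrightarrow> d x \<in> H"
  and i_H: "x \<in> H \<Longrightarrow> i x \<in> H" and m_H: "x \<in> H \<Longrightarrow> y \<in> H \<Longrightarrow> d x = r y \<Longrightarrow> m x y \<in> H"
  using sub by (auto simp: subgroupoid_def)

definition eH :: "('g \<Rightarrow> complex) \<Rightarrow> 'g \<Rightarrow> complex" where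
  "eH f = (\<lambda>x. if x \<in> H then f x else 0)"

lemma eH_sub: "f \<in> Cc T \<Longrightarrow> eH f \<in> Cc (subtopology T H)"
  unfolding eH_def by (rule Cc_restrict_subspace[OF _ H_open H_closed])

lemma eH_Cc: "f \<in> Cc T \<Longrightarrow> eH f \<in> Cc T"
  by (rule Cc_open_subspace[OF eH_sub H_open])

lemma eH_id: "f \<in> Cc (subtopology T H) \<Longrightarrow> eH f = f"
  using Cc_outside[of f "subtopology T H"] by (auto simp: eH_def fun_eq_iff)

lemma eH_add: "eH (\<lambda>x. f x + g x) = (\<lambda>x. eH f x + eH g x)"
  and eH_diff: "eH (\<lambda>x. f x - g x) = (\<lambda>x. eH f x - eH g x)"
  and eH_scale: "eH (\<lambda>x. c * f x) = (\<lambda>x. c * eH f x)"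
  by (auto simp: eH_def)

text \<open>\<open>G\<^sub>v\<close> splits into the classes of \<open>x \<sim> t \<longleftrightarrow> x t\<^sup>-\<^sup>1 \<in> H\<close>, which are open, so there are only countably
  many of them; points with range outside \<open>H\<close> belong to no class.\<close>
lemma block_partition:
  assumes v: "v \<in> G0"
  shows "\<exists>E :: nat \<Rightarrow> 'g set. (\<forall>n. E n \<in> sets (Mv v)) \<and> (\<forall>j k. j \<noteq> k \<longrightarrow> E j \<inter> E k = {}) \<and>
    (\<forall>n. \<forall>x\<in>E n. \<forall>t\<in>dfib T d v. t \<in> E n \<longleftrightarrow> m x (i t) \<in> H) \<and>
    (\<forall>x\<in>dfib T d v. x \<notin> (\<Union>n. E n) \<longrightarrow> (\<forall>t\<in>dfib T d v. m x (i t) \<notin> H))"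
proof -
  define cls where "cls x = {t \<in> dfib T d v. m x (i t) \<in> H}" for x
  \<comment> \<open>As x x^{-1} = r x, a point is related to itself exactly when its range lies in
    H. The relation is symmetric and transitive everywhere, but reflexive only on
    \<open>Y\<close>.\<close>
  define Y where "Y = {x \<in> dfib T d v. r x \<in> H}"
  have sym: "m t (i x) \<in> H" if "x \<in> dfib T d v" "t \<in> dfib T d v" "m x (i t) \<in> H" for x t
    using i_H[OF that(3)] that by (simp add: dfib_G gsimps i_mult)
  have trans: "m x (i s) \<in> H"
    if "x \<in> dfib T d v" "t \<in> dfib T d v" "s \<in> dfib T d v" "m x (i t) \<in> H" "m t (i s) \<in> H" for x t s
  proof -
    have "m (m x (i t)) (m t (i s)) \<in> H" using that(1-3) by (intro m_H[OF that(4,5)]) (auto simp: dfib_G gsimps)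
    moreover have "m (m x (i t)) (m t (i s)) = m x (i s)"
      using that(1-3) by (simp add: dfib_G gsimps m_assoc i_m_cancel)
    ultimately show ?thesis by simp
  qed
  have rxH: "r x \<in> H" if "x \<in> dfib T d v" "t \<in> dfib T d v" "m x (i t) \<in> H" for x t
    using r_H[OF that(3)] that by (simp add: dfib_G gsimps)
  have clsY: "cls x \<subseteq> Y" if "x \<in> dfib T d v" for x
    using that rxH sym unfolding cls_def Y_def by blast
  have self: "x \<in> cls x" if "x \<in> Y" for x
    using that by (simp add: Y_def cls_def dfib_G m_i)
  have open_cls: "openin (D v) (cls x)" if x: "x \<in> dfib T d v" for x
  proof -
    have "continuous_map (D v) T (\<lambda>t. m x (i t))"
      using x by (intro continuous_map_m continuous_map_i continuous_map_subtopology_id) (auto simp: dfib_G gsimps)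
    from openin_continuous_map_preimage[OF this H_open] show ?thesis
      by (simp only: topspace_dfib cls_def)
  qed
  have "openin (D v) Y"
  proof -
    have "Y = (\<Union>x\<in>Y. cls x)" using self clsY by (auto simp: Y_def)
    moreover have "openin (D v) (\<Union>x\<in>Y. cls x)" using open_cls by (intro openin_Union) (auto simp: Y_def)
    ultimately show ?thesis by simp
  qed
  then have tY: "topspace (subtopology (D v) Y) = Y" using openin_subset by fastforce
  have "Lindelof_space (subtopology (D v) Y)"
    by (intro second_countable_imp_Lindelof_space second_countable_subtopology second_countable_T)
  moreover have "openin (subtopology (D v) Y) U" if UY: "U \<in> cls ` Y" for U
  proof -
    obtain x where x: "x \<in> Y" "U = cls x" using UY by blast
    then have "openin (D v) U" "U \<subseteq> Y" using open_cls clsY by (auto simp: Y_def)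
    then show ?thesis by (metis openin_subtopology_Int inf.absorb1)
  qed
  moreover have "\<Union>(cls ` Y) = topspace (subtopology (D v) Y)"
    unfolding tY using self clsY by (auto simp: Y_def)
  ultimately obtain \<V> where V: "countable \<V>" "\<V> \<subseteq> cls ` Y" "\<Union>\<V> = Y"
    unfolding Lindelof_space_def tY by (metis (no_types, lifting))
  have dis: "A = B" if AB: "A \<in> \<V>" "B \<in> \<V>" "A \<inter> B \<noteq> {}" for A B
  proof -
    obtain x y where xy: "x \<in> Y" "A = cls x" "y \<in> Y" "B = cls y" using AB V(2) by blast
    obtain t where t: "t \<in> cls x" "t \<in> cls y" using AB(3) xy by blast
    have dx: "x \<in> dfib T d v" "y \<in> dfib T d v" "t \<in> dfib T d v" using xy t by (auto simp: Y_def cls_def)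
    have h: "m x (i t) \<in> H" "m y (i t) \<in> H" using t by (auto simp: cls_def)
    have "m x (i y) \<in> H" "m y (i x) \<in> H" using dx h trans sym by blast+
    then have "cls x = cls y" using dx trans unfolding cls_def by blast
    then show ?thesis using xy by simp
  qed
  define E where "E n = (if n \<in> to_nat_on \<V> ` \<V> then from_nat_into \<V> n else {})" for n
  have E\<V>: "E n \<in> \<V> \<or> E n = {}" for n
    using from_nat_into_to_nat_on[OF V(1)] by (auto simp: E_def)
  have \<V>E: "\<exists>n. E n = A" if "A \<in> \<V>" for A
    using that from_nat_into_to_nat_on[OF V(1)] by (intro exI[of _ "to_nat_on \<V> A"]) (simp add: E_def)
  have E_cls: "\<exists>x\<in>Y. E n = cls x" if "y \<in> E n" for y n
    using E\<V>[of n] V(2) that by auto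
  show ?thesis
  proof (intro exI[of _ E] conjI allI ballI impI)
    show "E n \<in> sets (Mv v)" for n
    proof (cases "E n = {}")
      case False
      then obtain x where "x \<in> Y" "E n = cls x" using E_cls by blast
      then show ?thesis using openin_borel_top[OF open_cls] by (auto simp: Y_def)
    qed simp
    show "E j \<inter> E k = {}" if "j \<noteq> k" for j k
    proof (rule ccontr)
      assume ne: "E j \<inter> E k \<noteq> {}"
      then have "E j \<in> \<V>" "E k \<in> \<V>" using E\<V>[of j] E\<V>[of k] by auto
      then have "E j = E k" using dis ne by blast
      moreover have "j \<in> to_nat_on \<V> ` \<V>" "k \<in> to_nat_on \<V> ` \<V>" using ne by (auto simp: E_def split: if_splits)
      ultimately show False
        using \<open>j \<noteq> k\<close> from_nat_into_to_nat_on[OF V(1)] by (auto simp: E_def)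
    qed
    fix n x t assume x: "x \<in> E n" and t: "t \<in> dfib T d v"
    obtain y where y: "y \<in> Y" "E n = cls y" using E_cls[OF x] by blast
    have dd: "x \<in> dfib T d v" "y \<in> dfib T d v" "m y (i x) \<in> H" using x y by (auto simp: cls_def Y_def)
    show "t \<in> E n \<longleftrightarrow> m x (i t) \<in> H"
      unfolding y(2) using dd t trans sym unfolding cls_def by blast
  next
    fix x t assume x: "x \<in> dfib T d v" "x \<notin> (\<Union>n. E n)" and t: "t \<in> dfib T d v"
    show "m x (i t) \<notin> H"
    proof
      assume "m x (i t) \<in> H"
      then have "x \<in> Y" using rxH[OF x(1) t] x(1) by (simp add: Y_def)
      then obtain A where "A \<in> \<V>" "x \<in> A" using V(3) by blast
      then show False using x(2) \<V>E by blast
    qed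
  qed
qed

text \<open>Row x of the restricted kernel is the full row cut to the class of x, so the cut can be
  moved from the function to the vector.\<close>

lemma opr_eH_block:
  assumes x: "x \<in> dfib T d v" and E: "\<And>t. t \<in> dfib T d v \<Longrightarrow> t \<in> E \<longleftrightarrow> m x (i t) \<in> H"
  shows "opr (eH f) v \<xi> x = opr f v (\<lambda>t. if t \<in> E then \<xi> t else 0) x"
  using x E by (auto simp: kop_def eH_def intro!: Bochner_Integration.integral_cong)

lemma opr_eH_off:
  assumes x: "x \<in> dfib T d v" and E: "\<And>t. t \<in> dfib T d v \<Longrightarrow> m x (i t) \<notin> H"
  shows "opr (eH f) v \<xi> x = 0"
  using opr_eH_block[OF x, of "{}"] E by (simp add: kop_def)

text \<open>Passing to the block diagonal is contractive. On a block the image is that of the vector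
  cut to this block, with norm at most \<open>rn f\<close> times that of the cut vector; the squares
  add up over the disjoint blocks, and off the blocks the image vanishes.\<close>

lemma rn_eH: assumes f: "f \<in> Cc T" shows "rn (eH f) \<le> rn f"
proof (rule rn_le[OF eH_Cc[OF f] rn_nonneg])
  fix v \<xi> assume v: "v \<in> G0" and \<xi>: "\<xi> \<in> L2 (Mv v)"
  let ?M = "Mv v"
  obtain E :: "nat \<Rightarrow> 'g set" where E: "\<forall>n. E n \<in> sets ?M" "\<forall>j k. j \<noteq> k \<longrightarrow> E j \<inter> E k = {}"
    "\<forall>n. \<forall>x\<in>E n. \<forall>t\<in>dfib T d v. t \<in> E n \<longleftrightarrow> m x (i t) \<in> H"
    "\<forall>x\<in>dfib T d v. x \<notin> (\<Union>n. E n) \<longrightarrow> (\<forall>t\<in>dfib T d v. m x (i t) \<notin> H)"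
    using block_partition[OF v] by (elim exE conjE) (rule that, assumption+)
  let ?F = "opr (eH f) v \<xi>"
  have F: "?F \<in> L2 ?M" by (rule opr_L2[OF eH_Cc[OF f] v \<xi>])
  define h where "h x = (rn f)\<^sup>2 * (cmod (\<xi> x))\<^sup>2 - (cmod (?F x))\<^sup>2" for x
  have h: "integrable ?M h"
    unfolding h_def using L2_integrable[OF F] L2_integrable[OF \<xi>] by auto
  have "0 \<le> (\<integral>x. h x \<partial>?M)"
  proof (rule integral_nonneg_blocks[OF h])
    show "E n \<in> sets ?M" for n using E by blast
    show "E j \<inter> E k = {}" if "j \<noteq> k" for j k using E that by blast
    show "0 \<le> h x" if "x \<in> space ?M" "x \<notin> (\<Union>n. E n)" for x
      using opr_eH_off[of x v f \<xi>] E(4) that by (simp add: h_def)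
    fix n
    let ?\<eta> = "\<lambda>t. if t \<in> E n then \<xi> t else 0"
    have \<eta>: "?\<eta> \<in> L2 ?M" using L2_indicator[OF \<xi>] E(1) by blast
    have sub: "E n \<subseteq> dfib T d v" using sets.sets_into_space[of "E n" ?M] E(1) by auto
    have *: "indicator (E n) x * h x = (rn f)\<^sup>2 * (cmod (?\<eta> x))\<^sup>2 - indicator (E n) x * (cmod (opr f v ?\<eta> x))\<^sup>2" for x
      using opr_eH_block[of x v "E n" f \<xi>] E(3) sub by (auto simp: h_def split: split_indicator)
    note i1 = L2_integrable[OF \<eta>] and i2 = L2_integrable[OF opr_L2[OF f v \<eta>]]
    have i3: "integrable ?M (\<lambda>x. indicator (E n) x * (cmod (opr f v ?\<eta> x))\<^sup>2)"
      using integrable_mult_indicator[OF _ i2, of "E n"] E(1) by simp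
    \<comment> \<open>The part of the image of the cut vector that leaves the block is
      dropped.\<close>
    have "(\<integral>x. indicator (E n) x * (cmod (opr f v ?\<eta> x))\<^sup>2 \<partial>?M) \<le> (\<integral>x. (cmod (opr f v ?\<eta> x))\<^sup>2 \<partial>?M)"
      by (rule integral_mono[OF i3 i2]) (auto split: split_indicator)
    also have "\<dots> = (n2 ?M (opr f v ?\<eta>))\<^sup>2" by (rule n2_square[symmetric])
    also have "\<dots> \<le> (rn f * n2 ?M ?\<eta>)\<^sup>2" by (intro power_mono rn_bound f v \<eta> n2_nonneg)
    also have "\<dots> = (\<integral>x. (rn f)\<^sup>2 * (cmod (?\<eta> x))\<^sup>2 \<partial>?M)" by (simp add: power_mult_distrib n2_square)
    finally show "0 \<le> (\<integral>x. indicator (E n) x * h x \<partial>?M)"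
      unfolding * using i1 i3 by simp
  qed
  also have "(\<integral>x. h x \<partial>?M) = (rn f * n2 ?M \<xi>)\<^sup>2 - (n2 ?M ?F)\<^sup>2"
    unfolding h_def using L2_integrable[OF F] L2_integrable[OF \<xi>] by (simp add: power_mult_distrib n2_square)
  finally have "(n2 ?M ?F)\<^sup>2 \<le> (rn f * n2 ?M \<xi>)\<^sup>2" by simp
  then show "n2 ?M ?F \<le> rn f * n2 ?M \<xi>"
    by (rule power2_le_imp_le) (simp add: rn_nonneg n2_nonneg)
qed

section \<open>Comparison with the reduced norm of the subgroupoid\<close>

lemma H_sets_D: "H \<inter> dfib T d v \<in> sets (borel_top (D v))"
  using openin_borel_top[OF openin_subtopology_Int[OF H_open], of "dfib T d v"] by simp

lemma H_sets_R: "H \<inter> rfib T r v \<in> sets (borel_top (R v))"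
  using openin_borel_top[OF openin_subtopology_Int[OF H_open], of "rfib T r v"] by simp

text \<open>H is stable under inversion, so restricting to H and pushing forward along the inversion
  commute.\<close>

lemma lam_d_H:
  assumes v: "v \<in> H \<inter> G0"
  shows "lam_d (subtopology T H) d i (restr_haar lam H) v = restrict_space (Mv v) H"
proof -
  have vG: "v \<in> G0" using v by simp
  let ?Y = "subtopology (D v) H" and ?X = "subtopology (R v) H"
  have "dfib (subtopology T H) d v = dfib T d v \<inter> H" using H_G by (auto simp: dfib_def)
  then have Y: "subtopology (subtopology T H) (dfib (subtopology T H) d v) = ?Y"
    by (simp add: subtopology_subtopology Int_ac)
  have sY: "sets (borel_top ?Y) = sets (restrict_space (Mv v) H)"
    using sets_borel_top_subtopology[of H "D v", unfolded topspace_dfib, OF H_sets_D]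
      sets_restrict_space_cong[OF sets_Mv] by simp
  have sX: "sets (restrict_space (lam v) H) = sets (borel_top ?X)"
    using sets_borel_top_subtopology[of H "R v", unfolded topspace_rfib, OF H_sets_R]
      sets_restrict_space_cong[OF sets_lam[OF vG]] by simp
  have "continuous_map ?X ?Y i"
  proof -
    have "continuous_map ?X (D v) i" by (rule continuous_map_from_subtopology[OF continuous_map_inverse_RD])
    then show ?thesis using i_H by (auto simp: continuous_map_in_subtopology)
  qed
  then have im: "i \<in> measurable (restrict_space (lam v) H) (borel_top ?Y)"
    using continuous_map_borel_top measurable_cong_sets[OF sX refl] by blast
  have Hl: "H \<inter> space (lam v) \<in> sets (lam v)"
    using H_sets_R by (simp add: sets_lam[OF vG] space_lam[OF vG])
  have HM: "H \<inter> space (Mv v) \<in> sets (Mv v)" using H_sets_D by simp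
  have "distr (restrict_space (lam v) H) (borel_top ?Y) i = restrict_space (Mv v) H"
  proof (rule measure_eqI)
    show "sets (distr (restrict_space (lam v) H) (borel_top ?Y) i) = sets (restrict_space (Mv v) H)"
      using sY by simp
    fix A assume "A \<in> sets (distr (restrict_space (lam v) H) (borel_top ?Y) i)"
    then have A: "A \<in> sets (borel_top ?Y)" by simp
    then have "A \<in> sets (restrict_space (Mv v) H)" using sY by simp
    then have AM: "A \<in> sets (Mv v)" "A \<subseteq> H"
      using HM by (auto simp: sets_restrict_space_iff)
    have "emeasure (distr (restrict_space (lam v) H) (borel_top ?Y) i) A
        = emeasure (restrict_space (lam v) H) (i -` A \<inter> space (restrict_space (lam v) H))"
      by (rule emeasure_distr[OF im A])
    also have "\<dots> = emeasure (lam v) (i -` A \<inter> space (restrict_space (lam v) H))"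
      using Hl by (intro emeasure_restrict_space) (auto simp: space_restrict_space)
    also have "i -` A \<inter> space (restrict_space (lam v) H) = i -` A \<inter> space (lam v)"
    proof -
      have "x \<in> H" if "x \<in> space (lam v)" "i x \<in> A" for x
        using that AM(2) i_H[of "i x"] by (auto simp: space_lam[OF vG] rfib_G)
      then show ?thesis by (auto simp: space_restrict_space)
    qed
    also have "emeasure (lam v) (i -` A \<inter> space (lam v)) = emeasure (Mv v) A"
      unfolding Mv_eq using AM(1) by (intro emeasure_distr[symmetric] i_measurable_lam[OF vG]) simp
    also have "\<dots> = emeasure (restrict_space (Mv v) H) A"
      using HM AM(2) by (intro emeasure_restrict_space[symmetric])
    finally show "emeasure (distr (restrict_space (lam v) H) (borel_top ?Y) i) A
        = emeasure (restrict_space (Mv v) H) A" .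
  qed
  then show ?thesis by (simp add: lam_d_def restr_haar_def Y)
qed

abbreviation rnH :: "('g \<Rightarrow> complex) \<Rightarrow> real" where
  "rnH \<equiv> rnorm (subtopology T H) (H \<inter> G0) d m i (restr_haar lam H)"

text \<open>A vector on a fibre of H is extended by zero to the fibre of G; the operator of H is
  then the operator of G followed by a cut to H. The inequality makes a sequence that is Cauchy for
  G also Cauchy for H, as membership in \<open>CrH_in_G\<close> demands.\<close>

lemma rnH_le: assumes f: "f \<in> Cc T" shows "rnH f \<le> rn f"
proof -
  have "(SUP v \<in> H \<inter> G0. ind_opnorm_sq (subtopology T H) d m i (restr_haar lam H) v f) \<le> ennreal ((rn f)\<^sup>2)"
  proof (rule SUP_least)
    fix v assume v: "v \<in> H \<inter> G0"
    then have vG: "v \<in> G0" by simp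
    let ?M = "Mv v" and ?N = "restrict_space (Mv v) H"
    have HM: "H \<inter> space ?M \<in> sets ?M" using H_sets_D by simp
    show "ind_opnorm_sq (subtopology T H) d m i (restr_haar lam H) v f \<le> ennreal ((rn f)\<^sup>2)"
      unfolding ind_opnorm_sq_def lam_d_H[OF v]
    proof (rule SUP_least, clarify)
      fix \<xi> assume \<xi>: "\<xi> \<in> borel_measurable ?N" "l2sq ?N \<xi> \<le> 1"
      let ?\<eta> = "\<lambda>t. if t \<in> H then \<xi> t else 0"
      have ind: "ind (subtopology T H) d m i (restr_haar lam H) v f \<xi> x = opr f v ?\<eta> x"
        if x: "x \<in> dfib T d v" for x
      proof -
        have "ind (subtopology T H) d m i (restr_haar lam H) v f \<xi> x = (\<integral>t. f (m x (i t)) * \<xi> t \<partial>?N)"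
          by (simp add: ind_def lam_d_H[OF v])
        also have "\<dots> = (\<integral>t. indicator H t *\<^sub>R (f (m x (i t)) * \<xi> t) \<partial>?M)"
          by (rule integral_restrict_space[OF HM])
        also have "\<dots> = (\<integral>t. f (m x (i t)) * ?\<eta> t \<partial>?M)"
          by (intro Bochner_Integration.integral_cong) (auto split: split_indicator)
        finally show ?thesis using x by (simp add: kop_def)
      qed
      have "(\<lambda>x. indicator H x *\<^sub>R \<xi> x) \<in> borel_measurable ?M"
        using \<xi>(1) borel_measurable_restrict_space_iff[OF HM] by blast
      moreover have "(\<lambda>x. indicator H x *\<^sub>R \<xi> x) = ?\<eta>" by (auto simp: fun_eq_iff)
      ultimately have \<eta>m: "?\<eta> \<in> borel_measurable ?M" by simp
      have "l2sq ?M ?\<eta> = (\<integral>\<^sup>+x. ennreal ((cmod (\<xi> x))\<^sup>2) * indicator H x \<partial>?M)"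
        unfolding l2sq_def by (intro nn_integral_cong) (auto split: split_indicator)
      also have "\<dots> = l2sq ?N \<xi>" unfolding l2sq_def by (rule nn_integral_restrict_space[OF HM, symmetric])
      finally have "l2sq ?M ?\<eta> \<le> 1" using \<xi>(2) by simp
      from unit_ball_L2[OF \<eta>m this] have \<eta>: "?\<eta> \<in> L2 ?M" "n2 ?M ?\<eta> \<le> 1" .
      have "l2sq ?N (ind (subtopology T H) d m i (restr_haar lam H) v f \<xi>)
          = (\<integral>\<^sup>+x. ennreal ((cmod (ind (subtopology T H) d m i (restr_haar lam H) v f \<xi> x))\<^sup>2) * indicator H x \<partial>?M)"
        unfolding l2sq_def by (rule nn_integral_restrict_space[OF HM])
      also have "\<dots> \<le> l2sq ?M (opr f v ?\<eta>)"
        unfolding l2sq_def by (intro nn_integral_mono) (auto simp: ind split: split_indicator)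
      also have "\<dots> = ennreal ((n2 ?M (opr f v ?\<eta>))\<^sup>2)" by (rule l2sq_n2[OF opr_L2[OF f vG \<eta>(1)]])
      also have "\<dots> \<le> ennreal ((rn f)\<^sup>2)"
      proof -
        have "n2 ?M (opr f v ?\<eta>) \<le> rn f"
          using rn_bound[OF f vG \<eta>(1)] mult_left_mono[OF \<eta>(2) rn_nonneg[of f]] by simp
        then show ?thesis by (intro ennreal_leI power_mono n2_nonneg)
      qed
      finally show "l2sq ?N (ind (subtopology T H) d m i (restr_haar lam H) v f \<xi>) \<le> ennreal ((rn f)\<^sup>2)" .
    qed
  qed
  then have "enn2real (SUP v \<in> H \<inter> G0. ind_opnorm_sq (subtopology T H) d m i (restr_haar lam H) v f)
      \<le> enn2real (ennreal ((rn f)\<^sup>2))"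
    by (rule enn2real_mono) (rule ennreal_less_top)
  then show ?thesis
    unfolding rnorm_def[of "subtopology T H"] using rn_nonneg[of f] by (simp add: real_le_lsqrt)
qed

end

section \<open>Matrices over the convolution algebra\<close>

lemma ip2_add_right:
  "\<xi> \<in> L2 M \<Longrightarrow> \<eta> \<in> L2 M \<Longrightarrow> \<zeta> \<in> L2 M \<Longrightarrow> ip2 M \<zeta> (\<lambda>x. \<xi> x + \<eta> x) = ip2 M \<zeta> \<xi> + ip2 M \<zeta> \<eta>"
  unfolding ip2_def distrib_left by (intro Bochner_Integration.integral_add ip2_integrable)

lemma ip2_add_left:
  "\<xi> \<in> L2 M \<Longrightarrow> \<eta> \<in> L2 M \<Longrightarrow> \<zeta> \<in> L2 M \<Longrightarrow> ip2 M (\<lambda>x. \<xi> x + \<eta> x) \<zeta> = ip2 M \<xi> \<zeta> + ip2 M \<eta> \<zeta>"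
  unfolding ip2_def complex_cnj_add distrib_right by (intro Bochner_Integration.integral_add ip2_integrable)

lemma ip2_zero [simp]: "ip2 M \<xi> (\<lambda>x. 0) = 0" "ip2 M (\<lambda>x. 0) \<xi> = 0"
  by (simp_all add: ip2_def)

lemma ip2_sum_right:
  "(\<And>k. k \<in> I \<Longrightarrow> f k \<in> L2 M) \<Longrightarrow> \<zeta> \<in> L2 M \<Longrightarrow> ip2 M \<zeta> (\<lambda>x. \<Sum>k\<in>I. f k x) = (\<Sum>k\<in>I. ip2 M \<zeta> (f k))"
  by (induction I rule: infinite_finite_induct) (auto simp: ip2_add_right L2_sum)

lemma ip2_sum_left:
  "(\<And>k. k \<in> I \<Longrightarrow> f k \<in> L2 M) \<Longrightarrow> \<zeta> \<in> L2 M \<Longrightarrow> ip2 M (\<lambda>x. \<Sum>k\<in>I. f k x) \<zeta> = (\<Sum>k\<in>I. ip2 M (f k) \<zeta>)"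
  by (induction I rule: infinite_finite_induct) (auto simp: ip2_add_left L2_sum)

lemma n2_sum: "(\<And>k. k \<in> I \<Longrightarrow> f k \<in> L2 M) \<Longrightarrow> n2 M (\<lambda>x. \<Sum>k\<in>I. f k x) \<le> (\<Sum>k\<in>I. n2 M (f k))"
proof (induction I rule: infinite_finite_induct)
  case (insert a F)
  have "n2 M (\<lambda>x. f a x + (\<Sum>k\<in>F. f k x)) \<le> n2 M (f a) + n2 M (\<lambda>x. \<Sum>k\<in>F. f k x)"
    using insert.prems by (intro n2_add L2_sum) auto
  then show ?case using insert by simp
qed (auto simp: n2_def)

lemma n2_square_diff:
  assumes "\<xi> \<in> L2 M" "\<eta> \<in> L2 M"
  shows "(n2 M (\<lambda>x. \<xi> x - \<eta> x))\<^sup>2 = (n2 M \<xi>)\<^sup>2 - 2 * Re (ip2 M \<eta> \<xi>) + (n2 M \<eta>)\<^sup>2"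
proof -
  define w where "w x = Re (cnj (\<eta> x) * \<xi> x)" for x
  have w: "integrable M w" "(\<integral>x. w x \<partial>M) = Re (ip2 M \<eta> \<xi>)"
    unfolding w_def ip2_def
    by (rule integrable_Re[OF ip2_integrable[OF assms(2,1)]], rule integral_Re[OF ip2_integrable[OF assms(2,1)]])
  have "(n2 M (\<lambda>x. \<xi> x - \<eta> x))\<^sup>2 = (\<integral>x. (cmod (\<xi> x))\<^sup>2 - 2 * w x + (cmod (\<eta> x))\<^sup>2 \<partial>M)"
    unfolding n2_square w_def
    by (intro Bochner_Integration.integral_cong refl) (simp add: cmod_power2, simp add: power2_eq_square algebra_simps)
  then show ?thesis
    using L2_integrable[OF assms(1)] L2_integrable[OF assms(2)] w by (simp add: n2_square)
qed

context haar_groupoid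
begin

lemma opr_sum:
  assumes f: "f \<in> Cc T" and v: "v \<in> G0"
  shows "(\<And>k. k \<in> I \<Longrightarrow> \<xi> k \<in> L2 (Mv v)) \<Longrightarrow> opr f v (\<lambda>x. \<Sum>k\<in>I. \<xi> k x) = (\<lambda>x. \<Sum>k\<in>I. opr f v (\<xi> k) x)"
  by (induction I rule: infinite_finite_induct) (auto simp: opr_add[OF f v] L2_sum, auto simp: kop_def)

lemma opr_fun_zero: "opr (\<lambda>x. 0) v \<xi> = (\<lambda>x. 0)"
  by (auto simp: kop_def)

lemma opr_fun_sum:
  assumes v: "v \<in> G0" and \<xi>: "\<xi> \<in> L2 (Mv v)"
  shows "(\<And>k. k \<in> I \<Longrightarrow> f k \<in> Cc T) \<Longrightarrow> opr (\<lambda>x. \<Sum>k\<in>I. f k x) v \<xi> = (\<lambda>x. \<Sum>k\<in>I. opr (f k) v \<xi> x)"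
proof (induction I rule: infinite_finite_induct)
  case (insert a F)
  then show ?case using opr_fun_add[of "f a" "\<lambda>x. \<Sum>k\<in>F. f k x", OF _ _ v \<xi>] Cc_sum[of F f T] by simp
qed (auto simp: opr_fun_zero)

text \<open>A tuple of n vectors is encoded as one function on pairs, so that the results on
  seminormed function spaces apply directly. Components of index n or larger are unconstrained and
  do not enter the seminorm \<open>qm\<close>.\<close>

definition Lm :: "nat \<Rightarrow> 'g \<Rightarrow> (nat \<times> 'g \<Rightarrow> complex) set" where
  "Lm n v = {\<xi>. \<forall>p<n. (\<lambda>x. \<xi> (p, x)) \<in> L2 (Mv v)}"

definition qm :: "nat \<Rightarrow> 'g \<Rightarrow> (nat \<times> 'g \<Rightarrow> complex) \<Rightarrow> real" where
  "qm n v \<xi> = L2_set (\<lambda>p. n2 (Mv v) (\<lambda>x. \<xi> (p, x))) {..<n}"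

definition mip :: "nat \<Rightarrow> 'g \<Rightarrow> (nat \<times> 'g \<Rightarrow> complex) \<Rightarrow> (nat \<times> 'g \<Rightarrow> complex) \<Rightarrow> complex" where
  "mip n v \<xi> \<eta> = (\<Sum>p<n. ip2 (Mv v) (\<lambda>x. \<xi> (p, x)) (\<lambda>x. \<eta> (p, x)))"

definition MC :: "nat \<Rightarrow> (nat \<Rightarrow> nat \<Rightarrow> 'g \<Rightarrow> complex) set" where
  "MC n = {A. \<forall>p<n. \<forall>q<n. A p q \<in> Cc T}"

text \<open>The value 0 beyond index n makes composition and linearity hold as equations of
  functions on all pairs.\<close>

definition mop :: "nat \<Rightarrow> 'g \<Rightarrow> (nat \<Rightarrow> nat \<Rightarrow> 'g \<Rightarrow> complex) \<Rightarrow> (nat \<times> 'g \<Rightarrow> complex) \<Rightarrow> nat \<times> 'g \<Rightarrow> complex" where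
  "mop n v A \<xi> = (\<lambda>(p, x). if p < n then \<Sum>q<n. opr (A p q) v (\<lambda>y. \<xi> (q, y)) x else 0)"

definition mmul :: "nat \<Rightarrow> (nat \<Rightarrow> nat \<Rightarrow> 'g \<Rightarrow> complex) \<Rightarrow> (nat \<Rightarrow> nat \<Rightarrow> 'g \<Rightarrow> complex)
    \<Rightarrow> nat \<Rightarrow> nat \<Rightarrow> 'g \<Rightarrow> complex" where
  "mmul n A B = (\<lambda>p q x. \<Sum>k<n. (A p k \<star> B k q) x)"

definition madj :: "(nat \<Rightarrow> nat \<Rightarrow> 'g \<Rightarrow> complex) \<Rightarrow> nat \<Rightarrow> nat \<Rightarrow> 'g \<Rightarrow> complex" where
  "madj A = (\<lambda>p q. invol T i (A q p))"

lemma LmD: "\<xi> \<in> Lm n v \<Longrightarrow> p < n \<Longrightarrow> (\<lambda>x. \<xi> (p, x)) \<in> L2 (Mv v)"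
  by (simp add: Lm_def)

lemma MCD: "A \<in> MC n \<Longrightarrow> p < n \<Longrightarrow> q < n \<Longrightarrow> A p q \<in> Cc T"
  by (simp add: MC_def)

lemma qm_nonneg: "0 \<le> qm n v \<xi>"
  by (simp add: qm_def)

lemma qm_square: "(qm n v \<xi>)\<^sup>2 = (\<Sum>p<n. (n2 (Mv v) (\<lambda>x. \<xi> (p, x)))\<^sup>2)"
  unfolding qm_def L2_set_def by (simp add: sum_nonneg)

lemma n2_le_qm: "p < n \<Longrightarrow> n2 (Mv v) (\<lambda>x. \<xi> (p, x)) \<le> qm n v \<xi>"
  unfolding qm_def using member_le_L2_set[of "{..<n}" p "\<lambda>p. n2 (Mv v) (\<lambda>x. \<xi> (p, x))"] by simp

lemma seminormed_Lm: "seminormed_functions (Lm n v) (qm n v)"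
proof
  fix a b :: "nat \<times> 'g \<Rightarrow> complex" and c
  assume a: "a \<in> Lm n v"
  show "(\<lambda>z. c * a z) \<in> Lm n v" using a L2_scale by (auto simp: Lm_def)
  show "qm n v (\<lambda>z. c * a z) = cmod c * qm n v a"
    by (simp add: qm_def n2_scale L2_set_right_distrib)
  show "0 \<le> qm n v a" by (rule qm_nonneg)
  assume b: "b \<in> Lm n v"
  show "(\<lambda>z. a z + b z) \<in> Lm n v" using a b by (auto simp: Lm_def intro!: L2_add)
  have "qm n v (\<lambda>z. a z + b z)
      \<le> L2_set (\<lambda>p. n2 (Mv v) (\<lambda>x. a (p, x)) + n2 (Mv v) (\<lambda>x. b (p, x))) {..<n}"
    unfolding qm_def using a b by (intro L2_set_mono n2_add n2_nonneg) (auto simp: Lm_def)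
  also have "\<dots> \<le> qm n v a + qm n v b" unfolding qm_def by (rule L2_set_triangle_ineq)
  finally show "qm n v (\<lambda>z. a z + b z) \<le> qm n v a + qm n v b" .
qed (simp add: Lm_def L2_zero)

lemma mop_section: "p < n \<Longrightarrow> (\<lambda>x. mop n v A \<xi> (p, x)) = (\<lambda>x. \<Sum>q<n. opr (A p q) v (\<lambda>y. \<xi> (q, y)) x)"
  by (simp add: mop_def)

lemma mop_Lm: assumes "A \<in> MC n" "v \<in> G0" "\<xi> \<in> Lm n v" shows "mop n v A \<xi> \<in> Lm n v"
  unfolding Lm_def using assms
  by (auto simp: mop_section intro!: L2_sum opr_L2 MCD LmD)

lemma linop_mop:
  assumes A: "A \<in> MC n" and v: "v \<in> G0"
  shows "seminormed_functions.linop (Lm n v) (mop n v A)"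
proof -
  interpret seminormed_functions "Lm n v" "qm n v" by (rule seminormed_Lm)
  show ?thesis
    unfolding linop_def
  proof (intro conjI ballI allI)
    fix a b c assume a: "a \<in> Lm n v"
    show "mop n v A a \<in> Lm n v" by (rule mop_Lm[OF A v a])
    show "mop n v A (\<lambda>z. c * a z) = (\<lambda>z. c * mop n v A a z)"
    proof -
      have "opr (A p q) v (\<lambda>y. c * a (q, y)) = (\<lambda>x. c * opr (A p q) v (\<lambda>y. a (q, y)) x)" for p q
        by (rule opr_scale[OF v])
      then show ?thesis by (auto simp: mop_def fun_eq_iff sum_distrib_left)
    qed
    assume b: "b \<in> Lm n v"
    have "opr (A p q) v (\<lambda>y. a (q, y) + b (q, y)) = (\<lambda>x. opr (A p q) v (\<lambda>y. a (q, y)) x + opr (A p q) v (\<lambda>y. b (q, y)) x)"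
      if "p < n" "q < n" for p q
      using that by (intro opr_add MCD[OF A] v LmD[OF a] LmD[OF b])
    then show "mop n v A (\<lambda>z. a z + b z) = (\<lambda>z. mop n v A a z + mop n v A b z)"
      by (auto simp: mop_def fun_eq_iff sum.distrib)
  qed
qed

lemma mop_add:
  assumes "A \<in> MC n" "B \<in> MC n" "v \<in> G0" "\<xi> \<in> Lm n v"
  shows "mop n v (\<lambda>p q x. A p q x + B p q x) \<xi> = (\<lambda>z. mop n v A \<xi> z + mop n v B \<xi> z)"
  using opr_fun_add[OF MCD[OF assms(1)] MCD[OF assms(2)] assms(3) LmD[OF assms(4)]]
  by (auto simp: mop_def fun_eq_iff sum.distrib)

lemma mop_scale: "v \<in> G0 \<Longrightarrow> mop n v (\<lambda>p q x. c * A p q x) \<xi> = (\<lambda>z. c * mop n v A \<xi> z)"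
  by (auto simp: mop_def fun_eq_iff opr_fun_scale sum_distrib_left)

lemma MC_add: "A \<in> MC n \<Longrightarrow> B \<in> MC n \<Longrightarrow> (\<lambda>p q x. A p q x + B p q x) \<in> MC n"
  and MC_scale: "A \<in> MC n \<Longrightarrow> (\<lambda>p q x. c * A p q x) \<in> MC n"
  and MC_diff: "A \<in> MC n \<Longrightarrow> B \<in> MC n \<Longrightarrow> (\<lambda>p q x. A p q x - B p q x) \<in> MC n"
  and mmul_MC: "A \<in> MC n \<Longrightarrow> B \<in> MC n \<Longrightarrow> mmul n A B \<in> MC n"
  and madj_MC: "A \<in> MC n \<Longrightarrow> madj A \<in> MC n"
  by (auto simp: MC_def mmul_def madj_def intro!: Cc_add Cc_scale Cc_diff Cc_sum conv_Cc invol_Cc)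

lemma mop_diff:
  assumes "A \<in> MC n" "B \<in> MC n" "v \<in> G0" "\<xi> \<in> Lm n v"
  shows "mop n v (\<lambda>p q x. A p q x - B p q x) \<xi> = (\<lambda>z. mop n v A \<xi> z - mop n v B \<xi> z)"
  using mop_add[OF assms(1) MC_scale[OF assms(2), of "-1"] assms(3,4)] mop_scale[OF assms(3), of n "-1" B \<xi>]
  by simp

lemma mop_mmul:
  assumes A: "A \<in> MC n" and B: "B \<in> MC n" and v: "v \<in> G0" and \<xi>: "\<xi> \<in> Lm n v"
  shows "mop n v (mmul n A B) \<xi> = mop n v A (mop n v B \<xi>)"
proof
  fix z :: "nat \<times> 'g" obtain p x where z: "z = (p, x)" by (cases z)
  show "mop n v (mmul n A B) \<xi> z = mop n v A (mop n v B \<xi>) z"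
  proof (cases "p < n")
    case p: True
    note L = opr_L2[OF MCD[OF B] v LmD[OF \<xi>]]
    have "mop n v (mmul n A B) \<xi> z = (\<Sum>q<n. \<Sum>k<n. opr (A p k \<star> B k q) v (\<lambda>y. \<xi> (q, y)) x)"
    proof -
      have "opr (\<lambda>x. \<Sum>k<n. (A p k \<star> B k q) x) v (\<lambda>y. \<xi> (q, y))
          = (\<lambda>x. \<Sum>k<n. opr (A p k \<star> B k q) v (\<lambda>y. \<xi> (q, y)) x)" if "q < n" for q
        using p that by (intro opr_fun_sum[OF v LmD[OF \<xi>]] conv_Cc MCD[OF A] MCD[OF B]) auto
      then show ?thesis unfolding z mop_def mmul_def using p by (auto intro!: sum.cong)
    qed
    also have "\<dots> = (\<Sum>q<n. \<Sum>k<n. opr (A p k) v (opr (B k q) v (\<lambda>y. \<xi> (q, y))) x)"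
    proof -
      have "opr (A p k \<star> B k q) v (\<lambda>y. \<xi> (q, y)) = opr (A p k) v (opr (B k q) v (\<lambda>y. \<xi> (q, y)))"
        if "k < n" "q < n" for k q
        using p that by (intro opr_conv MCD[OF A] MCD[OF B] v LmD[OF \<xi>])
      then show ?thesis by (auto intro!: sum.cong)
    qed
    also have "\<dots> = (\<Sum>k<n. \<Sum>q<n. opr (A p k) v (opr (B k q) v (\<lambda>y. \<xi> (q, y))) x)"
      by (rule sum.swap)
    also have "\<dots> = (\<Sum>k<n. opr (A p k) v (\<lambda>y. \<Sum>q<n. opr (B k q) v (\<lambda>y. \<xi> (q, y)) y) x)"
    proof -
      have "opr (A p k) v (\<lambda>y. \<Sum>q<n. opr (B k q) v (\<lambda>y. \<xi> (q, y)) y)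
          = (\<lambda>x. \<Sum>q<n. opr (A p k) v (opr (B k q) v (\<lambda>y. \<xi> (q, y))) x)" if "k < n" for k
        using p that by (intro opr_sum[OF MCD[OF A] v] L) auto
      then show ?thesis by (auto intro!: sum.cong)
    qed
    also have "\<dots> = mop n v A (mop n v B \<xi>) z"
      unfolding z mop_def using p by (auto intro!: sum.cong)
    finally show ?thesis .
  qed (simp add: z mop_def)
qed

text \<open>Together with \<open>rn_entry_le\<close> this shows that operator norms on tuples and
  norms of the entries control each other. Equality and convergence in the completion are stated for
  entries, the iteration runs on tuples.\<close>

lemma mop_le_entries:
  assumes A: "A \<in> MC n" and v: "v \<in> G0" and \<xi>: "\<xi> \<in> Lm n v"
  shows "qm n v (mop n v A \<xi>) \<le> (\<Sum>p<n. \<Sum>q<n. rn (A p q)) * qm n v \<xi>"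
proof -
  have "qm n v (mop n v A \<xi>) \<le> (\<Sum>p<n. n2 (Mv v) (\<lambda>x. mop n v A \<xi> (p, x)))"
    unfolding qm_def by (rule L2_set_le_sum) (rule n2_nonneg)
  also have "\<dots> \<le> (\<Sum>p<n. \<Sum>q<n. rn (A p q) * qm n v \<xi>)"
  proof (rule sum_mono)
    fix p assume "p \<in> {..<n}"
    then have p: "p < n" by simp
    have "n2 (Mv v) (\<lambda>x. mop n v A \<xi> (p, x)) \<le> (\<Sum>q<n. n2 (Mv v) (opr (A p q) v (\<lambda>y. \<xi> (q, y))))"
      unfolding mop_section[OF p] using p by (intro n2_sum opr_L2 MCD[OF A] v LmD[OF \<xi>]) auto
    also have "\<dots> \<le> (\<Sum>q<n. rn (A p q) * qm n v \<xi>)"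
    proof (rule sum_mono)
      fix q assume "q \<in> {..<n}"
      then have q: "q < n" by simp
      have "n2 (Mv v) (opr (A p q) v (\<lambda>y. \<xi> (q, y))) \<le> rn (A p q) * n2 (Mv v) (\<lambda>y. \<xi> (q, y))"
        by (rule rn_bound[OF MCD[OF A p q] v LmD[OF \<xi> q]])
      also have "\<dots> \<le> rn (A p q) * qm n v \<xi>" by (intro mult_left_mono n2_le_qm q rn_nonneg)
      finally show "n2 (Mv v) (opr (A p q) v (\<lambda>y. \<xi> (q, y))) \<le> rn (A p q) * qm n v \<xi>" .
    qed
    finally show "n2 (Mv v) (\<lambda>x. mop n v A \<xi> (p, x)) \<le> (\<Sum>q<n. rn (A p q) * qm n v \<xi>)" .
  qed
  finally show ?thesis by (simp add: sum_distrib_right)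
qed

lemma rn_entry_le:
  assumes A: "A \<in> MC n" and pq: "p < n" "q < n" and c: "0 \<le> c"
    and b: "\<And>v \<xi>. v \<in> G0 \<Longrightarrow> \<xi> \<in> Lm n v \<Longrightarrow> qm n v (mop n v A \<xi>) \<le> c * qm n v \<xi>"
  shows "rn (A p q) \<le> c"
proof (rule rn_le[OF MCD[OF A pq] c])
  fix v \<xi> assume v: "v \<in> G0" and \<xi>: "\<xi> \<in> L2 (Mv v)"
  \<comment> \<open>Placing a vector in slot q and reading off slot p recovers the entry (p,
    q).\<close>
  define \<eta> where "\<eta> = (\<lambda>(k, x). if k = q then \<xi> x else 0)"
  have \<eta>s: "(\<lambda>x. \<eta> (k, x)) = (if k = q then \<xi> else (\<lambda>x. 0))" for k by (auto simp: \<eta>_def)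
  have \<eta>: "\<eta> \<in> Lm n v" unfolding Lm_def mem_Collect_eq \<eta>s using \<xi> L2_zero by auto
  have z: "n2 (Mv v) (\<lambda>x. 0) = 0" by (simp add: n2_def)
  have "(qm n v \<eta>)\<^sup>2 = (\<Sum>k<n. if k = q then (n2 (Mv v) \<xi>)\<^sup>2 else 0)"
    unfolding qm_square \<eta>s by (intro sum.cong) (auto simp: z)
  then have "(qm n v \<eta>)\<^sup>2 = (n2 (Mv v) \<xi>)\<^sup>2" using pq by simp
  then have q\<eta>: "qm n v \<eta> = n2 (Mv v) \<xi>"
    by (rule power2_eq_imp_eq) (auto simp: qm_nonneg n2_nonneg)
  have "(\<lambda>x. mop n v A \<eta> (p, x)) = (\<lambda>x. \<Sum>k<n. if k = q then opr (A p q) v \<xi> x else 0)"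
    unfolding mop_section[OF pq(1)] \<eta>s by (intro ext sum.cong) (auto simp: kop_def)
  then have "(\<lambda>x. mop n v A \<eta> (p, x)) = opr (A p q) v \<xi>" using pq by simp
  then have "n2 (Mv v) (opr (A p q) v \<xi>) \<le> qm n v (mop n v A \<eta>)"
    using n2_le_qm[OF pq(1), of v "mop n v A \<eta>"] by simp
  also have "\<dots> \<le> c * n2 (Mv v) \<xi>" using b[OF v \<eta>] q\<eta> by simp
  finally show "n2 (Mv v) (opr (A p q) v \<xi>) \<le> c * n2 (Mv v) \<xi>" .
qed

lemma mip_self: "\<xi> \<in> Lm n v \<Longrightarrow> Re (mip n v \<xi> \<xi>) = (qm n v \<xi>)\<^sup>2"
  unfolding mip_def qm_square Re_sum by (intro sum.cong refl) (simp add: ip2_self LmD)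

lemma mop_adjoint:
  assumes A: "A \<in> MC n" and v: "v \<in> G0" and \<xi>: "\<xi> \<in> Lm n v" and \<eta>: "\<eta> \<in> Lm n v"
  shows "mip n v \<eta> (mop n v A \<xi>) = mip n v (mop n v (madj A) \<eta>) \<xi>"
proof -
  have "mip n v \<eta> (mop n v A \<xi>) = (\<Sum>p<n. \<Sum>q<n. ip2 (Mv v) (\<lambda>x. \<eta> (p, x)) (opr (A p q) v (\<lambda>y. \<xi> (q, y))))"
    unfolding mip_def
  proof (rule sum.cong[OF refl])
    fix p assume "p \<in> {..<n}"
    then have p: "p < n" by simp
    show "ip2 (Mv v) (\<lambda>x. \<eta> (p, x)) (\<lambda>x. mop n v A \<xi> (p, x))
        = (\<Sum>q<n. ip2 (Mv v) (\<lambda>x. \<eta> (p, x)) (opr (A p q) v (\<lambda>y. \<xi> (q, y))))"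
      unfolding mop_section[OF p] using p
      by (intro ip2_sum_right opr_L2 MCD[OF A] v LmD[OF \<xi>] LmD[OF \<eta>]) auto
  qed
  also have "\<dots> = (\<Sum>p<n. \<Sum>q<n. ip2 (Mv v) (opr (madj A q p) v (\<lambda>x. \<eta> (p, x))) (\<lambda>y. \<xi> (q, y)))"
    unfolding madj_def by (auto intro!: sum.cong opr_adjoint MCD[OF A] v LmD[OF \<xi>] LmD[OF \<eta>])
  also have "\<dots> = (\<Sum>q<n. \<Sum>p<n. ip2 (Mv v) (opr (madj A q p) v (\<lambda>x. \<eta> (p, x))) (\<lambda>y. \<xi> (q, y)))"
    by (rule sum.swap)
  also have "\<dots> = mip n v (mop n v (madj A) \<eta>) \<xi>"
    unfolding mip_def
  proof (rule sum.cong[OF refl])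
    fix q assume "q \<in> {..<n}"
    then have q: "q < n" by simp
    show "(\<Sum>p<n. ip2 (Mv v) (opr (madj A q p) v (\<lambda>x. \<eta> (p, x))) (\<lambda>y. \<xi> (q, y)))
        = ip2 (Mv v) (\<lambda>x. mop n v (madj A) \<eta> (q, x)) (\<lambda>y. \<xi> (q, y))"
      unfolding mop_section[OF q] using q
      by (intro ip2_sum_left[symmetric] opr_L2 MCD[OF madj_MC[OF A]] v LmD[OF \<xi>] LmD[OF \<eta>]) auto
  qed
  finally show ?thesis .
qed

text \<open>A form of positivity, with a bound, that survives the block diagonal restriction below.\<close>
definition posc :: "nat \<Rightarrow> real \<Rightarrow> (nat \<Rightarrow> nat \<Rightarrow> 'g \<Rightarrow> complex) \<Rightarrow> bool" where
  "posc n K Z \<longleftrightarrow> (\<forall>v\<in>G0. \<forall>\<xi>\<in>Lm n v. (qm n v (mop n v Z \<xi>))\<^sup>2 \<le> K * Re (mip n v (mop n v Z \<xi>) \<xi>))"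

text \<open>With eta = Y xi, the left side is |Y* eta|^2 <= b^2 |eta|^2, and |eta|^2 = <Y*Y xi,
  xi>.\<close>

lemma posc_gram:
  assumes Y: "Y \<in> MC n" and b: "\<And>v \<xi>. v \<in> G0 \<Longrightarrow> \<xi> \<in> Lm n v \<Longrightarrow> qm n v (mop n v (madj Y) \<xi>) \<le> b * qm n v \<xi>"
  shows "posc n (b\<^sup>2) (mmul n (madj Y) Y)"
  unfolding posc_def
proof (intro ballI)
  fix v \<xi> assume v: "v \<in> G0" and \<xi>: "\<xi> \<in> Lm n v"
  let ?\<eta> = "mop n v Y \<xi>"
  have \<eta>: "?\<eta> \<in> Lm n v" by (rule mop_Lm[OF Y v \<xi>])
  have eq: "mop n v (mmul n (madj Y) Y) \<xi> = mop n v (madj Y) ?\<eta>"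
    by (rule mop_mmul[OF madj_MC[OF Y] Y v \<xi>])
  have "(qm n v (mop n v (madj Y) ?\<eta>))\<^sup>2 \<le> (b * qm n v ?\<eta>)\<^sup>2"
    by (intro power_mono b v \<eta> qm_nonneg)
  also have "\<dots> = b\<^sup>2 * Re (mip n v ?\<eta> ?\<eta>)" by (simp add: power_mult_distrib mip_self[OF \<eta>])
  also have "mip n v ?\<eta> ?\<eta> = mip n v (mop n v (madj Y) ?\<eta>) \<xi>" by (rule mop_adjoint[OF Y v \<xi> \<eta>])
  finally show "(qm n v (mop n v (mmul n (madj Y) Y) \<xi>))\<^sup>2 \<le> b\<^sup>2 * Re (mip n v (mop n v (mmul n (madj Y) Y) \<xi>) \<xi>)"
    unfolding eq .
qed

text \<open>For B = A / K the inequality reads |B xi|^2 <= Re <B xi, xi>. Expanding, |xi - B xi|^2 =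
  |xi|^2 - 2 Re <B xi, xi> + |B xi|^2 <= |xi|^2 - |B xi|^2.\<close>

lemma posc_contraction:
  assumes A: "A \<in> MC n" and pos: "posc n K A" and K: "0 < K" and v: "v \<in> G0" and \<xi>: "\<xi> \<in> Lm n v"
  defines "B \<equiv> \<lambda>p q x. complex_of_real (1 / K) * A p q x"
  shows "qm n v (\<lambda>z. \<xi> z - mop n v B \<xi> z) \<le> qm n v \<xi>"
proof -
  let ?M = "Mv v"
  have B: "mop n v B \<xi> = (\<lambda>z. complex_of_real (1 / K) * mop n v A \<xi> z)"
    unfolding B_def by (rule mop_scale[OF v])
  have BL: "mop n v B \<xi> \<in> Lm n v"
    unfolding B by (rule seminormed_functions.L_scale[OF seminormed_Lm mop_Lm[OF A v \<xi>]])
  have q: "qm n v (mop n v B \<xi>) = (1 / K) * qm n v (mop n v A \<xi>)"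
    using seminormed_functions.q_scale[OF seminormed_Lm mop_Lm[OF A v \<xi>], of "complex_of_real (1 / K)"] K
    unfolding B by (simp add: norm_divide)
  have ip: "mip n v (mop n v B \<xi>) \<xi> = complex_of_real (1 / K) * mip n v (mop n v A \<xi>) \<xi>"
    unfolding B mip_def ip2_def by (simp add: sum_divide_distrib)
  have "(qm n v (mop n v A \<xi>))\<^sup>2 \<le> K * Re (mip n v (mop n v A \<xi>) \<xi>)"
    using pos v \<xi> by (simp add: posc_def)
  then have "(qm n v (mop n v B \<xi>))\<^sup>2 \<le> Re (mip n v (mop n v B \<xi>) \<xi>)"
    unfolding q ip using K by (simp add: power_mult_distrib field_simps power2_eq_square)
  moreover have "(qm n v (\<lambda>z. \<xi> z - mop n v B \<xi> z))\<^sup>2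
      = (qm n v \<xi>)\<^sup>2 - 2 * Re (mip n v (mop n v B \<xi>) \<xi>) + (qm n v (mop n v B \<xi>))\<^sup>2"
    unfolding qm_square mip_def Re_sum sum_distrib_left sum_subtractf[symmetric] sum.distrib[symmetric]
    by (intro sum.cong refl n2_square_diff LmD[OF \<xi>] LmD[OF BL]) auto
  ultimately have "(qm n v (\<lambda>z. \<xi> z - mop n v B \<xi> z))\<^sup>2 \<le> (qm n v \<xi>)\<^sup>2"
    using zero_le_power2[of "qm n v (mop n v B \<xi>)"] by linarith
  then show ?thesis by (rule power2_le_imp_le) (rule qm_nonneg)
qed

text \<open>The recursion of \<open>sqD\<close> carried out inside the algebra, with
  \<open>mmul\<close> in place of composition.\<close>

fun msq :: "nat \<Rightarrow> (nat \<Rightarrow> nat \<Rightarrow> 'g \<Rightarrow> complex) \<Rightarrow> nat \<Rightarrow> nat \<Rightarrow> nat \<Rightarrow> 'g \<Rightarrow> complex" where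
  "msq n A 0 = (\<lambda>p q x. 0)"
| "msq n A (Suc k) = (\<lambda>p q x. ((1/2) * A p q x + complex_of_real (sqx k) * msq n A k p q x)
      + (-1/2) * mmul n (msq n A k) (msq n A k) p q x)"

lemma msq_MC: "A \<in> MC n \<Longrightarrow> msq n A k \<in> MC n"
proof (induction k)
  case 0
  then show ?case by (simp add: MC_def Cc_zero)
next
  case (Suc k)
  show ?case unfolding msq.simps by (intro MC_add MC_scale mmul_MC Suc)
qed

lemma mop_msq:
  assumes A: "A \<in> MC n" and v: "v \<in> G0" and "\<xi> \<in> Lm n v"
  shows "mop n v (msq n A k) \<xi> = seminormed_functions.sqD (mop n v A) k \<xi>"
  using \<open>\<xi> \<in> Lm n v\<close>
proof (induction k arbitrary: \<xi>)
  case 0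
  interpret seminormed_functions "Lm n v" "qm n v" by (rule seminormed_Lm)
  show ?case by (auto simp: mop_def opr_fun_zero fun_eq_iff)
next
  case (Suc k)
  interpret seminormed_functions "Lm n v" "qm n v" by (rule seminormed_Lm)
  note S = msq_MC[OF A, of k]
  note x = Suc.prems
  have "mop n v (msq n A (Suc k)) \<xi> = (\<lambda>z. ((1/2) * mop n v A \<xi> z + complex_of_real (sqx k) * mop n v (msq n A k) \<xi> z)
      + (-1/2) * mop n v (msq n A k) (mop n v (msq n A k) \<xi>) z)"
    unfolding msq.simps
    by (simp only: mop_add[OF MC_add[OF MC_scale[OF A] MC_scale[OF S]] MC_scale[OF mmul_MC[OF S S]] v x]
        mop_add[OF MC_scale[OF A] MC_scale[OF S] v x] mop_scale[OF v] mop_mmul[OF S S v x])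
  also have "mop n v (msq n A k) (mop n v (msq n A k) \<xi>) = sqD (mop n v A) k (sqD (mop n v A) k \<xi>)"
    using Suc.IH[OF x] Suc.IH[OF mop_Lm[OF S v x]] by simp
  also have "mop n v (msq n A k) \<xi> = sqD (mop n v A) k \<xi>" by (rule Suc.IH[OF x])
  finally show ?case by (simp add: sqD.simps(2))
qed

lemma invol_add: "invol T i (\<lambda>x. f x + g x) = (\<lambda>x. invol T i f x + invol T i g x)"
  and invol_scale: "invol T i (\<lambda>x. c * f x) = (\<lambda>x. cnj c * invol T i f x)"
  and invol_sum: "invol T i (\<lambda>x. \<Sum>k\<in>I. h k x) = (\<lambda>x. \<Sum>k\<in>I. invol T i (h k) x)"
  by (auto simp: invol_def fun_eq_iff)

lemma invol_invol: "f \<in> Cc T \<Longrightarrow> invol T i (invol T i f) = f"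
  using Cc_outside[of f T] by (auto simp: invol_def fun_eq_iff i_closed)

text \<open>The coefficients of the recursion are real, so the approximate roots of a hermitian
  matrix are hermitian. This turns the product S S into S*S, the form in which positivity is
  defined.\<close>

lemma msq_hermitian:
  assumes A: "A \<in> MC n" and h: "\<And>p q. p < n \<Longrightarrow> q < n \<Longrightarrow> invol T i (A p q) = A q p" and "p < n" "q < n"
  shows "invol T i (msq n A k p q) = msq n A k q p"
  using \<open>p < n\<close> \<open>q < n\<close>
proof (induction k arbitrary: p q)
  case 0
  then show ?case by (simp add: invol_def fun_eq_iff)
next
  case (Suc k)
  note S = MCD[OF msq_MC[OF A, of k]]
  have "invol T i (mmul n (msq n A k) (msq n A k) p q) = mmul n (msq n A k) (msq n A k) q p"
    unfolding mmul_def invol_sum using Suc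
    by (intro ext sum.cong) (auto simp: invol_conv[OF S S])
  then show ?case
    unfolding msq.simps invol_add invol_scale using Suc h by simp
qed

end

context clopen_subgroupoid
begin

text \<open>Here h is the pointwise difference of the two sides. On a block the image F agrees with
  the image N of the tuple cut to the block. Pairing N with the cut tuple sees only that block, so
  the inequality for Z applies; the square of N outside the block is lost, but it stands on the
  smaller side. Off the blocks F vanishes.\<close>

lemma posc_eH:
  assumes Z: "Z \<in> MC n" and pos: "posc n K Z"
  shows "posc n K (\<lambda>p q. eH (Z p q))"
  unfolding posc_def
proof (intro ballI)
  fix v \<xi> assume v: "v \<in> G0" and \<xi>: "\<xi> \<in> Lm n v"
  let ?M = "Mv v"
  let ?F = "mop n v (\<lambda>p q. eH (Z p q)) \<xi>"
  have eZ: "(\<lambda>p q. eH (Z p q)) \<in> MC n" using Z eH_Cc by (simp add: MC_def)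
  have F: "?F \<in> Lm n v" by (rule mop_Lm[OF eZ v \<xi>])
  obtain E :: "nat \<Rightarrow> 'g set" where E: "\<forall>j. E j \<in> sets ?M" "\<forall>j k. j \<noteq> k \<longrightarrow> E j \<inter> E k = {}"
    "\<forall>j. \<forall>x\<in>E j. \<forall>t\<in>dfib T d v. t \<in> E j \<longleftrightarrow> m x (i t) \<in> H"
    "\<forall>x\<in>dfib T d v. x \<notin> (\<Union>j. E j) \<longrightarrow> (\<forall>t\<in>dfib T d v. m x (i t) \<notin> H)"
    using block_partition[OF v] by (elim exE conjE) (rule that, assumption+)
  define h where "h x = (\<Sum>p<n. K * Re (cnj (?F (p, x)) * \<xi> (p, x)) - (cmod (?F (p, x)))\<^sup>2)" for x
  have iip: "integrable ?M (\<lambda>x. Re (cnj (?F (p, x)) * \<xi> (p, x)))" if "p < n" for p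
    using ip2_integrable[OF LmD[OF F that] LmD[OF \<xi> that]] by (rule integrable_Re)
  note isq = L2_integrable[OF LmD[OF F]]
  have h: "integrable ?M h"
    unfolding h_def using iip isq by (intro Bochner_Integration.integrable_sum Bochner_Integration.integrable_diff) auto
  have int_h: "(\<integral>x. h x \<partial>?M) = K * Re (mip n v ?F \<xi>) - (qm n v ?F)\<^sup>2"
  proof -
    have "(\<integral>x. h x \<partial>?M) = (\<Sum>p<n. \<integral>x. K * Re (cnj (?F (p, x)) * \<xi> (p, x)) - (cmod (?F (p, x)))\<^sup>2 \<partial>?M)"
      unfolding h_def using iip isq by (intro Bochner_Integration.integral_sum) auto
    also have "\<dots> = (\<Sum>p<n. K * Re (ip2 ?M (\<lambda>x. ?F (p, x)) (\<lambda>x. \<xi> (p, x))) - (n2 ?M (\<lambda>x. ?F (p, x)))\<^sup>2)"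
    proof (intro sum.cong refl)
      fix p assume "p \<in> {..<n}"
      then have p: "p < n" by simp
      have "(\<integral>x. Re (cnj (?F (p, x)) * \<xi> (p, x)) \<partial>?M) = Re (ip2 ?M (\<lambda>x. ?F (p, x)) (\<lambda>x. \<xi> (p, x)))"
        unfolding ip2_def by (rule integral_Re[OF ip2_integrable[OF LmD[OF F p] LmD[OF \<xi> p]]])
      then show "(\<integral>x. K * Re (cnj (?F (p, x)) * \<xi> (p, x)) - (cmod (?F (p, x)))\<^sup>2 \<partial>?M)
          = K * Re (ip2 ?M (\<lambda>x. ?F (p, x)) (\<lambda>x. \<xi> (p, x))) - (n2 ?M (\<lambda>x. ?F (p, x)))\<^sup>2"
        using iip[OF p] isq[OF p] by (simp add: n2_square del: times_complex.sel)
    qed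
    finally show ?thesis by (simp add: mip_def qm_square sum_subtractf sum_distrib_left)
  qed
  have "0 \<le> (\<integral>x. h x \<partial>?M)"
  proof (rule integral_nonneg_blocks[OF h])
    show "E j \<in> sets ?M" for j using E by blast
    show "E j \<inter> E k = {}" if "j \<noteq> k" for j k using E that by blast
    show "0 \<le> h x" if "x \<in> space ?M" "x \<notin> (\<Union>j. E j)" for x
    proof -
      have x: "x \<in> dfib T d v" using that(1) by simp
      have "opr (eH (Z p q)) v (\<lambda>y. \<xi> (q, y)) x = 0" for p q
        using opr_eH_off[OF x] E(4) x that(2) by blast
      then have "?F (p, x) = 0" for p by (simp add: mop_def)
      then show ?thesis by (simp add: h_def)
    qed
    fix j
    define \<eta> where "\<eta> = (\<lambda>(p, x). if x \<in> E j then \<xi> (p, x) else 0)"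
    have \<eta>s: "(\<lambda>x. \<eta> (p, x)) = (\<lambda>x. if x \<in> E j then \<xi> (p, x) else 0)" for p by (simp add: \<eta>_def)
    have \<eta>: "\<eta> \<in> Lm n v"
      unfolding Lm_def mem_Collect_eq \<eta>s using E(1) LmD[OF \<xi>] by (auto intro!: L2_indicator)
    let ?N = "mop n v Z \<eta>"
    have N: "?N \<in> Lm n v" by (rule mop_Lm[OF Z v \<eta>])
    have sub: "E j \<subseteq> dfib T d v" using sets.sets_into_space[of "E j" ?M] E(1) by auto
    have FN: "?F (p, x) = ?N (p, x)" if x: "x \<in> E j" for p x
    proof -
      have "opr (eH (Z p q)) v (\<lambda>y. \<xi> (q, y)) x = opr (Z p q) v (\<lambda>y. \<eta> (q, y)) x" for q
        unfolding \<eta>s using x E(3) sub by (intro opr_eH_block) auto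
      then show ?thesis by (simp add: mop_def)
    qed
    \<comment> \<open>The tuple \<open>\<eta>\<close> vanishes off the block by itself, so only the
      square carries the indicator.\<close>
    have *: "indicator (E j) x * h x
        = (\<Sum>p<n. K * Re (cnj (?N (p, x)) * \<eta> (p, x)) - indicator (E j) x * (cmod (?N (p, x)))\<^sup>2)" for x
      by (cases "x \<in> E j") (auto simp: h_def FN \<eta>_def)
    have jip: "integrable ?M (\<lambda>x. Re (cnj (?N (p, x)) * \<eta> (p, x)))" if "p < n" for p
      using ip2_integrable[OF LmD[OF N that] LmD[OF \<eta> that]] by (rule integrable_Re)
    note jsq = L2_integrable[OF LmD[OF N]]
    have jsqi: "integrable ?M (\<lambda>x. indicator (E j) x * (cmod (?N (p, x)))\<^sup>2)" if "p < n" for p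
      using integrable_mult_indicator[OF _ jsq[OF that], of "E j"] E(1) by simp
    have "0 \<le> K * Re (mip n v ?N \<eta>) - (qm n v ?N)\<^sup>2"
      using pos v \<eta> by (simp add: posc_def)
    also have "\<dots> = (\<Sum>p<n. K * Re (ip2 ?M (\<lambda>x. ?N (p, x)) (\<lambda>x. \<eta> (p, x))) - (n2 ?M (\<lambda>x. ?N (p, x)))\<^sup>2)"
      by (simp add: mip_def qm_square sum_subtractf sum_distrib_left)
    also have "\<dots> \<le> (\<Sum>p<n. \<integral>x. K * Re (cnj (?N (p, x)) * \<eta> (p, x)) - indicator (E j) x * (cmod (?N (p, x)))\<^sup>2 \<partial>?M)"
    proof (rule sum_mono)
      fix p assume "p \<in> {..<n}"
      then have p: "p < n" by simp
      have 1: "(\<integral>x. Re (cnj (?N (p, x)) * \<eta> (p, x)) \<partial>?M) = Re (ip2 ?M (\<lambda>x. ?N (p, x)) (\<lambda>x. \<eta> (p, x)))"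
        unfolding ip2_def by (rule integral_Re[OF ip2_integrable[OF LmD[OF N p] LmD[OF \<eta> p]]])
      have 2: "(\<integral>x. indicator (E j) x * (cmod (?N (p, x)))\<^sup>2 \<partial>?M) \<le> (n2 ?M (\<lambda>x. ?N (p, x)))\<^sup>2"
        unfolding n2_square by (rule integral_mono[OF jsqi[OF p] jsq[OF p]]) (auto split: split_indicator)
      have "(\<integral>x. K * Re (cnj (?N (p, x)) * \<eta> (p, x)) - indicator (E j) x * (cmod (?N (p, x)))\<^sup>2 \<partial>?M)
          = K * (\<integral>x. Re (cnj (?N (p, x)) * \<eta> (p, x)) \<partial>?M) - (\<integral>x. indicator (E j) x * (cmod (?N (p, x)))\<^sup>2 \<partial>?M)"
        using jip[OF p] jsqi[OF p] by (simp del: times_complex.sel)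
      then show "K * Re (ip2 ?M (\<lambda>x. ?N (p, x)) (\<lambda>x. \<eta> (p, x))) - (n2 ?M (\<lambda>x. ?N (p, x)))\<^sup>2
          \<le> (\<integral>x. K * Re (cnj (?N (p, x)) * \<eta> (p, x)) - indicator (E j) x * (cmod (?N (p, x)))\<^sup>2 \<partial>?M)"
        using 1 2 by simp
    qed
    also have "\<dots> = (\<integral>x. indicator (E j) x * h x \<partial>?M)"
      unfolding * using jip jsqi by (intro Bochner_Integration.integral_sum[symmetric] Bochner_Integration.integrable_diff) auto
    finally show "0 \<le> (\<integral>x. indicator (E j) x * h x \<partial>?M)" .
  qed
  then show "(qm n v ?F)\<^sup>2 \<le> K * Re (mip n v ?F \<xi>)" unfolding int_h by simp
qed

end

section \<open>The conditional expectation\<close>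

text \<open>Being Cauchy becomes a limit along pairs of indices, so that sums and products of Cauchy
  sequences can be treated by the rules for limits.\<close>

lemma cauchy_iff_tendsto_prod:
  fixes f :: "nat \<Rightarrow> nat \<Rightarrow> real"
  assumes "\<And>p q. 0 \<le> f p q"
  shows "(\<forall>\<epsilon>>0. \<exists>K. \<forall>p\<ge>K. \<forall>q\<ge>K. f p q < \<epsilon>) \<longleftrightarrow>
    ((\<lambda>z. f (fst z) (snd z)) \<longlongrightarrow> 0) (sequentially \<times>\<^sub>F sequentially)"
  using assms
  by (auto simp: tendsto_iff eventually_prod_sequentially dist_real_def) blast+

context haar_groupoid
begin

section \<open>Cauchy sequences for the reduced norm\<close>

abbreviation cgap :: "(nat \<Rightarrow> 'g \<Rightarrow> complex) \<Rightarrow> nat \<times> nat \<Rightarrow> real" where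
  "cgap a z \<equiv> rn (\<lambda>x. a (fst z) x - a (snd z) x)"

abbreviation Seq2 :: "(nat \<times> nat) filter" where "Seq2 \<equiv> sequentially \<times>\<^sub>F sequentially"

abbreviation CR :: "(nat \<Rightarrow> 'g \<Rightarrow> complex) set" where "CR \<equiv> CrG T G0 d m i lam"

lemma CR_iff: "a \<in> CR \<longleftrightarrow> (\<forall>n. a n \<in> Cc T) \<and> (cgap a \<longlongrightarrow> 0) Seq2"
  using cauchy_iff_tendsto_prod[of "\<lambda>p q. rn (\<lambda>x. a p x - a q x)"]
  by (simp add: CrG_def cauchy_in_def rn_nonneg)

lemma CR_Cc: "a \<in> CR \<Longrightarrow> a n \<in> Cc T" and CR_gap: "a \<in> CR \<Longrightarrow> (cgap a \<longlongrightarrow> 0) Seq2"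
  by (simp_all add: CR_iff)

lemma CR_I:
  assumes "\<And>n. a n \<in> Cc T" "\<And>z. cgap a z \<le> g z" "(g \<longlongrightarrow> 0) Seq2"
  shows "a \<in> CR"
  unfolding CR_iff
  using tendsto_sandwich[of "\<lambda>_. 0" "cgap a" Seq2 g 0] assms rn_nonneg by auto

lemma CR_bounded:
  assumes a: "a \<in> CR" shows "\<exists>B>0. \<forall>n. rn (a n) \<le> B"
proof -
  have "\<forall>\<epsilon>>0. \<exists>K. \<forall>p\<ge>K. \<forall>q\<ge>K. rn (\<lambda>x. a p x - a q x) < \<epsilon>"
    using a by (simp add: CrG_def cauchy_in_def)
  then obtain K where K: "\<forall>p\<ge>K. \<forall>q\<ge>K. rn (\<lambda>x. a p x - a q x) < 1"
    using zero_less_one by blast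
  let ?B = "(\<Sum>k\<le>K. rn (a k)) + 1"
  have le: "rn (a k) \<le> (\<Sum>k\<le>K. rn (a k))" if "k \<le> K" for k
    using that by (intro member_le_sum) (auto simp: rn_nonneg)
  have "rn (a n) \<le> ?B" for n
  proof (cases "n \<le> K")
    case False
    then have "rn (a n) \<le> rn (a K) + 1"
      using rn_le_add_diff[OF CR_Cc[OF a] CR_Cc[OF a], of n K] K[rule_format, of n K] by simp
    then show ?thesis using le[of K] by simp
  qed (use le in fastforce)
  moreover have "0 < ?B" using le[of 0] rn_nonneg[of "a 0"] by simp
  ultimately show ?thesis by blast
qed

lemma CR_scale: "a \<in> CR \<Longrightarrow> (\<lambda>n x. c * a n x) \<in> CR"
proof (rule CR_I)
  assume a: "a \<in> CR"
  show "(\<lambda>x. c * a n x) \<in> Cc T" for n by (intro Cc_scale CR_Cc a)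
  show "cgap (\<lambda>n x. c * a n x) z \<le> cmod c * cgap a z" for z
    using rn_scale_le[OF Cc_diff[OF CR_Cc[OF a] CR_Cc[OF a]], of c] by (simp add: right_diff_distrib)
  show "((\<lambda>z. cmod c * cgap a z) \<longlongrightarrow> 0) Seq2" using tendsto_mult_left[OF CR_gap[OF a], of "cmod c"] by simp
qed

lemma CR_sum: "(\<And>k. k \<in> I \<Longrightarrow> a k \<in> CR) \<Longrightarrow> (\<lambda>n x. \<Sum>k\<in>I. a k n x) \<in> CR"
proof (induction I rule: infinite_finite_induct)
  case (insert j F)
  let ?s = "\<lambda>n x. \<Sum>k\<in>F. a k n x"
  have j: "a j \<in> CR" and s: "?s \<in> CR" using insert by auto
  have "(\<lambda>n x. a j n x + ?s n x) \<in> CR"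
  proof (rule CR_I)
    show "(\<lambda>x. a j n x + ?s n x) \<in> Cc T" for n by (rule Cc_add[OF CR_Cc[OF j] CR_Cc[OF s]])
    show "cgap (\<lambda>n x. a j n x + ?s n x) z \<le> cgap (a j) z + cgap ?s z" for z
      using rn_add[OF Cc_diff[OF CR_Cc[OF j] CR_Cc[OF j]] Cc_diff[OF CR_Cc[OF s] CR_Cc[OF s]]]
      by (simp add: add_diff_add)
    show "((\<lambda>z. cgap (a j) z + cgap ?s z) \<longlongrightarrow> 0) Seq2"
      using tendsto_add[OF CR_gap[OF j] CR_gap[OF s]] by simp
  qed
  then show ?case using insert.hyps by simp
qed (auto simp: CR_iff Cc_zero rn_zero)

lemma conv_scale_left: "(\<lambda>x. c * f x) \<star> g = (\<lambda>x. c * (f \<star> g) x)"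
  by (auto simp: conv_def fun_eq_iff mult.assoc)

lemma conv_scale_right: "f \<star> (\<lambda>x. c * g x) = (\<lambda>x. c * (f \<star> g) x)"
  by (auto simp: conv_def fun_eq_iff mult.left_commute)

lemma conv_diff_left: "f \<in> Cc T \<Longrightarrow> f' \<in> Cc T \<Longrightarrow> g \<in> Cc T \<Longrightarrow>
    (\<lambda>x. f x - f' x) \<star> g = (\<lambda>x. (f \<star> g) x - (f' \<star> g) x)"
  using conv_add_left[OF _ Cc_scale, of f f' g "-1"] conv_scale_left[of "-1" f' g] by simp

lemma conv_diff_right: "f \<in> Cc T \<Longrightarrow> g \<in> Cc T \<Longrightarrow> g' \<in> Cc T \<Longrightarrow>
    f \<star> (\<lambda>x. g x - g' x) = (\<lambda>x. (f \<star> g) x - (f \<star> g') x)"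
  using conv_add_right[OF _ _ Cc_scale, of f g g' "-1"] conv_scale_right[of f "-1" g'] by simp

lemma rn_conv_diff:
  assumes "f \<in> Cc T" "f' \<in> Cc T" "g \<in> Cc T" "g' \<in> Cc T"
  shows "rn (\<lambda>x. (f \<star> g) x - (f' \<star> g') x) \<le> rn (\<lambda>x. f x - f' x) * rn g + rn f' * rn (\<lambda>x. g x - g' x)"
proof -
  have "rn (\<lambda>x. (f \<star> g) x - (f' \<star> g') x)
      \<le> rn (\<lambda>x. (f \<star> g) x - (f' \<star> g) x) + rn (\<lambda>x. (f' \<star> g) x - (f' \<star> g') x)"
    by (intro rn_triangle conv_Cc assms)
  also have "rn (\<lambda>x. (f \<star> g) x - (f' \<star> g) x) \<le> rn (\<lambda>x. f x - f' x) * rn g"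
    unfolding conv_diff_left[OF assms(1-3), symmetric] by (intro rn_conv Cc_diff assms)
  also have "rn (\<lambda>x. (f' \<star> g) x - (f' \<star> g') x) \<le> rn f' * rn (\<lambda>x. g x - g' x)"
    unfolding conv_diff_right[OF assms(2-4), symmetric] by (intro rn_conv Cc_diff assms)
  finally show ?thesis by simp
qed

lemma CR_mult: assumes a: "a \<in> CR" and b: "b \<in> CR" shows "(\<lambda>n. a n \<star> b n) \<in> CR"
proof -
  obtain A B where A: "0 < A" "\<And>n. rn (a n) \<le> A" and B: "0 < B" "\<And>n. rn (b n) \<le> B"
    using CR_bounded[OF a] CR_bounded[OF b] by blast
  show ?thesis
  proof (rule CR_I)
    show "a n \<star> b n \<in> Cc T" for n by (intro conv_Cc CR_Cc a b)
    show "cgap (\<lambda>n. a n \<star> b n) z \<le> cgap a z * B + A * cgap b z" for z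
    proof -
      have "cgap (\<lambda>n. a n \<star> b n) z \<le> cgap a z * rn (b (fst z)) + rn (a (snd z)) * cgap b z"
        by (intro rn_conv_diff CR_Cc a b)
      also have "\<dots> \<le> cgap a z * B + A * cgap b z"
        by (intro add_mono mult_left_mono mult_right_mono A B rn_nonneg)
      finally show ?thesis .
    qed
    show "((\<lambda>z. cgap a z * B + A * cgap b z) \<longlongrightarrow> 0) Seq2"
      using tendsto_add[OF tendsto_mult_right[OF CR_gap[OF a], of B] tendsto_mult_left[OF CR_gap[OF b], of A]] by simp
  qed
qed

lemma invol_diff: "invol T i (\<lambda>x. f x - g x) = (\<lambda>x. invol T i f x - invol T i g x)"
  by (auto simp: invol_def fun_eq_iff)

lemma CR_star: assumes a: "a \<in> CR" shows "(\<lambda>n. invol T i (a n)) \<in> CR"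
proof (rule CR_I)
  show "invol T i (a n) \<in> Cc T" for n by (intro invol_Cc CR_Cc a)
  show "cgap (\<lambda>n. invol T i (a n)) z \<le> cgap a z" for z
    unfolding invol_diff[symmetric] by (intro rn_invol Cc_diff CR_Cc a)
  show "(cgap a \<longlongrightarrow> 0) Seq2" by (rule CR_gap[OF a])
qed

lemma cr_eq_I:
  assumes "\<And>n. rn (\<lambda>x. a n x - b n x) \<le> g n" "g \<longlonglongrightarrow> 0"
  shows "cr_eq T G0 d m i lam a b"
  unfolding cr_eq_def
  using tendsto_sandwich[of "\<lambda>_. 0" "\<lambda>n. rn (\<lambda>x. a n x - b n x)" sequentially g 0] assms rn_nonneg by auto

lemma cr_eq_refl: "cr_eq T G0 d m i lam a a"
  by (simp add: cr_eq_def rn_zero)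

text \<open>\<open>lim\<close> is unspecified for divergent sequences, so norms in the completion
  can be compared only after this.\<close>

lemma CR_norm_convergent: assumes a: "a \<in> CR" shows "convergent (\<lambda>n. rn (a n))"
proof -
  have "Cauchy (\<lambda>n. rn (a n))"
  proof (rule metric_CauchyI)
    fix e :: real assume "0 < e"
    then obtain K where K: "\<forall>p\<ge>K. \<forall>q\<ge>K. rn (\<lambda>x. a p x - a q x) < e"
      using a unfolding CrG_def cauchy_in_def by blast
    have "dist (rn (a p)) (rn (a q)) < e" if "p \<ge> K" "q \<ge> K" for p q
      using rn_abs_diff[OF CR_Cc[OF a] CR_Cc[OF a], of p q] K that by (fastforce simp: dist_real_def)
    then show "\<exists>M. \<forall>p\<ge>M. \<forall>q\<ge>M. dist (rn (a p)) (rn (a q)) < e" by blast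
  qed
  then show ?thesis by (rule Cauchy_convergent)
qed

text \<open>\<open>N\<close> serves both as the index of the approximant and as the depth of the iteration, so that the
  square root of the limit is represented by a sequence in \<open>Cc\<close>.\<close>
lemma msq_cauchy:
  assumes A: "\<And>N. A N \<in> MC n"
    and c: "\<And>N v \<xi>. v \<in> G0 \<Longrightarrow> \<xi> \<in> Lm n v \<Longrightarrow> qm n v (\<lambda>z. \<xi> z - mop n v (A N) \<xi> z) \<le> qm n v \<xi>"
    and CA: "\<And>p q. p < n \<Longrightarrow> q < n \<Longrightarrow> (\<lambda>N. A N p q) \<in> CR"
    and pq: "p < n" "q < n"
  shows "(\<lambda>N. msq n (A N) N p q) \<in> CR"
proof -
  \<comment> \<open>The sum of the distances of the entries; it dominates the distance of the two
    operators on every fibre.\<close>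
  define \<delta> where "\<delta> z = (\<Sum>p<n. \<Sum>q<n. cgap (\<lambda>N. A N p q) z)" for z
  have \<delta>0: "0 \<le> \<delta> z" for z unfolding \<delta>_def by (intro sum_nonneg rn_nonneg)
  have "(\<delta> \<longlongrightarrow> (\<Sum>p<n. \<Sum>q<n. 0)) Seq2"
    unfolding \<delta>_def using CR_gap[OF CA] by (intro tendsto_sum) auto
  then have \<delta>: "(\<delta> \<longlongrightarrow> 0) Seq2" by simp
  note S = msq_MC[OF A]
  have bound: "rn (\<lambda>x. msq n (A N) N p q x - msq n (A N') N' p q x) \<le> 4 * (1 - sqx k) + real k * \<delta> (N, N')"
    if k: "k \<le> N" "k \<le> N'" for N N' k
  proof (rule rn_entry_le[where A = "\<lambda>p q x. msq n (A N) N p q x - msq n (A N') N' p q x", OF MC_diff[OF S S] pq])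
    show "0 \<le> 4 * (1 - sqx k) + real k * \<delta> (N, N')" using sqx_range[of k] \<delta>0 by simp
    fix v \<xi> assume v: "v \<in> G0" and \<xi>: "\<xi> \<in> Lm n v"
    interpret seminormed_functions "Lm n v" "qm n v" by (rule seminormed_Lm)
    have "qm n v (\<lambda>z. mop n v (A N) \<eta> z - mop n v (A N') \<eta> z) \<le> \<delta> (N, N') * qm n v \<eta>" if "\<eta> \<in> Lm n v" for \<eta>
      using mop_le_entries[OF MC_diff[OF A A] v that, of N N'] unfolding mop_diff[OF A A v that]
      by (simp add: \<delta>_def)
    from sqD_cauchy[OF linop_mop[OF A v] c[OF v] linop_mop[OF A v] c[OF v] this \<delta>0 \<xi> k]
    show "qm n v (mop n v (\<lambda>p q x. msq n (A N) N p q x - msq n (A N') N' p q x) \<xi>)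
        \<le> (4 * (1 - sqx k) + real k * \<delta> (N, N')) * qm n v \<xi>"
      unfolding mop_diff[OF S S v \<xi>] mop_msq[OF A v \<xi>] by simp
  qed
  have "(cgap (\<lambda>N. msq n (A N) N p q) \<longlongrightarrow> 0) Seq2"
  proof (rule tendstoI)
    fix e :: real assume e: "0 < e"
    have "(\<lambda>k. 4 * (1 - sqx k)) \<longlonglongrightarrow> 4 * (1 - 1)" by (intro tendsto_intros sqx_tendsto)
    then have "\<forall>\<^sub>F k in sequentially. 4 * (1 - sqx k) < e / 2"
      using e by (intro order_tendstoD(2)) auto
    then obtain k where k: "4 * (1 - sqx k) < e / 2" using eventually_sequentially by auto
    have "((\<lambda>z. real k * \<delta> z) \<longlongrightarrow> real k * 0) Seq2" by (intro tendsto_intros \<delta>)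
    then have "\<forall>\<^sub>F z in Seq2. real k * \<delta> z < e / 2" using e by (intro order_tendstoD(2)) auto
    moreover have "\<forall>\<^sub>F z in Seq2. k \<le> fst z \<and> k \<le> snd z"
      unfolding eventually_prod_sequentially by (intro exI[of _ k]) auto
    ultimately show "\<forall>\<^sub>F z in Seq2. dist (cgap (\<lambda>N. msq n (A N) N p q) z) 0 < e"
    proof eventually_elim
      case (elim z)
      have "cgap (\<lambda>N. msq n (A N) N p q) z \<le> 4 * (1 - sqx k) + real k * \<delta> z"
        using bound[of k "fst z" "snd z"] elim by simp
      then show ?case using elim k rn_nonneg by (simp add: dist_real_def)
    qed
  qed
  then show ?thesis using MCD[OF S pq] by (simp add: CR_iff)
qed

lemma msq_square:
  assumes A: "A \<in> MC n"
    and c: "\<And>v \<xi>. v \<in> G0 \<Longrightarrow> \<xi> \<in> Lm n v \<Longrightarrow> qm n v (\<lambda>z. \<xi> z - mop n v A \<xi> z) \<le> qm n v \<xi>"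
    and pq: "p < n" "q < n"
  shows "rn (\<lambda>x. mmul n (msq n A k) (msq n A k) p q x - A p q x) \<le> 8 * (1 - sqx k)"
proof (rule rn_entry_le[where A = "\<lambda>p q x. mmul n (msq n A k) (msq n A k) p q x - A p q x", OF _ pq])
  note S = msq_MC[OF A, of k]
  show "(\<lambda>p q x. mmul n (msq n A k) (msq n A k) p q x - A p q x) \<in> MC n"
    by (intro MC_diff mmul_MC S A)
  show "0 \<le> 8 * (1 - sqx k)" using sqx_range[of k] by simp
  fix v \<xi> assume v: "v \<in> G0" and \<xi>: "\<xi> \<in> Lm n v"
  interpret seminormed_functions "Lm n v" "qm n v" by (rule seminormed_Lm)
  show "qm n v (mop n v (\<lambda>p q x. mmul n (msq n A k) (msq n A k) p q x - A p q x) \<xi>) \<le> 8 * (1 - sqx k) * qm n v \<xi>"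
    unfolding mop_diff[OF mmul_MC[OF S S] A v \<xi>] mop_mmul[OF S S v \<xi>]
      mop_msq[OF A v mop_Lm[OF S v \<xi>]]
    unfolding mop_msq[OF A v \<xi>] by (rule sqD_square[OF linop_mop[OF A v] c[OF v] \<xi>])
qed

end

context clopen_subgroupoid
begin

section \<open>The expectation on Cauchy sequences\<close>

abbreviation ce :: "(nat \<Rightarrow> 'g \<Rightarrow> complex) \<Rightarrow> nat \<Rightarrow> 'g \<Rightarrow> complex" where "ce a \<equiv> \<lambda>n. eH (a n)"

abbreviation CRH :: "(nat \<Rightarrow> 'g \<Rightarrow> complex) set" where "CRH \<equiv> CrH_in_G T G0 d m i lam H"

lemma rn_eH_diff: "f \<in> Cc T \<Longrightarrow> g \<in> Cc T \<Longrightarrow> rn (\<lambda>x. eH f x - eH g x) \<le> rn (\<lambda>x. f x - g x)"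
  unfolding eH_diff[symmetric] by (intro rn_eH Cc_diff)

lemma ce_CR: assumes a: "a \<in> CR" shows "ce a \<in> CR"
proof (rule CR_I)
  show "eH (a n) \<in> Cc T" for n by (intro eH_Cc CR_Cc a)
  show "cgap (ce a) z \<le> cgap a z" for z by (intro rn_eH_diff CR_Cc a)
  show "(cgap a \<longlongrightarrow> 0) Seq2" by (rule CR_gap[OF a])
qed

lemma ce_CRH: assumes a: "a \<in> CR" shows "ce a \<in> CRH"
proof -
  have "cauchy_in rnH (Cc (subtopology T H)) (ce a)"
    unfolding cauchy_in_def
  proof (intro conjI allI impI)
    show "eH (a n) \<in> Cc (subtopology T H)" for n by (intro eH_sub CR_Cc a)
    fix \<epsilon> :: real assume "0 < \<epsilon>"
    then obtain K where K: "\<forall>p\<ge>K. \<forall>q\<ge>K. rn (\<lambda>x. eH (a p) x - eH (a q) x) < \<epsilon>"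
      using ce_CR[OF a] unfolding CrG_def cauchy_in_def by blast
    have "rnH (\<lambda>x. eH (a p) x - eH (a q) x) \<le> rn (\<lambda>x. eH (a p) x - eH (a q) x)" for p q
      by (intro rnH_le Cc_diff eH_Cc CR_Cc a)
    then show "\<exists>K. \<forall>p\<ge>K. \<forall>q\<ge>K. rnH (\<lambda>x. eH (a p) x - eH (a q) x) < \<epsilon>"
      using K by (meson order_le_less_trans)
  qed
  then show ?thesis
    unfolding CrH_in_G_def using ce_CR[OF a] cr_eq_refl by blast
qed

text \<open>An element of the subalgebra is merely equal in the completion to a sequence supported
  in H. Facts about it are proved for s and carried over by an estimate.\<close>

lemma CRH_D:
  assumes "b \<in> CRH"
  obtains s where "b \<in> CR" "s \<in> CR" "\<And>n. eH (s n) = s n" "(\<lambda>n. rn (\<lambda>x. b n x - s n x)) \<longlonglongrightarrow> 0"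
proof -
  obtain s where s: "b \<in> CR" "s \<in> CR" "cr_eq T G0 d m i lam b s"
    "cauchy_in rnH (Cc (subtopology T H)) s"
    using assms unfolding CrH_in_G_def by blast
  have "eH (s n) = s n" for n using s(4) by (intro eH_id) (simp add: cauchy_in_def)
  then show thesis using that s by (simp add: cr_eq_def)
qed

lemma invol_eH: "invol T i (eH f) = eH (invol T i f)"
proof -
  have "i x \<in> H \<longleftrightarrow> x \<in> H" if "x \<in> G" for x using i_H[of x] i_H[of "i x"] that by auto
  then show ?thesis using H_G by (auto simp: invol_def eH_def fun_eq_iff)
qed

text \<open>For y in H, the arrow y^{-1} x lies in H exactly when x does, since H is closed under
  products and inverses. Restricting the convolution and restricting its second factor therefore cut
  the same integrals.\<close>

lemma conv_eH_left:
  assumes f: "eH f = f" shows "eH (f \<star> g) = f \<star> eH g"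
proof
  fix x
  have f0: "f y = 0" if "y \<notin> H" for y using fun_cong[OF f, of y] that by (simp add: eH_def)
  show "eH (f \<star> g) x = (f \<star> eH g) x"
  proof (cases "x \<in> G")
    case x: True
    have eq: "f y * eH g (m (i y) x) = (if x \<in> H then f y * g (m (i y) x) else 0)"
      if y: "y \<in> space (lam (r x))" for y
    proof (cases "y \<in> H")
      case True
      have yG: "y \<in> G" "r y = r x" using y x by (auto simp: space_lam rfib_G)
      have "m (i y) x \<in> H \<longleftrightarrow> x \<in> H"
      proof
        assume "m (i y) x \<in> H"
        then have "m y (m (i y) x) \<in> H" using True yG x by (intro m_H[OF True]) (auto simp: gsimps)
        then show "x \<in> H" using yG x by (simp add: m_i_cancel)
      next
        assume "x \<in> H"
        then show "m (i y) x \<in> H" using yG x i_H[OF True] by (intro m_H) (auto simp: gsimps)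
      qed
      then show ?thesis by (simp add: eH_def)
    qed (simp add: f0)
    have "(f \<star> eH g) x = (\<integral>y. (if x \<in> H then f y * g (m (i y) x) else 0) \<partial>lam (r x))"
      using x by (auto simp: conv_def eq intro!: Bochner_Integration.integral_cong)
    then show ?thesis using x by (simp add: eH_def conv_def)
  qed (auto simp: eH_def conv_def)
qed

lemma conv_eH_right:
  assumes g: "eH g = g" shows "eH (f \<star> g) = eH f \<star> g"
proof
  fix x
  have g0: "g y = 0" if "y \<notin> H" for y using fun_cong[OF g, of y] that by (simp add: eH_def)
  show "eH (f \<star> g) x = (eH f \<star> g) x"
  proof (cases "x \<in> G")
    case x: True
    have eq: "eH f y * g (m (i y) x) = (if x \<in> H then f y * g (m (i y) x) else 0)"
      if y: "y \<in> space (lam (r x))" for y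
    proof (cases "m (i y) x \<in> H")
      case True
      have yG: "y \<in> G" "r y = r x" using y x by (auto simp: space_lam rfib_G)
      have "y \<in> H \<longleftrightarrow> x \<in> H"
      proof
        assume yH: "y \<in> H"
        then have "m y (m (i y) x) \<in> H" using True yG x by (intro m_H[OF yH]) (auto simp: gsimps)
        then show "x \<in> H" using yG x by (simp add: m_i_cancel)
      next
        assume xH: "x \<in> H"
        \<comment> \<open>Recovers y as the product of x and the inverse of y^{-1} x.\<close>
        have "i (m (i y) x) = m (i x) y" using yG x by (simp add: i_mult gsimps)
        then have "m x (m (i x) y) \<in> H"
          using i_H[OF True] yG x by (intro m_H[OF xH]) (auto simp: gsimps)
        then show "y \<in> H" using yG x by (simp add: m_i_cancel)
      qed
      then show ?thesis by (simp add: eH_def)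
    qed (simp add: g0)
    have "(eH f \<star> g) x = (\<integral>y. (if x \<in> H then f y * g (m (i y) x) else 0) \<partial>lam (r x))"
      using x by (auto simp: conv_def eq intro!: Bochner_Integration.integral_cong)
    then show ?thesis using x by (simp add: eH_def conv_def)
  qed (auto simp: eH_def conv_def)
qed

text \<open>The identity is exact when the outer factors are supported in H. For limits of such
  functions, a and c are replaced by s and t before the restriction and put back afterwards, at the
  cost \<open>g n\<close> each time.\<close>

lemma ce_bimodule:
  assumes a: "a \<in> CRH" and b: "b \<in> CR" and c: "c \<in> CRH"
  shows "cr_eq T G0 d m i lam (ce (\<lambda>n. a n \<star> b n \<star> c n)) (\<lambda>n. a n \<star> eH (b n) \<star> c n)"
proof -
  obtain s where s: "a \<in> CR" "s \<in> CR" "\<And>n. eH (s n) = s n" "(\<lambda>n. rn (\<lambda>x. a n x - s n x)) \<longlonglongrightarrow> 0"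
    using CRH_D[OF a] by blast
  obtain t where t: "c \<in> CR" "t \<in> CR" "\<And>n. eH (t n) = t n" "(\<lambda>n. rn (\<lambda>x. c n x - t n x)) \<longlonglongrightarrow> 0"
    using CRH_D[OF c] by blast
  obtain B where B: "0 < B" "\<And>n. rn (b n) \<le> B" using CR_bounded[OF b] by blast
  obtain S where S: "0 < S" "\<And>n. rn (s n) \<le> S" using CR_bounded[OF s(2)] by blast
  obtain C where C: "0 < C" "\<And>n. rn (c n) \<le> C" using CR_bounded[OF t(1)] by blast
  note Cs = CR_Cc[OF s(1)] CR_Cc[OF s(2)] CR_Cc[OF t(1)] CR_Cc[OF t(2)] CR_Cc[OF b]
  \<comment> \<open>The cost of replacing both outer factors, uniform over middle factors of norm at
    most B. It serves for \<open>b n\<close> and, restriction being contractive, for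
    \<open>eH (b n)\<close>.\<close>
  define g where "g n = rn (\<lambda>x. a n x - s n x) * B * C + S * B * rn (\<lambda>x. c n x - t n x)" for n
  have perturb: "rn (\<lambda>x. (a n \<star> f \<star> c n) x - (s n \<star> f \<star> t n) x) \<le> g n"
    if f: "f \<in> Cc T" "rn f \<le> B" for f n
  proof -
    let ?as = "rn (\<lambda>x. a n x - s n x)" and ?ct = "rn (\<lambda>x. c n x - t n x)"
    have 1: "rn (\<lambda>x. (a n \<star> f) x - (s n \<star> f) x) \<le> ?as * B"
      using rn_conv_diff[OF Cs(1) Cs(2) f(1) f(1), of n n] mult_left_mono[OF f(2) rn_nonneg, of "\<lambda>x. a n x - s n x"]
      by (simp add: rn_zero)
    have 2: "rn (s n \<star> f) \<le> S * B"
      using rn_conv[OF Cs(2) f(1), of n] mult_mono[OF S(2) f(2) less_imp_le[OF S(1)] rn_nonneg, of n] by linarith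
    have "rn (\<lambda>x. (a n \<star> f \<star> c n) x - (s n \<star> f \<star> t n) x)
        \<le> rn (\<lambda>x. (a n \<star> f) x - (s n \<star> f) x) * rn (c n) + rn (s n \<star> f) * ?ct"
      by (intro rn_conv_diff conv_Cc Cs f)
    also have "\<dots> \<le> (?as * B) * C + (S * B) * ?ct"
      using B(1) S(1) by (intro add_mono mult_mono 1 2 C(2) rn_nonneg mult_nonneg_nonneg order_refl) auto
    finally show ?thesis by (simp add: g_def)
  qed
  show ?thesis
  proof (rule cr_eq_I)
    fix n
    have e: "eH (s n \<star> b n \<star> t n) = s n \<star> eH (b n) \<star> t n"
      by (simp add: conv_eH_right[OF t(3)] conv_eH_left[OF s(3)])
    have "rn (\<lambda>x. eH (a n \<star> b n \<star> c n) x - (a n \<star> eH (b n) \<star> c n) x)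
        \<le> rn (\<lambda>x. eH (a n \<star> b n \<star> c n) x - eH (s n \<star> b n \<star> t n) x)
          + rn (\<lambda>x. (s n \<star> eH (b n) \<star> t n) x - (a n \<star> eH (b n) \<star> c n) x)"
      unfolding e[symmetric] by (intro rn_triangle conv_Cc eH_Cc Cs)
    also have "rn (\<lambda>x. eH (a n \<star> b n \<star> c n) x - eH (s n \<star> b n \<star> t n) x)
        \<le> rn (\<lambda>x. (a n \<star> b n \<star> c n) x - (s n \<star> b n \<star> t n) x)"
      by (intro rn_eH_diff conv_Cc Cs)
    also have "\<dots> \<le> g n" by (intro perturb Cs B)
    also have "rn (\<lambda>x. (s n \<star> eH (b n) \<star> t n) x - (a n \<star> eH (b n) \<star> c n) x)
        = rn (\<lambda>x. (a n \<star> eH (b n) \<star> c n) x - (s n \<star> eH (b n) \<star> t n) x)"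
      by (intro rn_diff_sym conv_Cc eH_Cc Cs)
    also have "\<dots> \<le> g n"
      using rn_eH[OF Cs(5), of n] B(2)[of n] by (intro perturb eH_Cc Cs) linarith
    finally show "rn (\<lambda>x. eH (a n \<star> b n \<star> c n) x - (a n \<star> eH (b n) \<star> c n) x) \<le> 2 * g n" by simp
  next
    have "g \<longlonglongrightarrow> 0 * B * C + S * B * 0"
      unfolding g_def by (intro tendsto_intros s(4) t(4))
    then show "(\<lambda>n. 2 * g n) \<longlonglongrightarrow> 0" using tendsto_mult_left[of g 0 sequentially 2] by simp
  qed
qed

text \<open>X is a limit of Gram matrices \<open>Zn N\<close> over \<open>Cc\<close>. Cauchy
  sequences are bounded, so all of them satisfy the positivity inequality with the same K, and so do
  their restrictions. Rescaling by this fixed K keeps the sequence Cauchy and provides the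
  contractions for the root; the factor of the restricted matrix is then the sequence of approximate
  roots with growing depth.\<close>

lemma ce_positive:
  assumes X: "cr_matrix_pos T G0 r d m i lam n X"
  shows "cr_matrix_pos T G0 r d m i lam n (\<lambda>p q. ce (X p q))"
proof -
  note X' = X[unfolded cr_matrix_pos_def]
  have XC: "X p q \<in> CR" if "p < n" "q < n" for p q
    using conjunct1[OF X'] that by simp
  obtain Y where Y: "\<forall>p<n. \<forall>q<n. Y p q \<in> CR"
    "\<forall>p<n. \<forall>q<n. cr_eq T G0 d m i lam (X p q)
      (cr_sum {..<n} (\<lambda>k. cr_mult T r m i lam (cr_star T i (Y k p)) (Y k q)))"
    using conjunct2[OF X'] by (elim exE conjE) (rule that)
  have YC: "Y p q \<in> CR" if "p < n" "q < n" for p q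
    using Y(1) that by simp
  have XY: "cr_eq T G0 d m i lam (X p q)
      (cr_sum {..<n} (\<lambda>k. cr_mult T r m i lam (cr_star T i (Y k p)) (Y k q)))" if "p < n" "q < n" for p q
    using Y(2) that by simp
  define Yn where "Yn N = (\<lambda>p q. Y p q N)" for N
  define Zn where "Zn N = mmul n (madj (Yn N)) (Yn N)" for N
  have YnM: "Yn N \<in> MC n" for N using CR_Cc[OF YC] by (simp add: MC_def Yn_def)
  note adjM = madj_MC[OF YnM]
  have ZM: "Zn N \<in> MC n" for N unfolding Zn_def by (intro mmul_MC madj_MC YnM)
  have Zseq: "cr_sum {..<n} (\<lambda>k. cr_mult T r m i lam (cr_star T i (Y k p)) (Y k q)) = (\<lambda>N. Zn N p q)" for p q
    by (simp add: cr_sum_def cr_mult_def cr_star_def Zn_def mmul_def madj_def Yn_def)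
  have ZC: "(\<lambda>N. Zn N p q) \<in> CR" if "p < n" "q < n" for p q
    unfolding Zn_def mmul_def madj_def Yn_def using that
    by (intro CR_sum CR_mult CR_star YC) auto
  have XZ: "(\<lambda>N. rn (\<lambda>x. X p q N x - Zn N p q x)) \<longlonglongrightarrow> 0" if "p < n" "q < n" for p q
    using XY[OF that] unfolding Zseq cr_eq_def .
  have "\<exists>B. \<forall>N. p < n \<longrightarrow> q < n \<longrightarrow> rn (Y p q N) \<le> B" for p q
    using CR_bounded[OF YC[of p q]] by blast
  then obtain Bd where Bd: "\<And>p q N. p < n \<Longrightarrow> q < n \<Longrightarrow> rn (Y p q N) \<le> Bd p q" by metis
  \<comment> \<open>The summand 1 makes K positive in all cases, including n = 0. The indices of
    \<open>Bd\<close> are swapped because the adjoint transposes.\<close>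
  define b where "b = 1 + (\<Sum>p<n. \<Sum>q<n. \<bar>Bd q p\<bar>)"
  have b1: "1 \<le> b" unfolding b_def by (simp add: sum_nonneg)
  define K where "K = b\<^sup>2"
  have K: "0 < K" using b1 by (simp add: K_def)
  have "posc n K (Zn N)" for N
    unfolding K_def Zn_def
  proof (rule posc_gram[OF YnM])
    fix v \<xi> assume v: "v \<in> G0" and \<xi>: "\<xi> \<in> Lm n v"
    have "qm n v (mop n v (madj (Yn N)) \<xi>) \<le> (\<Sum>p<n. \<Sum>q<n. rn (madj (Yn N) p q)) * qm n v \<xi>"
      by (rule mop_le_entries[OF adjM v \<xi>])
    also have "(\<Sum>p<n. \<Sum>q<n. rn (madj (Yn N) p q)) \<le> (\<Sum>p<n. \<Sum>q<n. \<bar>Bd q p\<bar>)"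
    proof (intro sum_mono)
      fix p q assume pq: "p \<in> {..<n}" "q \<in> {..<n}"
      have "rn (madj (Yn N) p q) \<le> rn (Y q p N)"
        unfolding madj_def Yn_def using pq by (intro rn_invol CR_Cc YC) auto
      also have "\<dots> \<le> \<bar>Bd q p\<bar>" using Bd[of q p N] pq by auto
      finally show "rn (madj (Yn N) p q) \<le> \<bar>Bd q p\<bar>" .
    qed
    also have "\<dots> \<le> b" by (simp add: b_def)
    finally show "qm n v (mop n v (madj (Yn N)) \<xi>) \<le> b * qm n v \<xi>"
      by (simp add: mult_right_mono qm_nonneg)
  qed
  then have pos: "posc n K (\<lambda>p q. eH (Zn N p q))" for N by (intro posc_eH ZM)
  have eZM: "(\<lambda>p q. eH (Zn N p q)) \<in> MC n" for N using ZM eH_Cc by (simp add: MC_def)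
  define A where "A N = (\<lambda>p q x. complex_of_real (1 / K) * eH (Zn N p q) x)" for N
  have AM: "A N \<in> MC n" for N unfolding A_def by (rule MC_scale[OF eZM])
  have Ac: "qm n v (\<lambda>z. \<xi> z - mop n v (A N) \<xi> z) \<le> qm n v \<xi>" if "v \<in> G0" "\<xi> \<in> Lm n v" for N v \<xi>
    unfolding A_def by (rule posc_contraction[OF eZM pos K that])
  have ACR: "(\<lambda>N. A N p q) \<in> CR" if "p < n" "q < n" for p q
    unfolding A_def by (intro CR_scale ce_CR ZC that)
  have Zh: "invol T i (Zn N p q) = Zn N q p" if "p < n" "q < n" for N p q
    unfolding Zn_def mmul_def invol_sum using that
    by (intro ext sum.cong refl)
      (auto simp: madj_def invol_conv[OF invol_Cc[OF MCD[OF YnM]] MCD[OF YnM]] invol_invol[OF MCD[OF YnM]])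
  have Ah: "invol T i (A N p q) = A N q p" if "p < n" "q < n" for N p q
    unfolding A_def invol_scale invol_eH Zh[OF that] by simp
  define S where "S N = msq n (A N) N" for N
  have SM: "S N \<in> MC n" for N unfolding S_def by (rule msq_MC[OF AM])
  have SCR: "(\<lambda>N. S N p q) \<in> CR" if "p < n" "q < n" for p q
    unfolding S_def by (rule msq_cauchy[OF AM Ac ACR that])
  have Sh: "invol T i (S N p q) = S N q p" if "p < n" "q < n" for N p q
    unfolding S_def by (rule msq_hermitian[OF AM Ah that])
  \<comment> \<open>\<open>A N\<close> is the restricted matrix divided by K, so its root is
    multiplied by sqrt K.\<close>
  define Y' where "Y' p q = (\<lambda>N x. complex_of_real (sqrt K) * S N p q x)" for p q
  have sq: "complex_of_real (sqrt K) * (complex_of_real (sqrt K) * c) = complex_of_real K * c" for c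
    using K by (simp flip: mult.assoc of_real_mult)
  have YS: "cr_sum {..<n} (\<lambda>k. cr_mult T r m i lam (cr_star T i (Y' k p)) (Y' k q))
      = (\<lambda>N x. complex_of_real K * mmul n (S N) (S N) p q x)" if pq: "p < n" "q < n" for p q
  proof (intro ext)
    fix N x
    have "cr_sum {..<n} (\<lambda>k. cr_mult T r m i lam (cr_star T i (Y' k p)) (Y' k q)) N x
        = (\<Sum>k<n. (invol T i (\<lambda>x. complex_of_real (sqrt K) * S N k p x) \<star> (\<lambda>x. complex_of_real (sqrt K) * S N k q x)) x)"
      by (simp add: cr_sum_def cr_mult_def cr_star_def Y'_def)
    also have "\<dots> = (\<Sum>k<n. complex_of_real K * (S N p k \<star> S N k q) x)"
      unfolding invol_scale conv_scale_left conv_scale_right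
      using pq by (intro sum.cong refl) (simp add: Sh sq)
    also have "\<dots> = complex_of_real K * mmul n (S N) (S N) p q x"
      by (simp add: mmul_def sum_distrib_left)
    finally show "cr_sum {..<n} (\<lambda>k. cr_mult T r m i lam (cr_star T i (Y' k p)) (Y' k q)) N x
        = complex_of_real K * mmul n (S N) (S N) p q x" .
  qed
  have main: "cr_eq T G0 d m i lam (ce (X p q)) (\<lambda>N x. complex_of_real K * mmul n (S N) (S N) p q x)"
    if pq: "p < n" "q < n" for p q
  proof (rule cr_eq_I)
    fix N
    note ZN = MCD[OF ZM pq] and XN = CR_Cc[OF XC[OF pq]] and SS = MCD[OF mmul_MC[OF SM SM] pq]
    have eZ: "eH (Zn N p q) = (\<lambda>x. complex_of_real K * A N p q x)"
      using K by (simp add: A_def)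
    have "rn (\<lambda>x. eH (X p q N) x - complex_of_real K * mmul n (S N) (S N) p q x)
        \<le> rn (\<lambda>x. eH (X p q N) x - eH (Zn N p q) x)
          + rn (\<lambda>x. eH (Zn N p q) x - complex_of_real K * mmul n (S N) (S N) p q x)"
      by (intro rn_triangle eH_Cc XN ZN Cc_scale SS)
    also have "rn (\<lambda>x. eH (X p q N) x - eH (Zn N p q) x) \<le> rn (\<lambda>x. X p q N x - Zn N p q x)"
      by (intro rn_eH_diff XN ZN)
    also have "rn (\<lambda>x. eH (Zn N p q) x - complex_of_real K * mmul n (S N) (S N) p q x)
        = rn (\<lambda>x. complex_of_real K * (A N p q x - mmul n (S N) (S N) p q x))"
      unfolding eZ by (simp add: right_diff_distrib)
    also have "\<dots> \<le> K * rn (\<lambda>x. A N p q x - mmul n (S N) (S N) p q x)"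
      using rn_scale_le[OF Cc_diff[OF MCD[OF AM pq] SS], of "complex_of_real K"] K by simp
    also have "rn (\<lambda>x. A N p q x - mmul n (S N) (S N) p q x) = rn (\<lambda>x. mmul n (S N) (S N) p q x - A N p q x)"
      by (intro rn_diff_sym MCD[OF AM pq] SS)
    also have "\<dots> \<le> 8 * (1 - sqx N)"
      unfolding S_def by (rule msq_square[OF AM Ac pq])
    finally show "rn (\<lambda>x. eH (X p q N) x - complex_of_real K * mmul n (S N) (S N) p q x)
        \<le> rn (\<lambda>x. X p q N x - Zn N p q x) + K * (8 * (1 - sqx N))"
      using K by simp
  next
    have "(\<lambda>N. rn (\<lambda>x. X p q N x - Zn N p q x) + K * (8 * (1 - sqx N))) \<longlonglongrightarrow> 0 + K * (8 * (1 - 1))"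
      by (intro tendsto_intros XZ pq sqx_tendsto)
    then show "(\<lambda>N. rn (\<lambda>x. X p q N x - Zn N p q x) + K * (8 * (1 - sqx N))) \<longlonglongrightarrow> 0" by simp
  qed
  show ?thesis
    unfolding cr_matrix_pos_def
  proof (intro conjI allI impI exI[of _ Y'])
    show "ce (X p q) \<in> CR" if "p < n" "q < n" for p q by (intro ce_CR XC that)
    show "Y' p q \<in> CR" if "p < n" "q < n" for p q
      unfolding Y'_def by (intro CR_scale SCR that)
    show "cr_eq T G0 d m i lam (ce (X p q))
        (cr_sum {..<n} (\<lambda>k. cr_mult T r m i lam (cr_star T i (Y' k p)) (Y' k q)))" if "p < n" "q < n" for p q
      unfolding YS[OF that] by (rule main[OF that])
  qed
qed

lemma cond_exp: "is_cond_exp T G0 r d m i lam CRH ce"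
  unfolding is_cond_exp_def Let_def
proof (intro conjI ballI allI impI)
  show "ce a \<in> CRH" if "a \<in> CR" for a by (rule ce_CRH[OF that])
  show "cr_eq T G0 d m i lam (ce a) (ce b)" if "a \<in> CR" "b \<in> CR" "cr_eq T G0 d m i lam a b" for a b
    by (rule cr_eq_I[OF rn_eH_diff[OF CR_Cc[OF that(1)] CR_Cc[OF that(2)]]]) (use that(3) in \<open>simp add: cr_eq_def\<close>)
  show "cr_eq T G0 d m i lam (ce (cr_add a b)) (cr_add (ce a) (ce b))" for a b
    by (simp add: cr_add_def eH_add cr_eq_refl)
  show "cr_eq T G0 d m i lam (ce (cr_scale c a)) (cr_scale c (ce a))" for c a
    by (simp add: cr_scale_def eH_scale cr_eq_refl)
  show "cr_norm T G0 d m i lam (ce a) \<le> cr_norm T G0 d m i lam a" if a: "a \<in> CR" for a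
    unfolding cr_norm_def
    by (rule LIMSEQ_le[OF CR_norm_convergent[OF ce_CR[OF a], THEN convergent_LIMSEQ_iff[THEN iffD1]]
          CR_norm_convergent[OF a, THEN convergent_LIMSEQ_iff[THEN iffD1]]])
      (use rn_eH[OF CR_Cc[OF a]] in auto)
  show "cr_matrix_pos T G0 r d m i lam n (\<lambda>p q. ce (X p q))" if "cr_matrix_pos T G0 r d m i lam n X" for n X
    by (rule ce_positive[OF that])
  show "cr_eq T G0 d m i lam (ce b) b" if b: "b \<in> CRH" for b
  proof -
    obtain s where s: "b \<in> CR" "s \<in> CR" "\<And>n. eH (s n) = s n" "(\<lambda>n. rn (\<lambda>x. b n x - s n x)) \<longlonglongrightarrow> 0"
      using CRH_D[OF b] by blast
    note Cs = CR_Cc[OF s(1)] CR_Cc[OF s(2)]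
    show ?thesis
    proof (rule cr_eq_I)
      fix n
      \<comment> \<open>Restriction fixes \<open>s n\<close> and is contractive, so it moves
        \<open>b n\<close> by at most twice the distance to \<open>s n\<close>.\<close>
      have "rn (\<lambda>x. eH (b n) x - b n x) \<le> rn (\<lambda>x. eH (b n) x - s n x) + rn (\<lambda>x. s n x - b n x)"
        by (intro rn_triangle eH_Cc Cs)
      also have "rn (\<lambda>x. eH (b n) x - s n x) \<le> rn (\<lambda>x. b n x - s n x)"
        using rn_eH_diff[OF Cs, of n n] by (simp add: s(3))
      also have "rn (\<lambda>x. s n x - b n x) = rn (\<lambda>x. b n x - s n x)" by (intro rn_diff_sym Cs)
      finally show "rn (\<lambda>x. eH (b n) x - b n x) \<le> 2 * rn (\<lambda>x. b n x - s n x)" by simp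
    next
      show "(\<lambda>n. 2 * rn (\<lambda>x. b n x - s n x)) \<longlonglongrightarrow> 0" using tendsto_mult_left[OF s(4), of 2] by simp
    qed
  qed
  show "cr_eq T G0 d m i lam (ce (cr_mult T r m i lam (cr_mult T r m i lam a b) c))
      (cr_mult T r m i lam (cr_mult T r m i lam a (ce b)) c)" if "a \<in> CRH" "b \<in> CR" "c \<in> CRH" for a b c
    using ce_bimodule[OF that] by (simp add: cr_mult_def)
qed

end

theorem theorem6p2:
  fixes T :: "'g topology" and G0 H :: "'g set"
    and r d i :: "'g \<Rightarrow> 'g" and m :: "'g \<Rightarrow> 'g \<Rightarrow> 'g"
    and lam :: "'g \<Rightarrow> 'g measure"
  assumes "lc_groupoid T G0 r d m i lam"
    and "subgroupoid (topspace T) r d m i H"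
    and "openin T H" and "closedin T H"
  shows "\<exists>e. is_cond_exp T G0 r d m i lam (CrH_in_G T G0 d m i lam H) e"
proof -
  interpret clopen_subgroupoid T G0 r d i m lam H
    by unfold_locales (rule assms)+
  show ?thesis using cond_exp by blast
qed

end
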